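(* For any ring $R$, the following statements are equivalent: (a) $(\mathcal{I}(R)^\vee,\mathcal{DI}(R))$ is a hereditary complete cotorsion pair in $\mathrm{Mod}(R)$, and $\mathrm{pd}(\mathcal{I}(R))<\infty$. (b) $\mathcal{DI}(R)=\mathcal{I}(R)^\perp$ and $\mathrm{pd}(\mathcal{I}(R))<\infty$. (c) $\mathrm{gl.DID}(R)<\infty$. Moreover, if one of the conditions (a), (b), (c) holds true, then $$\mathrm{gl.DID}(R)=\mathrm{pd}(\mathcal{AP}(R))=\mathrm{pd}(\mathcal{I}(R)).$$
   Context: $R$ is an associative ring with identity, $\mathrm{Mod}(R)$ the category of left $R$-modules, $\mathcal{I}(R)$ the class of injective modules, $\mathcal{I}(R)^\vee$ the class of modules with finite injective dimension. $\mathcal{AP}(R)$ is the class of absolutely pure (FP-injective) modules: $M$ with $\mathrm{Ext}^1_R(F,M)=0$ for every finitely presented $F$. $\mathcal{DI}(R)$ is the class of Ding injective modules: cycles of exact complexes $I$ of injective modules such that $\mathrm{Hom}_R(E,I)$ is exact for every $E\in\mathcal{AP}(R)$. The Ding injective dimension of $M$ is the smallest $k\ge0$ with an exact sequence $0\to M\to D_0\to\cdots\to D_k\to0$, $D_j\in\mathcal{DI}(R)$ ($\infty$ if none); $\mathrm{gl.DID}(R)$ is the supremum of these over all $M\in\mathrm{Mod}(R)$. For a class $\mathcal{X}$, $\mathrm{pd}(\mathcal{X})=\sup\{\mathrm{pd}(X):X\in\mathcal{X}\}$ and $\mathcal{X}^\perp=\{N:\mathrm{Ext}^i_R(X,N)=0\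 \forall X\in\mathcal{X},\ \forall i\ge1\}$. A complete cotorsion pair $(\mathcal{A},\mathcal{B})$ in $\mathrm{Mod}(R)$: $\mathcal{A}=\{X:\mathrm{Ext}^1_R(X,\mathcal{B})=0\}$, $\mathcal{B}=\{Y:\mathrm{Ext}^1_R(\mathcal{A},Y)=0\}$, and every module $C$ fits in short exact sequences $0\to B\to A\to C\to0$ and $0\to C\to B'\to A'\to0$ with $A,A'\in\mathcal{A}$, $B,B'\in\mathcal{B}$. It is hereditary if $\mathcal{A}$ is closed under kernels of epimorphisms between its objects and $\mathcal{B}$ is closed under cokernels of monomorphisms between its objects. *)

theory Defs
  imports
    "HOL-Algebra.Module"
    "HOL-Algebra.Coset"
    "HOL-Algebra.Elementary_Groups"
    "HOL-Library.Equipollence"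
    "HOL-Library.Extended_Nat"
begin

section \<open>Left modules over an associative ring with identity\<close>

text \<open>The locale \<open>module\<close> of HOL-Algebra requires a commutative ring, so the module axioms are
  restated here over \<open>ring\<close>. Of the record \<open>module\<close> only the additive structure and \<open>smult\<close>
  are ever used; the ring multiplication that the record also carries is irrelevant junk.\<close>

locale left_module = R?: ring R + M?: abelian_group M
  for R (structure) and M (structure) +
  assumes smult_closed:
      "\<lbrakk>a \<in> carrier R; x \<in> carrier M\<rbrakk> \<Longrightarrow> a \<odot>\<^bsub>M\<^esub> x \<in> carrier M"
    and smult_l_distr:
      "\<lbrakk>a \<in> carrier R; b \<in> carrier R; x \<in> carrier M\<rbrakk> \<Longrightarrow>
        (a \<oplus> b) \<odot>\<^bsub>M\<^esub> x = a \<odot>\<^bsub>M\<^esub> x \<oplus>\<^bsub>M\<^esub> b \<odot>\<^bsub>M\<^esub> x"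
    and smult_r_distr:
      "\<lbrakk>a \<in> carrier R; x \<in> carrier M; y \<in> carrier M\<rbrakk> \<Longrightarrow>
        a \<odot>\<^bsub>M\<^esub> (x \<oplus>\<^bsub>M\<^esub> y) = a \<odot>\<^bsub>M\<^esub> x \<oplus>\<^bsub>M\<^esub> a \<odot>\<^bsub>M\<^esub> y"
    and smult_assoc:
      "\<lbrakk>a \<in> carrier R; b \<in> carrier R; x \<in> carrier M\<rbrakk> \<Longrightarrow>
        (a \<otimes> b) \<odot>\<^bsub>M\<^esub> x = a \<odot>\<^bsub>M\<^esub> (b \<odot>\<^bsub>M\<^esub> x)"
    and smult_one:
      "x \<in> carrier M \<Longrightarrow> \<one> \<odot>\<^bsub>M\<^esub> x = x"

text \<open>HOL cannot quantify over all types inside a formula, so \<open>Mod(R)\<close> is formed relative to a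
  universe \<open>U\<close> of admissible (``small'') carrier sets. The only requirements on \<open>U\<close> are that
  it is closed under passing to sets of no larger size, is closed (up to bijection) under products
  indexed by \<open>R \<times> \<nat>\<close>, and contains a set with at least two elements. If the elements of \<open>'m\<close>
  are the sets of a model of set theory containing \<open>R\<close> and \<open>U\<close> consists of the small collections,
  this is literally the category of all left \<open>R\<close>-modules; Grothendieck universes containing \<open>R\<close>
  are covered too.\<close>

definition module_universe :: "('r, 'x) ring_scheme \<Rightarrow> 'm set set \<Rightarrow> bool" where
  "module_universe R U \<longleftrightarrow>
     (\<exists>A\<in>U. \<exists>x\<in>A. \<exists>y\<in>A. x \<noteq> y) \<and>
     (\<forall>A\<in>U. \<forall>B. B \<lesssim> A \<longrightarrow> B \<in> U) \<and>
     (\<forall>F. (\<forall>i \<in> carrier R \<times> (UNIV :: nat set). F i \<in> U) \<longrightarrow>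
        (\<exists>B\<in>U. (\<Pi>\<^sub>E i \<in> carrier R \<times> (UNIV :: nat set). F i) \<lesssim> B))"

text \<open>Over every ring such a universe exists already in HOL.\<close>

lemma module_universe_exists:
  fixes R :: "('r, 'x) ring_scheme"
  shows "module_universe R (UNIV :: ('r \<times> nat \<Rightarrow> bool) set set)"
proof -
  have "infinite (UNIV :: ('r \<times> nat) set)"
    by (simp add: finite_prod)
  from card_of_Times_same_infinite[OF this]
  obtain e :: "('r \<times> nat) \<times> ('r \<times> nat) \<Rightarrow> 'r \<times> nat" where "bij_betw e (UNIV \<times> UNIV) UNIV"
    unfolding card_of_ordIso[symmetric] by blast
  then have inv: "inv_into UNIV e (e p) = p" for p
    by (auto simp: bij_betw_def)
  let ?g = "\<lambda>f :: 'r \<times> nat \<Rightarrow> 'r \<times> nat \<Rightarrow> bool. \<lambda>q. case inv_into UNIV e q of (i, j) \<Rightarrow> f i j"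
  have "inj ?g"
  proof (rule injI, intro ext)
    fix f h i j
    assume "?g f = ?g h"
    then have "?g f (e (i, j)) = ?g h (e (i, j))"
      by (rule fun_cong)
    then show "f i j = h i j"
      by (simp add: inv)
  qed
  then have "A \<lesssim> (UNIV :: ('r \<times> nat \<Rightarrow> bool) set)" for A :: "('r \<times> nat \<Rightarrow> 'r \<times> nat \<Rightarrow> bool) set"
    unfolding lepoll_def by (intro exI[of _ ?g]) (auto intro: inj_on_subset)
  moreover have "(\<lambda>_. True) \<noteq> (\<lambda>_ :: 'r \<times> nat. False)"
    by (simp add: fun_eq_iff)
  ultimately show ?thesis
    unfolding module_universe_def by blast
qed

definition Mod_cat :: "('r, 'x) ring_scheme \<Rightarrow> 'm set set \<Rightarrow> ('r, 'm) module set" where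
  "Mod_cat R U = {M. left_module R M \<and> carrier M \<in> U}"


section \<open>Homomorphisms and exactness\<close>

text \<open>Homomorphisms are extensional, so that equality of functions is equality of morphisms.\<close>

definition Hom ::
    "('r, 'x) ring_scheme \<Rightarrow> ('r, 'm) module \<Rightarrow> ('r, 'm) module \<Rightarrow> ('m \<Rightarrow> 'm) set" where
  "Hom R M N = {f \<in> carrier M \<rightarrow>\<^sub>E carrier N.
     (\<forall>x\<in>carrier M. \<forall>y\<in>carrier M. f (x \<oplus>\<^bsub>M\<^esub> y) = f x \<oplus>\<^bsub>N\<^esub> f y) \<and>
     (\<forall>a\<in>carrier R. \<forall>x\<in>carrier M. f (a \<odot>\<^bsub>M\<^esub> x) = a \<odot>\<^bsub>N\<^esub> f x)}"

definition Hom_group ::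
    "('r, 'x) ring_scheme \<Rightarrow> ('r, 'm) module \<Rightarrow> ('r, 'm) module \<Rightarrow> ('m \<Rightarrow> 'm) monoid" where
  "Hom_group R M N =
     \<lparr>carrier = Hom R M N,
      mult = (\<lambda>f g. \<lambda>x\<in>carrier M. f x \<oplus>\<^bsub>N\<^esub> g x),
      one = (\<lambda>x\<in>carrier M. \<zero>\<^bsub>N\<^esub>)\<rparr>"

definition isomorphic_modules ::
    "('r, 'x) ring_scheme \<Rightarrow> ('r, 'm) module \<Rightarrow> ('r, 'm) module \<Rightarrow> bool" where
  "isomorphic_modules R M N \<longleftrightarrow> (\<exists>f \<in> Hom R M N. bij_betw f (carrier M) (carrier N))"

definition kernel_of :: "('r, 'm) module \<Rightarrow> ('m \<Rightarrow> 'm) \<Rightarrow> ('r, 'm) module \<Rightarrow> 'm set" where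
  "kernel_of M f N = {x \<in> carrier M. f x = \<zero>\<^bsub>N\<^esub>}"

definition kernel_module ::
    "('r, 'm) module \<Rightarrow> ('m \<Rightarrow> 'm) \<Rightarrow> ('r, 'm) module \<Rightarrow> ('r, 'm) module" where
  "kernel_module M f N = M\<lparr>carrier := kernel_of M f N\<rparr>"

definition exact_at ::
    "('r, 'm) module \<Rightarrow> ('m \<Rightarrow> 'm) \<Rightarrow> ('r, 'm) module \<Rightarrow> ('m \<Rightarrow> 'm) \<Rightarrow> ('r, 'm) module \<Rightarrow> bool" where
  "exact_at L f M g N \<longleftrightarrow> f ` carrier L = kernel_of M g N"

definition short_exact ::
    "('r, 'x) ring_scheme \<Rightarrow> ('r, 'm) module \<Rightarrow> ('r, 'm) module \<Rightarrow> ('r, 'm) module \<Rightarrow> bool" where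
  "short_exact R L M N \<longleftrightarrow> (\<exists>f \<in> Hom R L M. \<exists>g \<in> Hom R M N.
     inj_on f (carrier L) \<and> exact_at L f M g N \<and> g ` carrier M = carrier N)"

text \<open>\<open>exact_sequence R n Y d\<close>: the sequence
  \<open>0 \<rightarrow> Y 0 \<rightarrow> Y 1 \<rightarrow> \<dots> \<rightarrow> Y (n + 1) \<rightarrow> 0\<close> with maps \<open>d j : Y j \<rightarrow> Y (j + 1)\<close> is exact.\<close>

definition exact_sequence ::
    "('r, 'x) ring_scheme \<Rightarrow> nat \<Rightarrow> (nat \<Rightarrow> ('r, 'm) module) \<Rightarrow> (nat \<Rightarrow> 'm \<Rightarrow> 'm) \<Rightarrow> bool" where
  "exact_sequence R n Y d \<longleftrightarrow>
     (\<forall>j\<le>n. d j \<in> Hom R (Y j) (Y (Suc j))) \<and>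
     inj_on (d 0) (carrier (Y 0)) \<and>
     (\<forall>j<n. exact_at (Y j) (d j) (Y (Suc j)) (d (Suc j)) (Y (Suc (Suc j)))) \<and>
     d n ` carrier (Y n) = carrier (Y (Suc n))"


section \<open>Projective, injective and finitely presented modules; dimensions\<close>

definition Proj :: "('r, 'x) ring_scheme \<Rightarrow> 'm set set \<Rightarrow> ('r, 'm) module set" where
  "Proj R U = {P \<in> Mod_cat R U. \<forall>A \<in> Mod_cat R U. \<forall>B \<in> Mod_cat R U.
     \<forall>p \<in> Hom R A B. \<forall>f \<in> Hom R P B. p ` carrier A = carrier B \<longrightarrow>
       (\<exists>g \<in> Hom R P A. compose (carrier P) p g = f)}"

definition Inj :: "('r, 'x) ring_scheme \<Rightarrow> 'm set set \<Rightarrow> ('r, 'm) module set" where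
  "Inj R U = {E \<in> Mod_cat R U. \<forall>A \<in> Mod_cat R U. \<forall>B \<in> Mod_cat R U.
     \<forall>i \<in> Hom R A B. \<forall>f \<in> Hom R A E. inj_on i (carrier A) \<longrightarrow>
       (\<exists>g \<in> Hom R B E. compose (carrier A) g i = f)}"

definition fg_free :: "('r, 'x) ring_scheme \<Rightarrow> ('r, 'm) module \<Rightarrow> bool" where
  "fg_free R M \<longleftrightarrow> (\<exists>B. finite B \<and> B \<subseteq> carrier M \<and>
     (\<forall>x \<in> carrier M. \<exists>!c. c \<in> B \<rightarrow>\<^sub>E carrier R \<and> x = (\<Oplus>\<^bsub>M\<^esub>b\<in>B. c b \<odot>\<^bsub>M\<^esub> b)))"

definition fin_pres :: "('r, 'x) ring_scheme \<Rightarrow> 'm set set \<Rightarrow> ('r, 'm) module set" where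
  "fin_pres R U = {F \<in> Mod_cat R U.
     \<exists>F\<^sub>1 \<in> Mod_cat R U. \<exists>F\<^sub>0 \<in> Mod_cat R U. fg_free R F\<^sub>1 \<and> fg_free R F\<^sub>0 \<and>
       (\<exists>f \<in> Hom R F\<^sub>1 F\<^sub>0. \<exists>g \<in> Hom R F\<^sub>0 F.
          exact_at F\<^sub>1 f F\<^sub>0 g F \<and> g ` carrier F\<^sub>0 = carrier F)}"

text \<open>Least \<open>k\<close> such that there is an exact sequence \<open>0 \<rightarrow> M \<rightarrow> D\<^sub>0 \<rightarrow> \<dots> \<rightarrow> D\<^sub>k \<rightarrow> 0\<close> with all
  \<open>D\<^sub>j\<close> in the class \<open>C\<close>; the infimum of the empty set in \<open>enat\<close> is \<open>\<infinity>\<close>.\<close>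

definition coresolution_dim ::
    "('r, 'x) ring_scheme \<Rightarrow> ('r, 'm) module set \<Rightarrow> ('r, 'm) module \<Rightarrow> enat" where
  "coresolution_dim R C M = Inf {enat k |k. \<exists>Y d. exact_sequence R k Y d \<and>
     Y 0 = M \<and> (\<forall>j\<le>k. Y (Suc j) \<in> C)}"

definition inj_dim :: "('r, 'x) ring_scheme \<Rightarrow> 'm set set \<Rightarrow> ('r, 'm) module \<Rightarrow> enat" where
  "inj_dim R U M = coresolution_dim R (Inj R U) M"

definition proj_dim :: "('r, 'x) ring_scheme \<Rightarrow> 'm set set \<Rightarrow> ('r, 'm) module \<Rightarrow> enat" where
  "proj_dim R U M = Inf {enat k |k. \<exists>Y d. exact_sequence R k Y d \<and>
     (\<forall>j\<le>k. Y j \<in> Proj R U) \<and> Y (Suc k) = M}"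

definition pd_class ::
    "('r, 'x) ring_scheme \<Rightarrow> 'm set set \<Rightarrow> ('r, 'm) module set \<Rightarrow> enat" where
  "pd_class R U C = (SUP X\<in>C. proj_dim R U X)"

definition fin_inj_dim :: "('r, 'x) ring_scheme \<Rightarrow> 'm set set \<Rightarrow> ('r, 'm) module set" where
  "fin_inj_dim R U = {M \<in> Mod_cat R U. inj_dim R U M < \<infinity>}"


section \<open>Ext\<close>

text \<open>\<open>d 0 : P 0 \<rightarrow> X\<close> is the augmentation and \<open>d (n + 1) : P (n + 1) \<rightarrow> P n\<close> are the differentials.\<close>

definition proj_resolution ::
    "('r, 'x) ring_scheme \<Rightarrow> 'm set set \<Rightarrow> ('r, 'm) module \<Rightarrow>
     (nat \<Rightarrow> ('r, 'm) module) \<times> (nat \<Rightarrow> 'm \<Rightarrow> 'm) \<Rightarrow> bool" where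
  "proj_resolution R U X = (\<lambda>(P, d).
     (\<forall>n. P n \<in> Proj R U) \<and>
     d 0 \<in> Hom R (P 0) X \<and> (\<forall>n. d (Suc n) \<in> Hom R (P (Suc n)) (P n)) \<and>
     d 0 ` carrier (P 0) = carrier X \<and>
     exact_at (P (Suc 0)) (d (Suc 0)) (P 0) (d 0) X \<and>
     (\<forall>n. exact_at (P (Suc (Suc n))) (d (Suc (Suc n))) (P (Suc n)) (d (Suc n)) (P n)))"

definition cocycles ::
    "('r, 'x) ring_scheme \<Rightarrow> (nat \<Rightarrow> ('r, 'm) module) \<times> (nat \<Rightarrow> 'm \<Rightarrow> 'm) \<Rightarrow> nat \<Rightarrow>
     ('r, 'm) module \<Rightarrow> ('m \<Rightarrow> 'm) set" where
  "cocycles R = (\<lambda>(P, d) n N. {\<phi> \<in> Hom R (P n) N.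
     compose (carrier (P (Suc n))) \<phi> (d (Suc n)) = (\<lambda>x\<in>carrier (P (Suc n)). \<zero>\<^bsub>N\<^esub>)})"

definition coboundaries ::
    "('r, 'x) ring_scheme \<Rightarrow> (nat \<Rightarrow> ('r, 'm) module) \<times> (nat \<Rightarrow> 'm \<Rightarrow> 'm) \<Rightarrow> nat \<Rightarrow>
     ('r, 'm) module \<Rightarrow> ('m \<Rightarrow> 'm) set" where
  "coboundaries R = (\<lambda>(P, d) n N. case n of
       0 \<Rightarrow> {\<lambda>x\<in>carrier (P 0). \<zero>\<^bsub>N\<^esub>}
     | Suc m \<Rightarrow> (\<lambda>\<psi>. compose (carrier (P n)) \<psi> (d n)) ` Hom R (P m) N)"

text \<open>\<open>Ext\<close> as the cohomology of \<open>Hom\<^sub>R(P, N)\<close> for a chosen projective resolution \<open>P\<close> of \<open>X\<close>.\<close>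

definition Ext ::
    "('r, 'x) ring_scheme \<Rightarrow> 'm set set \<Rightarrow> nat \<Rightarrow> ('r, 'm) module \<Rightarrow> ('r, 'm) module \<Rightarrow>
     ('m \<Rightarrow> 'm) set monoid" where
  "Ext R U n X N =
     (let Pd = (SOME Pd. proj_resolution R U X Pd)
      in Hom_group R (fst Pd n) N \<lparr>carrier := cocycles R Pd n N\<rparr> Mod coboundaries R Pd n N)"

definition perp ::
    "('r, 'x) ring_scheme \<Rightarrow> 'm set set \<Rightarrow> ('r, 'm) module set \<Rightarrow> ('r, 'm) module set" where
  "perp R U C = {N \<in> Mod_cat R U. \<forall>X\<in>C. \<forall>i\<ge>1. trivial_group (Ext R U i X N)}"


section \<open>Absolutely pure and Ding injective modules\<close>

definition Abs_pure :: "('r, 'x) ring_scheme \<Rightarrow> 'm set set \<Rightarrow> ('r, 'm) module set" where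
  "Abs_pure R U = {M \<in> Mod_cat R U. \<forall>F \<in> fin_pres R U. trivial_group (Ext R U 1 F M)}"

definition exact_complex ::
    "('r, 'x) ring_scheme \<Rightarrow> (int \<Rightarrow> ('r, 'm) module) \<Rightarrow> (int \<Rightarrow> 'm \<Rightarrow> 'm) \<Rightarrow> bool" where
  "exact_complex R I d \<longleftrightarrow>
     (\<forall>n. d n \<in> Hom R (I n) (I (n + 1))) \<and>
     (\<forall>n. exact_at (I n) (d n) (I (n + 1)) (d (n + 1)) (I (n + 2)))"

definition Hom_exact ::
    "('r, 'x) ring_scheme \<Rightarrow> ('r, 'm) module \<Rightarrow>
     (int \<Rightarrow> ('r, 'm) module) \<Rightarrow> (int \<Rightarrow> 'm \<Rightarrow> 'm) \<Rightarrow> bool" where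
  "Hom_exact R E I d \<longleftrightarrow> (\<forall>n.
     (\<lambda>\<psi>. compose (carrier E) (d n) \<psi>) ` Hom R E (I n) =
     {\<phi> \<in> Hom R E (I (n + 1)).
        compose (carrier E) (d (n + 1)) \<phi> = (\<lambda>x\<in>carrier E. \<zero>\<^bsub>I (n + 2)\<^esub>)})"

definition Ding_inj :: "('r, 'x) ring_scheme \<Rightarrow> 'm set set \<Rightarrow> ('r, 'm) module set" where
  "Ding_inj R U = {M \<in> Mod_cat R U. \<exists>I d n.
     (\<forall>j. I j \<in> Inj R U) \<and> exact_complex R I d \<and>
     (\<forall>E \<in> Abs_pure R U. Hom_exact R E I d) \<and>
     isomorphic_modules R M (kernel_module (I n) (d n) (I (n + 1)))}"

definition Ding_inj_dim :: "('r, 'x) ring_scheme \<Rightarrow> 'm set set \<Rightarrow> ('r, 'm) module \<Rightarrow> enat" where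
  "Ding_inj_dim R U M = coresolution_dim R (Ding_inj R U) M"

definition gl_DID :: "('r, 'x) ring_scheme \<Rightarrow> 'm set set \<Rightarrow> enat" where
  "gl_DID R U = (SUP M \<in> Mod_cat R U. Ding_inj_dim R U M)"


section \<open>Cotorsion pairs\<close>

definition cotorsion_pair ::
    "('r, 'x) ring_scheme \<Rightarrow> 'm set set \<Rightarrow> ('r, 'm) module set \<Rightarrow> ('r, 'm) module set \<Rightarrow> bool" where
  "cotorsion_pair R U \<A> \<B> \<longleftrightarrow>
     \<A> = {X \<in> Mod_cat R U. \<forall>B\<in>\<B>. trivial_group (Ext R U 1 X B)} \<and>
     \<B> = {Y \<in> Mod_cat R U. \<forall>A\<in>\<A>. trivial_group (Ext R U 1 A Y)}"

definition complete_cotorsion_pair ::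
    "('r, 'x) ring_scheme \<Rightarrow> 'm set set \<Rightarrow> ('r, 'm) module set \<Rightarrow> ('r, 'm) module set \<Rightarrow> bool" where
  "complete_cotorsion_pair R U \<A> \<B> \<longleftrightarrow> cotorsion_pair R U \<A> \<B> \<and>
     (\<forall>C \<in> Mod_cat R U.
        (\<exists>B\<in>\<B>. \<exists>A\<in>\<A>. short_exact R B A C) \<and>
        (\<exists>B\<in>\<B>. \<exists>A\<in>\<A>. short_exact R C B A))"

definition hereditary ::
    "('r, 'x) ring_scheme \<Rightarrow> 'm set set \<Rightarrow> ('r, 'm) module set \<Rightarrow> ('r, 'm) module set \<Rightarrow> bool" where
  "hereditary R U \<A> \<B> \<longleftrightarrow>
     (\<forall>K \<in> Mod_cat R U. \<forall>A\<in>\<A>. \<forall>A'\<in>\<A>. short_exact R K A A' \<longrightarrow> K \<in> \<A>) \<and>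
     (\<forall>B\<in>\<B>. \<forall>B'\<in>\<B>. \<forall>L \<in> Mod_cat R U. short_exact R B B' L \<longrightarrow> L \<in> \<B>)"

end

theory Submission
  imports Defs "HOL-Library.Countable_Set"
begin

text \<open>
  Right halves of the defining complexes show \<open>DI \<subseteq> AP\<^sup>\<bottom> \<subseteq> \<I>\<^sup>\<bottom>\<close>, and \<open>\<I>\<^sup>\<bottom> = (\<I>\<^sup>\<or>)\<^sup>\<bottom>\<close> by dimension
  shifting. If \<open>DI = \<I>\<^sup>\<bottom>\<close> and \<open>pd(\<I>) \<le> n\<close>, then \<open>n\<close>-th cosyzygies are Ding injective, so
  \<open>gl.DID \<le> pd(\<I>)\<close>; conversely \<open>gl.DID \<le> n\<close> kills \<open>Ext\<^sup>n\<^sup>+\<^sup>1(X, -)\<close> for absolutely pure \<open>X\<close>, so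
  \<open>pd(AP) \<le> gl.DID\<close>. Since \<open>DI\<close> is closed under extensions (horseshoe), Auslander--Buchweitz
  induction on the length of a Ding coresolution of \<open>M\<close> yields \<open>0 \<rightarrow> D \<rightarrow> W \<rightarrow> M \<rightarrow> 0\<close> and
  \<open>0 \<rightarrow> M \<rightarrow> D' \<rightarrow> W' \<rightarrow> 0\<close> with \<open>D, D' \<in> DI\<close> and \<open>W, W' \<in> \<I>\<^sup>\<or>\<close>. For \<open>M \<in> \<I>\<^sup>\<bottom>\<close> the module \<open>W\<close> lies in
  \<open>\<I>\<^sup>\<bottom> \<inter> \<I>\<^sup>\<or> = \<I>\<close>, and splicing such sequences builds the left half of a complex exhibiting \<open>M\<close> as
  Ding injective.
\<close>

section \<open>Left modules, homomorphisms and short exact sequences\<close>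

text \<open>Two gaps separate \<open>Ding_inj\<close> from the orthogonal of the injectives. Ding
  injectivity asks for vanishing against all absolutely pure E, whereas M in the orthogonal is
  tested on injectives only. In 0 -> D -> W -> M -> 0 with W injective and D Ding injective,
  however, Ext(E, W) and Ext(E, D) vanish in all positive degrees, hence so does Ext(E, M). The
  other gap is the left half of the complex, which needs injectives mapping onto M with kernels in
  the same class; finite Ding dimension supplies them. The same sequences give completeness of the
  cotorsion pair without any set-theoretic existence argument. Vanishing of Ext is handled as an
  extension property (\<open>orth\<close>) that is shifted along syzygies and cosyzygies; the group
  \<open>Ext\<close> with its chosen resolution enters through one comparison lemma. Products
  indexed by \<open>R\<close> times the naturals are the source of all larger sets in the universe,
  so free modules and coinduced modules must be encoded in such products before projectives and
  injectives become available.\<close>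

lemma left_moduleI:
  assumes "ring R" "abelian_group M"
    and "\<And>a x. \<lbrakk>a \<in> carrier R; x \<in> carrier M\<rbrakk> \<Longrightarrow> a \<odot>\<^bsub>M\<^esub> x \<in> carrier M"
    and "\<And>a b x. \<lbrakk>a \<in> carrier R; b \<in> carrier R; x \<in> carrier M\<rbrakk> \<Longrightarrow>
        (a \<oplus>\<^bsub>R\<^esub> b) \<odot>\<^bsub>M\<^esub> x = a \<odot>\<^bsub>M\<^esub> x \<oplus>\<^bsub>M\<^esub> b \<odot>\<^bsub>M\<^esub> x"
    and "\<And>a x y. \<lbrakk>a \<in> carrier R; x \<in> carrier M; y \<in> carrier M\<rbrakk> \<Longrightarrow>
        a \<odot>\<^bsub>M\<^esub> (x \<oplus>\<^bsub>M\<^esub> y) = a \<odot>\<^bsub>M\<^esub> x \<oplus>\<^bsub>M\<^esub> a \<odot>\<^bsub>M\<^esub> y"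
    and "\<And>a b x. \<lbrakk>a \<in> carrier R; b \<in> carrier R; x \<in> carrier M\<rbrakk> \<Longrightarrow>
        (a \<otimes>\<^bsub>R\<^esub> b) \<odot>\<^bsub>M\<^esub> x = a \<odot>\<^bsub>M\<^esub> (b \<odot>\<^bsub>M\<^esub> x)"
    and "\<And>x. x \<in> carrier M \<Longrightarrow> \<one>\<^bsub>R\<^esub> \<odot>\<^bsub>M\<^esub> x = x"
  shows "left_module R M"
  using assms unfolding left_module_def left_module_axioms_def by blast

lemma left_moduleD:
  assumes "left_module R M"
  shows left_module_ring: "ring R" and left_module_group: "abelian_group M"
    and left_module_smult_closed:
      "\<And>a x. \<lbrakk>a \<in> carrier R; x \<in> carrier M\<rbrakk> \<Longrightarrow> a \<odot>\<^bsub>M\<^esub> x \<in> carrier M"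
    and left_module_l_distr: "\<And>a b x. \<lbrakk>a \<in> carrier R; b \<in> carrier R; x \<in> carrier M\<rbrakk> \<Longrightarrow>
        (a \<oplus>\<^bsub>R\<^esub> b) \<odot>\<^bsub>M\<^esub> x = a \<odot>\<^bsub>M\<^esub> x \<oplus>\<^bsub>M\<^esub> b \<odot>\<^bsub>M\<^esub> x"
    and left_module_r_distr: "\<And>a x y. \<lbrakk>a \<in> carrier R; x \<in> carrier M; y \<in> carrier M\<rbrakk> \<Longrightarrow>
        a \<odot>\<^bsub>M\<^esub> (x \<oplus>\<^bsub>M\<^esub> y) = a \<odot>\<^bsub>M\<^esub> x \<oplus>\<^bsub>M\<^esub> a \<odot>\<^bsub>M\<^esub> y"
    and left_module_smult_assoc: "\<And>a b x. \<lbrakk>a \<in> carrier R; b \<in> carrier R; x \<in> carrier M\<rbrakk> \<Longrightarrow>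
        (a \<otimes>\<^bsub>R\<^esub> b) \<odot>\<^bsub>M\<^esub> x = a \<odot>\<^bsub>M\<^esub> (b \<odot>\<^bsub>M\<^esub> x)"
    and left_module_smult_one: "\<And>x. x \<in> carrier M \<Longrightarrow> \<one>\<^bsub>R\<^esub> \<odot>\<^bsub>M\<^esub> x = x"
proof -
  interpret left_module R M by fact
  show "ring R" "abelian_group M" by unfold_locales
qed (use assms in \<open>auto simp: left_module_def left_module_axioms_def\<close>)

lemma left_module_zero_smult:
  assumes "left_module R M" "x \<in> carrier M"
  shows "\<zero>\<^bsub>R\<^esub> \<odot>\<^bsub>M\<^esub> x = \<zero>\<^bsub>M\<^esub>"
proof -
  interpret R: ring R by (rule left_module_ring[OF assms(1)])
  interpret M: abelian_group M by (rule left_module_group[OF assms(1)])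
  have c: "\<zero>\<^bsub>R\<^esub> \<odot>\<^bsub>M\<^esub> x \<in> carrier M"
    by (simp add: left_module_smult_closed[OF assms(1)] assms(2))
  have "\<zero>\<^bsub>R\<^esub> \<odot>\<^bsub>M\<^esub> x \<oplus>\<^bsub>M\<^esub> \<zero>\<^bsub>R\<^esub> \<odot>\<^bsub>M\<^esub> x = (\<zero>\<^bsub>R\<^esub> \<oplus>\<^bsub>R\<^esub> \<zero>\<^bsub>R\<^esub>) \<odot>\<^bsub>M\<^esub> x"
    by (subst left_module_l_distr[OF assms(1)]) (use assms(2) in auto)
  then show ?thesis using c by (simp add: M.add.r_cancel_one')
qed

lemma left_module_smult_zero:
  assumes "left_module R M" "a \<in> carrier R"
  shows "a \<odot>\<^bsub>M\<^esub> \<zero>\<^bsub>M\<^esub> = \<zero>\<^bsub>M\<^esub>"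
proof -
  interpret M: abelian_group M by (rule left_module_group[OF assms(1)])
  have c: "a \<odot>\<^bsub>M\<^esub> \<zero>\<^bsub>M\<^esub> \<in> carrier M"
    by (simp add: left_module_smult_closed[OF assms(1)] assms(2))
  have "a \<odot>\<^bsub>M\<^esub> \<zero>\<^bsub>M\<^esub> \<oplus>\<^bsub>M\<^esub> a \<odot>\<^bsub>M\<^esub> \<zero>\<^bsub>M\<^esub> = a \<odot>\<^bsub>M\<^esub> (\<zero>\<^bsub>M\<^esub> \<oplus>\<^bsub>M\<^esub> \<zero>\<^bsub>M\<^esub>)"
    by (subst left_module_r_distr[OF assms(1)]) (use assms(2) in auto)
  then show ?thesis using c by (simp add: M.add.r_cancel_one')
qed

lemma left_module_smult_minus:
  assumes M: "left_module R M" "a \<in> carrier R" "x \<in> carrier M"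
  shows "a \<odot>\<^bsub>M\<^esub> (\<ominus>\<^bsub>M\<^esub> x) = \<ominus>\<^bsub>M\<^esub> (a \<odot>\<^bsub>M\<^esub> x)"
proof -
  interpret M: abelian_group M by (rule left_module_group[OF assms(1)])
  note [simp] = left_module_smult_closed[OF assms(1)]
  have "a \<odot>\<^bsub>M\<^esub> (\<ominus>\<^bsub>M\<^esub> x) \<oplus>\<^bsub>M\<^esub> a \<odot>\<^bsub>M\<^esub> x = \<zero>\<^bsub>M\<^esub>"
    using assms left_module_r_distr[OF assms(1,2), of "\<ominus>\<^bsub>M\<^esub> x" x] left_module_smult_zero[OF assms(1,2)]
    by (simp add: M.l_neg)
  then show ?thesis using assms M.minus_equality[of "a \<odot>\<^bsub>M\<^esub> (\<ominus>\<^bsub>M\<^esub> x)" "a \<odot>\<^bsub>M\<^esub> x"] by simp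
qed

text \<open>This covers both transport along a bijection and, with \<open>q\<close> choosing a
  representative of each coset, the formation of quotients.\<close>

lemma image_module:
  fixes M :: "('r, 'a) module" and q :: "'a \<Rightarrow> 'b"
  assumes M: "left_module R M"
    and add: "\<And>x x' y y'. \<lbrakk>x \<in> carrier M; x' \<in> carrier M; y \<in> carrier M; y' \<in> carrier M;
       q x = q x'; q y = q y'\<rbrakk> \<Longrightarrow> q (x \<oplus>\<^bsub>M\<^esub> y) = q (x' \<oplus>\<^bsub>M\<^esub> y')"
    and smult: "\<And>a x x'. \<lbrakk>a \<in> carrier R; x \<in> carrier M; x' \<in> carrier M; q x = q x'\<rbrakk> \<Longrightarrow>
       q (a \<odot>\<^bsub>M\<^esub> x) = q (a \<odot>\<^bsub>M\<^esub> x')"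
  obtains N :: "('r, 'b) module" where "left_module R N" "carrier N = q ` carrier M"
    "\<And>x y. \<lbrakk>x \<in> carrier M; y \<in> carrier M\<rbrakk> \<Longrightarrow> q (x \<oplus>\<^bsub>M\<^esub> y) = q x \<oplus>\<^bsub>N\<^esub> q y"
    "\<And>a x. \<lbrakk>a \<in> carrier R; x \<in> carrier M\<rbrakk> \<Longrightarrow> q (a \<odot>\<^bsub>M\<^esub> x) = a \<odot>\<^bsub>N\<^esub> q x"
proof -
  interpret R: ring R by (rule left_module_ring[OF M])
  interpret M: abelian_group M by (rule left_module_group[OF M])
  define s where "s = inv_into (carrier M) q"
  have s: "s (q x) \<in> carrier M" "q (s (q x)) = q x" if "x \<in> carrier M" for x
    using that unfolding s_def by (auto intro: inv_into_into f_inv_into_f)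
  define N :: "('r, 'b) module" where
    "N = \<lparr>carrier = q ` carrier M, mult = undefined, one = undefined, zero = q \<zero>\<^bsub>M\<^esub>,
      add = \<lambda>u v. q (s u \<oplus>\<^bsub>M\<^esub> s v), smult = \<lambda>a u. q (a \<odot>\<^bsub>M\<^esub> s u)\<rparr>"
  have car: "carrier N = q ` carrier M" by (simp add: N_def)
  have qa: "q x \<oplus>\<^bsub>N\<^esub> q y = q (x \<oplus>\<^bsub>M\<^esub> y)" if "x \<in> carrier M" "y \<in> carrier M" for x y
    unfolding N_def by simp (rule add, use that s in auto)
  have qs: "a \<odot>\<^bsub>N\<^esub> q x = q (a \<odot>\<^bsub>M\<^esub> x)" if "a \<in> carrier R" "x \<in> carrier M" for a x
    unfolding N_def by simp (rule smult, use that s in auto)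
  have q0: "\<zero>\<^bsub>N\<^esub> = q \<zero>\<^bsub>M\<^esub>" by (simp add: N_def)
  note sc = left_module_smult_closed[OF M]
  have ab: "abelian_group N"
  proof (rule abelian_groupI)
    fix x assume "x \<in> carrier N"
    then obtain a where "a \<in> carrier M" "x = q a" by (auto simp: car)
    then show "\<exists>y \<in> carrier N. y \<oplus>\<^bsub>N\<^esub> x = \<zero>\<^bsub>N\<^esub>"
      by (intro bexI[of _ "q (\<ominus>\<^bsub>M\<^esub> a)"]) (auto simp: car qa q0 M.l_neg)
  qed (auto simp: car qa q0 M.a_ac)
  have "left_module R N"
    by (rule left_moduleI)
      (auto simp: R.ring_axioms ab car qa qs sc left_module_l_distr[OF M] left_module_r_distr[OF M]
        left_module_smult_assoc[OF M] left_module_smult_one[OF M])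
  then show thesis using that[of N] by (auto simp: car qa qs)
qed

text \<open>The module is an explicit premise here because a diagram involves several modules over
  the same \<open>R\<close> at once; instantiated with \<open>Mod_left_module\<close>, many of these
  facts become simp rules that serve all of them.\<close>

lemma
  assumes L: "left_module R M"
  shows lmod_zero: "\<zero>\<^bsub>M\<^esub> \<in> carrier M"
    and lmod_add: "\<lbrakk>x \<in> carrier M; y \<in> carrier M\<rbrakk> \<Longrightarrow> x \<oplus>\<^bsub>M\<^esub> y \<in> carrier M"
    and lmod_neg: "x \<in> carrier M \<Longrightarrow> \<ominus>\<^bsub>M\<^esub> x \<in> carrier M"
    and lmod_minus: "\<lbrakk>x \<in> carrier M; y \<in> carrier M\<rbrakk> \<Longrightarrow> x \<ominus>\<^bsub>M\<^esub> y \<in> carrier M"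
    and lmod_smult: "\<lbrakk>a \<in> carrier R; x \<in> carrier M\<rbrakk> \<Longrightarrow> a \<odot>\<^bsub>M\<^esub> x \<in> carrier M"
    and lmod_add_0: "x \<in> carrier M \<Longrightarrow> x \<oplus>\<^bsub>M\<^esub> \<zero>\<^bsub>M\<^esub> = x"
    and lmod_0_add: "x \<in> carrier M \<Longrightarrow> \<zero>\<^bsub>M\<^esub> \<oplus>\<^bsub>M\<^esub> x = x"
    and lmod_assoc: "\<lbrakk>x \<in> carrier M; y \<in> carrier M; z \<in> carrier M\<rbrakk> \<Longrightarrow>
       (x \<oplus>\<^bsub>M\<^esub> y) \<oplus>\<^bsub>M\<^esub> z = x \<oplus>\<^bsub>M\<^esub> (y \<oplus>\<^bsub>M\<^esub> z)"
    and lmod_comm: "\<lbrakk>x \<in> carrier M; y \<in> carrier M\<rbrakk> \<Longrightarrow> x \<oplus>\<^bsub>M\<^esub> y = y \<oplus>\<^bsub>M\<^esub> x"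
    and lmod_lcomm: "\<lbrakk>x \<in> carrier M; y \<in> carrier M; z \<in> carrier M\<rbrakk> \<Longrightarrow>
       x \<oplus>\<^bsub>M\<^esub> (y \<oplus>\<^bsub>M\<^esub> z) = y \<oplus>\<^bsub>M\<^esub> (x \<oplus>\<^bsub>M\<^esub> z)"
    and lmod_minus_self: "x \<in> carrier M \<Longrightarrow> x \<ominus>\<^bsub>M\<^esub> x = \<zero>\<^bsub>M\<^esub>"
    and lmod_minus_0: "x \<in> carrier M \<Longrightarrow> x \<ominus>\<^bsub>M\<^esub> \<zero>\<^bsub>M\<^esub> = x"
    and lmod_minus_eq_0: "\<lbrakk>x \<in> carrier M; y \<in> carrier M\<rbrakk> \<Longrightarrow> x \<ominus>\<^bsub>M\<^esub> y = \<zero>\<^bsub>M\<^esub> \<longleftrightarrow> x = y"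
    and lmod_add_minus: "\<lbrakk>x \<in> carrier M; y \<in> carrier M\<rbrakk> \<Longrightarrow> x \<oplus>\<^bsub>M\<^esub> (y \<ominus>\<^bsub>M\<^esub> x) = y"
    and lmod_minus_add: "\<lbrakk>x \<in> carrier M; y \<in> carrier M\<rbrakk> \<Longrightarrow> (y \<ominus>\<^bsub>M\<^esub> x) \<oplus>\<^bsub>M\<^esub> x = y"
    and lmod_cancel: "\<lbrakk>x \<in> carrier M; y \<in> carrier M; z \<in> carrier M\<rbrakk> \<Longrightarrow>
       x \<oplus>\<^bsub>M\<^esub> y = x \<oplus>\<^bsub>M\<^esub> z \<longleftrightarrow> y = z"
    and lmod_neg_add: "x \<in> carrier M \<Longrightarrow> \<ominus>\<^bsub>M\<^esub> x \<oplus>\<^bsub>M\<^esub> x = \<zero>\<^bsub>M\<^esub>"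
    and lmod_minus_diff: "\<lbrakk>x \<in> carrier M; y \<in> carrier M; x' \<in> carrier M; y' \<in> carrier M\<rbrakk> \<Longrightarrow>
       (x \<oplus>\<^bsub>M\<^esub> y) \<ominus>\<^bsub>M\<^esub> (x' \<oplus>\<^bsub>M\<^esub> y') = (x \<ominus>\<^bsub>M\<^esub> x') \<oplus>\<^bsub>M\<^esub> (y \<ominus>\<^bsub>M\<^esub> y')"
    and lmod_minus_trans: "\<lbrakk>x \<in> carrier M; y \<in> carrier M; z \<in> carrier M\<rbrakk> \<Longrightarrow>
       (x \<ominus>\<^bsub>M\<^esub> y) \<oplus>\<^bsub>M\<^esub> (y \<ominus>\<^bsub>M\<^esub> z) = x \<ominus>\<^bsub>M\<^esub> z"
    and lmod_minus_minus: "\<lbrakk>x \<in> carrier M; y \<in> carrier M; z \<in> carrier M\<rbrakk> \<Longrightarrow>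
       (x \<ominus>\<^bsub>M\<^esub> z) \<ominus>\<^bsub>M\<^esub> (y \<ominus>\<^bsub>M\<^esub> z) = x \<ominus>\<^bsub>M\<^esub> y"
    and lmod_smult_0: "a \<in> carrier R \<Longrightarrow> a \<odot>\<^bsub>M\<^esub> \<zero>\<^bsub>M\<^esub> = \<zero>\<^bsub>M\<^esub>"
    and lmod_smult_add: "\<lbrakk>a \<in> carrier R; x \<in> carrier M; y \<in> carrier M\<rbrakk> \<Longrightarrow>
        a \<odot>\<^bsub>M\<^esub> (x \<oplus>\<^bsub>M\<^esub> y) = a \<odot>\<^bsub>M\<^esub> x \<oplus>\<^bsub>M\<^esub> a \<odot>\<^bsub>M\<^esub> y"
    and lmod_smult_minus: "\<lbrakk>a \<in> carrier R; x \<in> carrier M; y \<in> carrier M\<rbrakk> \<Longrightarrow>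
        a \<odot>\<^bsub>M\<^esub> (x \<ominus>\<^bsub>M\<^esub> y) = a \<odot>\<^bsub>M\<^esub> x \<ominus>\<^bsub>M\<^esub> a \<odot>\<^bsub>M\<^esub> y"
proof -
  interpret M: abelian_group M by (rule left_module_group[OF assms])
  note [simp] = left_module_smult_closed[OF L]
  show "\<zero>\<^bsub>M\<^esub> \<in> carrier M" by simp
  show "x \<oplus>\<^bsub>M\<^esub> y \<in> carrier M" if "x \<in> carrier M" "y \<in> carrier M" using that by simp
  show "\<ominus>\<^bsub>M\<^esub> x \<in> carrier M" if "x \<in> carrier M" using that by simp
  show "x \<ominus>\<^bsub>M\<^esub> y \<in> carrier M" if "x \<in> carrier M" "y \<in> carrier M" using that by simp
  show "a \<odot>\<^bsub>M\<^esub> x \<in> carrier M" if "a \<in> carrier R" "x \<in> carrier M" using that by simp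
  show "x \<oplus>\<^bsub>M\<^esub> \<zero>\<^bsub>M\<^esub> = x" "\<zero>\<^bsub>M\<^esub> \<oplus>\<^bsub>M\<^esub> x = x" if "x \<in> carrier M" using that by auto
  show "(x \<oplus>\<^bsub>M\<^esub> y) \<oplus>\<^bsub>M\<^esub> z = x \<oplus>\<^bsub>M\<^esub> (y \<oplus>\<^bsub>M\<^esub> z)" "x \<oplus>\<^bsub>M\<^esub> (y \<oplus>\<^bsub>M\<^esub> z) = y \<oplus>\<^bsub>M\<^esub> (x \<oplus>\<^bsub>M\<^esub> z)"
    if "x \<in> carrier M" "y \<in> carrier M" "z \<in> carrier M" using that by (auto simp: M.a_ac)
  show "x \<oplus>\<^bsub>M\<^esub> y = y \<oplus>\<^bsub>M\<^esub> x" if "x \<in> carrier M" "y \<in> carrier M" using that by (simp add: M.a_comm)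
  show "x \<ominus>\<^bsub>M\<^esub> x = \<zero>\<^bsub>M\<^esub>" "x \<ominus>\<^bsub>M\<^esub> \<zero>\<^bsub>M\<^esub> = x" if "x \<in> carrier M"
    using that by (auto simp: M.minus_eq M.r_neg)
  show "x \<ominus>\<^bsub>M\<^esub> y = \<zero>\<^bsub>M\<^esub> \<longleftrightarrow> x = y" if "x \<in> carrier M" "y \<in> carrier M"
    using that by (simp add: M.minus_eq M.add.inv_solve_right')
  show m: "(y \<ominus>\<^bsub>M\<^esub> x) \<oplus>\<^bsub>M\<^esub> x = y" if "x \<in> carrier M" "y \<in> carrier M" for x y
    using that by (simp add: M.minus_eq M.a_assoc M.l_neg)
  show "x \<oplus>\<^bsub>M\<^esub> (y \<ominus>\<^bsub>M\<^esub> x) = y" if "x \<in> carrier M" "y \<in> carrier M"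
    using that m[OF that] by (simp add: M.a_comm[of x])
  show "x \<oplus>\<^bsub>M\<^esub> y = x \<oplus>\<^bsub>M\<^esub> z \<longleftrightarrow> y = z"
    if "x \<in> carrier M" "y \<in> carrier M" "z \<in> carrier M" using that by simp
  show "\<ominus>\<^bsub>M\<^esub> x \<oplus>\<^bsub>M\<^esub> x = \<zero>\<^bsub>M\<^esub>" if "x \<in> carrier M"
    using that by (rule M.l_neg)
  show "(x \<oplus>\<^bsub>M\<^esub> y) \<ominus>\<^bsub>M\<^esub> (x' \<oplus>\<^bsub>M\<^esub> y') = (x \<ominus>\<^bsub>M\<^esub> x') \<oplus>\<^bsub>M\<^esub> (y \<ominus>\<^bsub>M\<^esub> y')"
    if "x \<in> carrier M" "y \<in> carrier M" "x' \<in> carrier M" "y' \<in> carrier M"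
    using that by (simp add: M.minus_eq M.minus_add M.a_ac)
  have t: "(x \<ominus>\<^bsub>M\<^esub> y) \<oplus>\<^bsub>M\<^esub> (y \<ominus>\<^bsub>M\<^esub> z) = x \<ominus>\<^bsub>M\<^esub> z"
    if "x \<in> carrier M" "y \<in> carrier M" "z \<in> carrier M" for x y z
  proof -
    have "((x \<ominus>\<^bsub>M\<^esub> y) \<oplus>\<^bsub>M\<^esub> (y \<ominus>\<^bsub>M\<^esub> z)) \<oplus>\<^bsub>M\<^esub> z = (x \<ominus>\<^bsub>M\<^esub> z) \<oplus>\<^bsub>M\<^esub> z"
      using that by (simp add: M.a_assoc m)
    then show ?thesis using that by simp
  qed
  then show "(x \<ominus>\<^bsub>M\<^esub> y) \<oplus>\<^bsub>M\<^esub> (y \<ominus>\<^bsub>M\<^esub> z) = x \<ominus>\<^bsub>M\<^esub> z"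
    if "x \<in> carrier M" "y \<in> carrier M" "z \<in> carrier M" using that by blast
  show "(x \<ominus>\<^bsub>M\<^esub> z) \<ominus>\<^bsub>M\<^esub> (y \<ominus>\<^bsub>M\<^esub> z) = x \<ominus>\<^bsub>M\<^esub> y"
    if "x \<in> carrier M" "y \<in> carrier M" "z \<in> carrier M"
  proof -
    have "((x \<ominus>\<^bsub>M\<^esub> z) \<ominus>\<^bsub>M\<^esub> (y \<ominus>\<^bsub>M\<^esub> z)) \<oplus>\<^bsub>M\<^esub> (y \<ominus>\<^bsub>M\<^esub> z) = (x \<ominus>\<^bsub>M\<^esub> y) \<oplus>\<^bsub>M\<^esub> (y \<ominus>\<^bsub>M\<^esub> z)"
      using that by (simp add: m t)
    then show ?thesis using that by simp
  qed
  show "a \<odot>\<^bsub>M\<^esub> \<zero>\<^bsub>M\<^esub> = \<zero>\<^bsub>M\<^esub>" if "a \<in> carrier R"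
    using that by (rule left_module_smult_zero[OF L])
  show "a \<odot>\<^bsub>M\<^esub> (x \<oplus>\<^bsub>M\<^esub> y) = a \<odot>\<^bsub>M\<^esub> x \<oplus>\<^bsub>M\<^esub> a \<odot>\<^bsub>M\<^esub> y"
    if "a \<in> carrier R" "x \<in> carrier M" "y \<in> carrier M"
    using that by (rule left_module_r_distr[OF L])
  show "a \<odot>\<^bsub>M\<^esub> (x \<ominus>\<^bsub>M\<^esub> y) = a \<odot>\<^bsub>M\<^esub> x \<ominus>\<^bsub>M\<^esub> a \<odot>\<^bsub>M\<^esub> y"
    if "a \<in> carrier R" "x \<in> carrier M" "y \<in> carrier M"
    using that by (simp add: M.minus_eq left_module_r_distr[OF L] left_module_smult_minus[OF L])
qed

text \<open>Unlike \<open>Hom\<close>, source and target may have different carrier types and no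
  extensionality is imposed. This suits the auxiliary modules of functions, pairs and rationals that
  are later moved into the universe.\<close>

definition linear_map ::
    "('r, 'x) ring_scheme \<Rightarrow> ('r, 'a) module \<Rightarrow> ('r, 'b) module \<Rightarrow> ('a \<Rightarrow> 'b) \<Rightarrow> bool" where
  "linear_map R M N f \<longleftrightarrow> (\<forall>x\<in>carrier M. f x \<in> carrier N) \<and>
     (\<forall>x\<in>carrier M. \<forall>y\<in>carrier M. f (x \<oplus>\<^bsub>M\<^esub> y) = f x \<oplus>\<^bsub>N\<^esub> f y) \<and>
     (\<forall>a\<in>carrier R. \<forall>x\<in>carrier M. f (a \<odot>\<^bsub>M\<^esub> x) = a \<odot>\<^bsub>N\<^esub> f x)"

lemma linear_mapD:
  assumes "linear_map R M N f"
  shows "\<And>x. x \<in> carrier M \<Longrightarrow> f x \<in> carrier N"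
    "\<And>x y. \<lbrakk>x \<in> carrier M; y \<in> carrier M\<rbrakk> \<Longrightarrow> f (x \<oplus>\<^bsub>M\<^esub> y) = f x \<oplus>\<^bsub>N\<^esub> f y"
    "\<And>a x. \<lbrakk>a \<in> carrier R; x \<in> carrier M\<rbrakk> \<Longrightarrow> f (a \<odot>\<^bsub>M\<^esub> x) = a \<odot>\<^bsub>N\<^esub> f x"
  using assms by (auto simp: linear_map_def)

lemma additive_zero:
  assumes "left_module R M" "left_module R N" "f \<zero>\<^bsub>M\<^esub> \<in> carrier N"
    "f (\<zero>\<^bsub>M\<^esub> \<oplus>\<^bsub>M\<^esub> \<zero>\<^bsub>M\<^esub>) = f \<zero>\<^bsub>M\<^esub> \<oplus>\<^bsub>N\<^esub> f \<zero>\<^bsub>M\<^esub>"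
  shows "f \<zero>\<^bsub>M\<^esub> = \<zero>\<^bsub>N\<^esub>"
proof -
  have "f \<zero>\<^bsub>M\<^esub> \<oplus>\<^bsub>N\<^esub> f \<zero>\<^bsub>M\<^esub> = f \<zero>\<^bsub>M\<^esub> \<oplus>\<^bsub>N\<^esub> \<zero>\<^bsub>N\<^esub>"
    using assms(3,4) lmod_add_0[OF assms(2)] lmod_add_0[OF assms(1)] lmod_zero[OF assms(1)] by simp
  then show ?thesis using lmod_cancel[OF assms(2)] lmod_zero[OF assms(2)] assms(3) by blast
qed

lemma linear_map_zero:
  assumes "left_module R M" "left_module R N" "linear_map R M N f"
  shows "f \<zero>\<^bsub>M\<^esub> = \<zero>\<^bsub>N\<^esub>"
  by (rule additive_zero[OF assms(1,2)])
    (use assms(3) lmod_zero[OF assms(1)] in \<open>auto simp: linear_map_def\<close>)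

lemma linear_map_minus:
  assumes "left_module R M" "left_module R N" "linear_map R M N f" "x \<in> carrier M" "y \<in> carrier M"
  shows "f (x \<ominus>\<^bsub>M\<^esub> y) = f x \<ominus>\<^bsub>N\<^esub> f y"
proof -
  note [simp] = lmod_minus[OF assms(1)] lmod_minus[OF assms(2)] linear_mapD[OF assms(3)] assms(4,5)
  have "f y \<oplus>\<^bsub>N\<^esub> f (x \<ominus>\<^bsub>M\<^esub> y) = f (y \<oplus>\<^bsub>M\<^esub> (x \<ominus>\<^bsub>M\<^esub> y))"
    by simp
  also have "\<dots> = f y \<oplus>\<^bsub>N\<^esub> (f x \<ominus>\<^bsub>N\<^esub> f y)"
    by (subst lmod_add_minus[OF assms(1)], simp, simp, subst lmod_add_minus[OF assms(2)]) auto
  finally show ?thesis by (subst (asm) lmod_cancel[OF assms(2)]) auto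
qed

text \<open>The quotient is carried by chosen representatives of the cosets of \<open>S\<close>
  rather than by the cosets. Its carrier is thus a subset of the old one, so quotients of small
  modules are small.\<close>

lemma quotient_module:
  fixes M :: "('r, 'a) module"
  assumes M: "left_module R M" and SB: "S \<subseteq> carrier M" and S0: "\<zero>\<^bsub>M\<^esub> \<in> S"
    and Sa: "\<And>x y. \<lbrakk>x \<in> S; y \<in> S\<rbrakk> \<Longrightarrow> x \<oplus>\<^bsub>M\<^esub> y \<in> S"
    and Sm: "\<And>x y. \<lbrakk>x \<in> S; y \<in> S\<rbrakk> \<Longrightarrow> x \<ominus>\<^bsub>M\<^esub> y \<in> S"
    and Ss: "\<And>a x. \<lbrakk>a \<in> carrier R; x \<in> S\<rbrakk> \<Longrightarrow> a \<odot>\<^bsub>M\<^esub> x \<in> S"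
  obtains N :: "('r, 'a) module" and q where "left_module R N" "linear_map R M N q"
    "carrier N = q ` carrier M" "carrier N \<subseteq> carrier M"
    "\<And>x. x \<in> carrier M \<Longrightarrow> q x = \<zero>\<^bsub>N\<^esub> \<longleftrightarrow> x \<in> S"
proof -
  note [simp] = lmod_zero[OF M] lmod_add[OF M] lmod_minus[OF M] lmod_smult[OF M] lmod_minus_self[OF M] lmod_minus_0[OF M]
  define q where "q x = (SOME y. y \<in> carrier M \<and> x \<ominus>\<^bsub>M\<^esub> y \<in> S)" for x
  have q: "q x \<in> carrier M" "x \<ominus>\<^bsub>M\<^esub> q x \<in> S" if "x \<in> carrier M" for x
    using someI[of "\<lambda>y. y \<in> carrier M \<and> x \<ominus>\<^bsub>M\<^esub> y \<in> S" x] that S0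
    unfolding q_def by auto
  have q_eq: "q x = q y \<longleftrightarrow> x \<ominus>\<^bsub>M\<^esub> y \<in> S" if "x \<in> carrier M" "y \<in> carrier M" for x y
  proof
    assume "q x = q y"
    then have "(x \<ominus>\<^bsub>M\<^esub> q x) \<ominus>\<^bsub>M\<^esub> (y \<ominus>\<^bsub>M\<^esub> q x) \<in> S" using q that by (metis Sm)
    moreover have "(x \<ominus>\<^bsub>M\<^esub> q x) \<ominus>\<^bsub>M\<^esub> (y \<ominus>\<^bsub>M\<^esub> q x) = x \<ominus>\<^bsub>M\<^esub> y"
      using that q(1)[of x] by (simp add: lmod_minus_minus[OF M])
    ultimately show "x \<ominus>\<^bsub>M\<^esub> y \<in> S" by simp
  next
    assume S: "x \<ominus>\<^bsub>M\<^esub> y \<in> S"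
    have S': "y \<ominus>\<^bsub>M\<^esub> x \<in> S"
      using Sm[OF S0 S] lmod_minus_minus[OF M, of y x y] that by simp
    have "x \<ominus>\<^bsub>M\<^esub> z \<in> S \<longleftrightarrow> y \<ominus>\<^bsub>M\<^esub> z \<in> S" if z: "z \<in> carrier M" for z
      using lmod_minus_trans[OF M, of x y z] lmod_minus_trans[OF M, of y x z]
        Sa[OF S] Sa[OF S'] z \<open>x \<in> carrier M\<close> \<open>y \<in> carrier M\<close> by metis
    \<comment> \<open>The predicates under the choice operator coincide for \<open>x\<close> and
      \<open>y\<close>, hence so do the chosen representatives.\<close>
    then show "q x = q y" unfolding q_def by meson
  qed
  have q_add: "q (x \<oplus>\<^bsub>M\<^esub> y) = q (x' \<oplus>\<^bsub>M\<^esub> y')"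
    if "x \<in> carrier M" "x' \<in> carrier M" "y \<in> carrier M" "y' \<in> carrier M" "q x = q x'" "q y = q y'"
    for x x' y y'
    using that by (simp add: q_eq lmod_minus_diff[OF M] Sa)
  have q_smult: "q (a \<odot>\<^bsub>M\<^esub> x) = q (a \<odot>\<^bsub>M\<^esub> x')"
    if "a \<in> carrier R" "x \<in> carrier M" "x' \<in> carrier M" "q x = q x'" for a x x'
    using that by (simp add: q_eq Ss flip: lmod_smult_minus[OF M])
  obtain N :: "('r, 'a) module" where N: "left_module R N" "carrier N = q ` carrier M"
    "\<And>x y. \<lbrakk>x \<in> carrier M; y \<in> carrier M\<rbrakk> \<Longrightarrow> q (x \<oplus>\<^bsub>M\<^esub> y) = q x \<oplus>\<^bsub>N\<^esub> q y"
    "\<And>a x. \<lbrakk>a \<in> carrier R; x \<in> carrier M\<rbrakk> \<Longrightarrow> q (a \<odot>\<^bsub>M\<^esub> x) = a \<odot>\<^bsub>N\<^esub> q x"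
    by (rule image_module[where q = q, OF M]) (rule q_add q_smult that; assumption)+
  have q0: "q \<zero>\<^bsub>M\<^esub> = \<zero>\<^bsub>N\<^esub>"
    using linear_map_zero[OF M N(1)] N by (auto simp: linear_map_def)
  show thesis
  proof (rule that[of N q])
    show "linear_map R M N q" using N by (auto simp: linear_map_def)
    show "q x = \<zero>\<^bsub>N\<^esub> \<longleftrightarrow> x \<in> S" if "x \<in> carrier M" for x
      using q_eq[OF that, of "\<zero>\<^bsub>M\<^esub>"] that by (simp add: q0)
  qed (use N q in auto)
qed

section \<open>Small modules: homomorphisms, kernels, cokernels and short exact sequences\<close>

locale module_category =
  fixes R :: "('r, 'x) ring_scheme" and U :: "'m set set"
  assumes ring: "ring R" and universe: "module_universe R U"
begin

abbreviation Mods :: "('r, 'm) module set" where "Mods \<equiv> Mod_cat R U"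

lemma universe_lepoll: "\<lbrakk>A \<in> U; B \<lesssim> A\<rbrakk> \<Longrightarrow> B \<in> U"
  using universe unfolding module_universe_def by blast

lemma universe_PiE:
  assumes "\<And>i. i \<in> carrier R \<times> (UNIV :: nat set) \<Longrightarrow> F i \<in> U"
  obtains B where "B \<in> U" "(\<Pi>\<^sub>E i \<in> carrier R \<times> (UNIV :: nat set). F i) \<lesssim> B"
  using universe assms unfolding module_universe_def by blast

lemma Mod_left_module: "M \<in> Mods \<Longrightarrow> left_module R M"
  by (simp add: Mod_cat_def)

lemma Mod_group: "M \<in> Mods \<Longrightarrow> abelian_group M"
  by (rule left_module_group[OF Mod_left_module])

lemma Mod_carrier: "M \<in> Mods \<Longrightarrow> carrier M \<in> U"
  by (simp add: Mod_cat_def)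

lemmas mod_zero [simp] = lmod_zero[OF Mod_left_module]
lemmas mod_add [simp] = lmod_add[OF Mod_left_module]
lemmas mod_neg [simp] = lmod_neg[OF Mod_left_module]
lemmas mod_minus [simp] = lmod_minus[OF Mod_left_module]
lemmas mod_smult [simp] = lmod_smult[OF Mod_left_module]
lemmas mod_add_0 [simp] = lmod_add_0[OF Mod_left_module]
lemmas mod_0_add [simp] = lmod_0_add[OF Mod_left_module]
lemmas mod_assoc = lmod_assoc[OF Mod_left_module]
lemmas mod_comm = lmod_comm[OF Mod_left_module]
lemmas mod_lcomm = lmod_lcomm[OF Mod_left_module]
lemmas mod_minus_self [simp] = lmod_minus_self[OF Mod_left_module]
lemmas mod_minus_0 [simp] = lmod_minus_0[OF Mod_left_module]
lemmas mod_minus_eq_0 = lmod_minus_eq_0[OF Mod_left_module]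
lemmas mod_add_minus [simp] = lmod_add_minus[OF Mod_left_module]
lemmas mod_minus_add [simp] = lmod_minus_add[OF Mod_left_module]
lemmas mod_cancel [simp] = lmod_cancel[OF Mod_left_module]
lemmas mod_neg_add [simp] = lmod_neg_add[OF Mod_left_module]
lemmas mod_minus_diff = lmod_minus_diff[OF Mod_left_module]
lemmas mod_smult_0 [simp] = lmod_smult_0[OF Mod_left_module]
lemmas mod_smult_add = lmod_smult_add[OF Mod_left_module]
lemmas mod_smult_minus = lmod_smult_minus[OF Mod_left_module]

lemmas mod_ac = mod_assoc mod_comm mod_lcomm

lemma Hom_closed: "\<lbrakk>f \<in> Hom R A B; x \<in> carrier A\<rbrakk> \<Longrightarrow> f x \<in> carrier B"
  by (auto simp: Hom_def)

lemma Hom_add: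
  "\<lbrakk>f \<in> Hom R A B; x \<in> carrier A; y \<in> carrier A\<rbrakk> \<Longrightarrow> f (x \<oplus>\<^bsub>A\<^esub> y) = f x \<oplus>\<^bsub>B\<^esub> f y"
  by (auto simp: Hom_def)

lemma Hom_smult:
  "\<lbrakk>f \<in> Hom R A B; a \<in> carrier R; x \<in> carrier A\<rbrakk> \<Longrightarrow> f (a \<odot>\<^bsub>A\<^esub> x) = a \<odot>\<^bsub>B\<^esub> f x"
  by (auto simp: Hom_def)

declare Hom_closed [simp] Hom_add [simp] Hom_smult [simp]

lemma Hom_zero [simp]:
  assumes "f \<in> Hom R A B" "A \<in> Mods" "B \<in> Mods"
  shows "f \<zero>\<^bsub>A\<^esub> = \<zero>\<^bsub>B\<^esub>"
proof -
  have "f \<zero>\<^bsub>A\<^esub> \<oplus>\<^bsub>B\<^esub> f \<zero>\<^bsub>A\<^esub> = f \<zero>\<^bsub>A\<^esub> \<oplus>\<^bsub>B\<^esub> \<zero>\<^bsub>B\<^esub>"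
    using Hom_add[OF assms(1), of "\<zero>\<^bsub>A\<^esub>" "\<zero>\<^bsub>A\<^esub>"] assms by (simp del: Hom_add)
  then show ?thesis using assms by (simp del: mod_add_0)
qed

lemma Hom_minus [simp]:
  assumes "f \<in> Hom R A B" "A \<in> Mods" "B \<in> Mods" "x \<in> carrier A" "y \<in> carrier A"
  shows "f (x \<ominus>\<^bsub>A\<^esub> y) = f x \<ominus>\<^bsub>B\<^esub> f y"
proof -
  have "f y \<oplus>\<^bsub>B\<^esub> f (x \<ominus>\<^bsub>A\<^esub> y) = f y \<oplus>\<^bsub>B\<^esub> (f x \<ominus>\<^bsub>B\<^esub> f y)"
    using Hom_add[OF assms(1), of y "x \<ominus>\<^bsub>A\<^esub> y"] assms by (simp del: Hom_add mod_cancel)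
  then show ?thesis using assms by (simp del: mod_add_minus)
qed

lemma Hom_PiE: "f \<in> Hom R A B \<Longrightarrow> f \<in> carrier A \<rightarrow>\<^sub>E carrier B"
  unfolding Hom_def by blast

lemma Hom_eqI:
  assumes "f \<in> Hom R A B" "g \<in> Hom R A B" "\<And>x. x \<in> carrier A \<Longrightarrow> f x = g x"
  shows "f = g"
  using Hom_PiE[OF assms(1)] Hom_PiE[OF assms(2)] assms(3) by (rule PiE_ext)

lemma Hom_restrict:
  assumes "\<And>x. x \<in> carrier A \<Longrightarrow> f x \<in> carrier B"
    and "\<And>x y. \<lbrakk>x \<in> carrier A; y \<in> carrier A\<rbrakk> \<Longrightarrow> f (x \<oplus>\<^bsub>A\<^esub> y) = f x \<oplus>\<^bsub>B\<^esub> f y"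
    and "\<And>a x. \<lbrakk>a \<in> carrier R; x \<in> carrier A\<rbrakk> \<Longrightarrow> f (a \<odot>\<^bsub>A\<^esub> x) = a \<odot>\<^bsub>B\<^esub> f x"
    and "A \<in> Mods"
  shows "restrict f (carrier A) \<in> Hom R A B"
  using assms unfolding Hom_def by auto

lemma Hom_compose [simp]:
  assumes "f \<in> Hom R A B" "g \<in> Hom R B C" "A \<in> Mods"
  shows "compose (carrier A) g f \<in> Hom R A C"
  unfolding compose_def by (rule Hom_restrict) (use assms in auto)

lemma compose_apply [simp]: "x \<in> S \<Longrightarrow> compose S g f x = g (f x)"
  by (simp add: compose_def)

lemma Hom_comp:
  assumes "f \<in> Hom R A B" "g \<in> Hom R B C" "A \<in> Mods"
  obtains h where "h \<in> Hom R A C" "\<And>x. x \<in> carrier A \<Longrightarrow> h x = g (f x)"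
  using that[of "compose (carrier A) g f"] assms by auto

lemma Hom_diff:
  assumes "f \<in> Hom R A B" "g \<in> Hom R A B" "A \<in> Mods" "B \<in> Mods"
  obtains h where "h \<in> Hom R A B" "\<And>x. x \<in> carrier A \<Longrightarrow> h x = f x \<ominus>\<^bsub>B\<^esub> g x"
proof -
  have "(\<lambda>x\<in>carrier A. f x \<ominus>\<^bsub>B\<^esub> g x) \<in> Hom R A B"
    by (rule Hom_restrict) (use assms in \<open>auto simp: mod_minus_diff mod_smult_minus\<close>)
  then show thesis using that by force
qed

lemma Hom_sum:
  assumes "f \<in> Hom R A B" "g \<in> Hom R A B" "A \<in> Mods" "B \<in> Mods"
  obtains h where "h \<in> Hom R A B" "\<And>x. x \<in> carrier A \<Longrightarrow> h x = f x \<oplus>\<^bsub>B\<^esub> g x"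
proof -
  have "(\<lambda>x\<in>carrier A. f x \<oplus>\<^bsub>B\<^esub> g x) \<in> Hom R A B"
    by (rule Hom_restrict) (use assms in \<open>auto simp: mod_ac mod_smult_add\<close>)
  then show thesis using that by force
qed

lemma Hom_id: "A \<in> Mods \<Longrightarrow> (\<lambda>x\<in>carrier A. x) \<in> Hom R A A"
  by (rule Hom_restrict) auto

lemma Hom_0: "\<lbrakk>A \<in> Mods; B \<in> Mods\<rbrakk> \<Longrightarrow> (\<lambda>x\<in>carrier A. \<zero>\<^bsub>B\<^esub>) \<in> Hom R A B"
  by (rule Hom_restrict) auto

lemma Hom_inj_onI:
  assumes "f \<in> Hom R A B" "A \<in> Mods" "B \<in> Mods" "\<And>x. \<lbrakk>x \<in> carrier A; f x = \<zero>\<^bsub>B\<^esub>\<rbrakk> \<Longrightarrow> x = \<zero>\<^bsub>A\<^esub>"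
  shows "inj_on f (carrier A)"
proof (rule inj_onI)
  fix x y assume xy: "x \<in> carrier A" "y \<in> carrier A" "f x = f y"
  then have "f (x \<ominus>\<^bsub>A\<^esub> y) = \<zero>\<^bsub>B\<^esub>" using assms(1-3) by (simp)
  then have "x \<ominus>\<^bsub>A\<^esub> y = \<zero>\<^bsub>A\<^esub>" by (intro assms(4)) (use assms(2) xy in simp)
  then show "x = y" using assms(2) xy by (simp add: mod_minus_eq_0)
qed

text \<open>The homomorphism theorem: \<open>s\<close> is an arbitrary set-theoretic section of
  \<open>p\<close>, and since \<open>f\<close> kills the kernel of \<open>p\<close>, the values of
  \<open>f\<close> on \<open>s\<close> do not depend on the section. This independence makes the
  induced map linear.\<close>

lemma factor_surj:
  assumes "p \<in> Hom R M L" "p ` carrier M = carrier L" "f \<in> Hom R M N" "M \<in> Mods" "L \<in> Mods" "N \<in> Mods"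
    and "\<And>x. \<lbrakk>x \<in> carrier M; p x = \<zero>\<^bsub>L\<^esub>\<rbrakk> \<Longrightarrow> f x = \<zero>\<^bsub>N\<^esub>"
  obtains g where "g \<in> Hom R L N" "\<And>x. x \<in> carrier M \<Longrightarrow> g (p x) = f x"
proof -
  define s where "s = inv_into (carrier M) p"
  have s: "s y \<in> carrier M" "p (s y) = y" if "y \<in> carrier L" for y
    using that assms(2) unfolding s_def by (metis inv_into_into, metis f_inv_into_f)
  have eq: "f x = f y" if "x \<in> carrier M" "y \<in> carrier M" "p x = p y" for x y
  proof -
    have "f (x \<ominus>\<^bsub>M\<^esub> y) = \<zero>\<^bsub>N\<^esub>" by (rule assms(7)) (use that assms in auto)
    then show ?thesis using that assms by (simp add: mod_minus_eq_0)
  qed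
  have "(\<lambda>y\<in>carrier L. f (s y)) \<in> Hom R L N"
  proof (rule Hom_restrict)
    fix x y assume xy: "x \<in> carrier L" "y \<in> carrier L"
    then have "f (s (x \<oplus>\<^bsub>L\<^esub> y)) = f (s x \<oplus>\<^bsub>M\<^esub> s y)"
      by (intro eq) (use s assms in auto)
    then show "f (s (x \<oplus>\<^bsub>L\<^esub> y)) = f (s x) \<oplus>\<^bsub>N\<^esub> f (s y)"
      using s assms xy by simp
  next
    fix a x assume x: "a \<in> carrier R" "x \<in> carrier L"
    then have "f (s (a \<odot>\<^bsub>L\<^esub> x)) = f (a \<odot>\<^bsub>M\<^esub> s x)"
      by (intro eq) (use s assms in auto)
    then show "f (s (a \<odot>\<^bsub>L\<^esub> x)) = a \<odot>\<^bsub>N\<^esub> f (s x)"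
      using s assms x by simp
  qed (use s assms in auto)
  moreover have "(\<lambda>y\<in>carrier L. f (s y)) (p x) = f x" if "x \<in> carrier M" for x
    using that assms(1) by (auto intro!: eq s)
  ultimately show thesis by (rule that)
qed

lemma factor_inj:
  assumes "i \<in> Hom R A B" "inj_on i (carrier A)" "f \<in> Hom R X B" "A \<in> Mods" "B \<in> Mods" "X \<in> Mods"
    and "\<And>x. x \<in> carrier X \<Longrightarrow> f x \<in> i ` carrier A"
  obtains g where "g \<in> Hom R X A" "\<And>x. x \<in> carrier X \<Longrightarrow> i (g x) = f x"
proof -
  define s where "s x = inv_into (carrier A) i (f x)" for x
  have s: "s x \<in> carrier A" "i (s x) = f x" if "x \<in> carrier X" for x
    using assms(7)[OF that] unfolding s_def by (auto intro: inv_into_into f_inv_into_f)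
  have "restrict s (carrier X) \<in> Hom R X A"
  proof (rule Hom_restrict)
    fix x y assume xy: "x \<in> carrier X" "y \<in> carrier X"
    show "s (x \<oplus>\<^bsub>X\<^esub> y) = s x \<oplus>\<^bsub>A\<^esub> s y"
      by (rule inj_onD[OF assms(2)]) (use s assms xy in auto)
  next
    fix a x assume x: "a \<in> carrier R" "x \<in> carrier X"
    show "s (a \<odot>\<^bsub>X\<^esub> x) = a \<odot>\<^bsub>A\<^esub> s x"
      by (rule inj_onD[OF assms(2)]) (use s assms x in auto)
  qed (use s assms in auto)
  then show thesis using that s by force
qed

lemma kernel_Mod:
  assumes "f \<in> Hom R A B" "A \<in> Mods" "B \<in> Mods"
  shows "kernel_module A f B \<in> Mods"
proof -
  have c: "carrier (kernel_module A f B) = {x \<in> carrier A. f x = \<zero>\<^bsub>B\<^esub>}"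
    by (simp add: kernel_module_def kernel_of_def)
  have o: "add (kernel_module A f B) = add A" "smult (kernel_module A f B) = smult A" "zero (kernel_module A f B) = zero A"
    by (simp_all add: kernel_module_def)
  have "abelian_group (kernel_module A f B)"
  proof (rule abelian_groupI)
    fix x assume "x \<in> carrier (kernel_module A f B)"
    then have x: "x \<in> carrier A" "f x = \<zero>\<^bsub>B\<^esub>" by (auto simp: c)
    have "f (\<zero>\<^bsub>A\<^esub> \<ominus>\<^bsub>A\<^esub> x) = \<zero>\<^bsub>B\<^esub>" using x assms by simp
    then show "\<exists>y\<in>carrier (kernel_module A f B). y \<oplus>\<^bsub>kernel_module A f B\<^esub> x = \<zero>\<^bsub>kernel_module A f B\<^esub>"
      using x assms by (intro bexI[of _ "\<zero>\<^bsub>A\<^esub> \<ominus>\<^bsub>A\<^esub> x"]) (auto simp: c o simp del: Hom_minus)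
  qed (use assms in \<open>auto simp: c o mod_ac\<close>)
  then have "left_module R (kernel_module A f B)"
    by (rule left_moduleI[OF ring])
      (use assms in \<open>auto simp: c o mod_smult_add left_module_l_distr[OF Mod_left_module]
        left_module_smult_assoc[OF Mod_left_module] left_module_smult_one[OF Mod_left_module]\<close>)
  moreover have "carrier (kernel_module A f B) \<in> U"
    by (rule universe_lepoll[OF Mod_carrier[OF assms(2)]]) (auto simp: c intro: subset_imp_lepoll)
  ultimately show ?thesis by (simp add: Mod_cat_def)
qed

text \<open>The two maps are exposed, in contrast to \<open>short_exact\<close>, because diagram
  chases must name them; smallness of the three modules is bundled in.\<close>

definition ses where
  "ses A i B p C \<longleftrightarrow> A \<in> Mods \<and> B \<in> Mods \<and> C \<in> Mods \<and> i \<in> Hom R A B \<and> p \<in> Hom R B C \<and>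
     inj_on i (carrier A) \<and> exact_at A i B p C \<and> p ` carrier B = carrier C"

lemma sesI:
  assumes "A \<in> Mods" "B \<in> Mods" "C \<in> Mods" "i \<in> Hom R A B" "p \<in> Hom R B C"
    "\<And>x. \<lbrakk>x \<in> carrier A; i x = \<zero>\<^bsub>B\<^esub>\<rbrakk> \<Longrightarrow> x = \<zero>\<^bsub>A\<^esub>"
    "\<And>x. x \<in> carrier A \<Longrightarrow> p (i x) = \<zero>\<^bsub>C\<^esub>"
    "\<And>y. \<lbrakk>y \<in> carrier B; p y = \<zero>\<^bsub>C\<^esub>\<rbrakk> \<Longrightarrow> \<exists>x \<in> carrier A. i x = y"
    "\<And>z. z \<in> carrier C \<Longrightarrow> \<exists>y \<in> carrier B. p y = z"
  shows "ses A i B p C"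
proof -
  have "inj_on i (carrier A)" by (rule Hom_inj_onI[OF assms(4,1,2,6)])
  moreover have "exact_at A i B p C"
    using assms unfolding exact_at_def kernel_of_def by force
  moreover have "p ` carrier B = carrier C" using assms(5,9) by fastforce
  ultimately show ?thesis using assms unfolding ses_def by blast
qed

lemma sesD:
  assumes "ses A i B p C"
  shows "A \<in> Mods" "B \<in> Mods" "C \<in> Mods" "i \<in> Hom R A B" "p \<in> Hom R B C" "inj_on i (carrier A)"
    "p ` carrier B = carrier C" "i ` carrier A = {y \<in> carrier B. p y = \<zero>\<^bsub>C\<^esub>}"
  using assms unfolding ses_def exact_at_def kernel_of_def by blast+

lemma ses_zero: "\<lbrakk>ses A i B p C; x \<in> carrier A\<rbrakk> \<Longrightarrow> p (i x) = \<zero>\<^bsub>C\<^esub>"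
  by (drule sesD(8)) blast

lemma ses_mid: "\<lbrakk>ses A i B p C; y \<in> carrier B; p y = \<zero>\<^bsub>C\<^esub>\<rbrakk> \<Longrightarrow> \<exists>x \<in> carrier A. i x = y"
  by (drule sesD(8)) (metis (mono_tags, lifting) imageE mem_Collect_eq)

lemma ses_surj: "\<lbrakk>ses A i B p C; z \<in> carrier C\<rbrakk> \<Longrightarrow> \<exists>y \<in> carrier B. p y = z"
  by (drule sesD(7)) (metis imageE)

lemma ses_inj: "\<lbrakk>ses A i B p C; x \<in> carrier A; y \<in> carrier A; i x = i y\<rbrakk> \<Longrightarrow> x = y"
  by (drule sesD(6)) (rule inj_onD)

lemma ses_inj_0: "\<lbrakk>ses A i B p C; x \<in> carrier A; i x = \<zero>\<^bsub>B\<^esub>\<rbrakk> \<Longrightarrow> x = \<zero>\<^bsub>A\<^esub>"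
  using ses_inj[of A i B p C x "\<zero>\<^bsub>A\<^esub>"] sesD(1,2,4)[of A i B p C] by simp

lemma ses_kernel:
  assumes "f \<in> Hom R A B" "A \<in> Mods" "B \<in> Mods" "f ` carrier A = carrier B"
  shows "ses (kernel_module A f B) (\<lambda>x\<in>kernel_of A f B. x) A f B"
proof -
  have c: "carrier (kernel_module A f B) = kernel_of A f B"
    by (simp add: kernel_module_def)
  have o: "add (kernel_module A f B) = add A" "smult (kernel_module A f B) = smult A" "zero (kernel_module A f B) = zero A"
    by (simp_all add: kernel_module_def)
  have "(\<lambda>x\<in>carrier (kernel_module A f B). x) \<in> Hom R (kernel_module A f B) A"
    by (rule Hom_restrict) (use kernel_Mod[OF assms(1-3)] in \<open>auto simp: o c kernel_of_def assms\<close>)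
  then show ?thesis
    by (intro sesI kernel_Mod) (use assms(1-3) assms(4)[symmetric] in \<open>auto simp: c kernel_of_def o\<close>)
qed

text \<open>This fact and the next one are the universal properties of kernel and cokernel, in the
  elementwise form in which diagram chases invoke them.\<close>

lemma ses_factor_left:
  assumes "ses A i B p C" "f \<in> Hom R X B" "X \<in> Mods" "\<And>x. x \<in> carrier X \<Longrightarrow> p (f x) = \<zero>\<^bsub>C\<^esub>"
  obtains g where "g \<in> Hom R X A" "\<And>x. x \<in> carrier X \<Longrightarrow> i (g x) = f x"
  by (rule factor_inj[of i A B f X]) (use assms sesD[OF assms(1)] in auto)

lemma ses_factor_right:
  assumes "ses A i B p C" "f \<in> Hom R B N" "N \<in> Mods" "\<And>x. x \<in> carrier A \<Longrightarrow> f (i x) = \<zero>\<^bsub>N\<^esub>"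
  obtains g where "g \<in> Hom R C N" "\<And>x. x \<in> carrier B \<Longrightarrow> g (p x) = f x"
proof (rule factor_surj[of p B C f N])
  fix x assume "x \<in> carrier B" "p x = \<zero>\<^bsub>C\<^esub>"
  then show "f x = \<zero>\<^bsub>N\<^esub>" using ses_mid[OF assms(1)] assms(4) by blast
qed (use that assms sesD[OF assms(1)] in auto)

lemma cokernel_ses:
  assumes "i \<in> Hom R A B" "A \<in> Mods" "B \<in> Mods" "inj_on i (carrier A)"
  obtains C p where "ses A i B p C"
proof -
  let ?S = "i ` carrier A"
  have S0: "\<zero>\<^bsub>B\<^esub> \<in> ?S" using Hom_zero[OF assms(1-3)] assms(2) by (metis image_eqI mod_zero)
  have Sa: "x \<oplus>\<^bsub>B\<^esub> y \<in> ?S" if "x \<in> ?S" "y \<in> ?S" for x y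
    using that assms by (auto simp del: Hom_add simp flip: Hom_add[OF assms(1)])
  have Sm: "x \<ominus>\<^bsub>B\<^esub> y \<in> ?S" if "x \<in> ?S" "y \<in> ?S" for x y
    using that assms by (auto simp del: Hom_minus simp flip: Hom_minus[OF assms(1-3)])
  have Ss: "a \<odot>\<^bsub>B\<^esub> x \<in> ?S" if "a \<in> carrier R" "x \<in> ?S" for a x
    using that assms by (auto simp del: Hom_smult simp flip: Hom_smult[OF assms(1)])
  have SB: "?S \<subseteq> carrier B" using assms(1) by auto
  obtain N :: "('r, 'm) module" and q where N: "left_module R N" "linear_map R B N q"
    "carrier N = q ` carrier B" "carrier N \<subseteq> carrier B"
    "\<And>x. x \<in> carrier B \<Longrightarrow> q x = \<zero>\<^bsub>N\<^esub> \<longleftrightarrow> x \<in> ?S"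
    by (rule quotient_module[OF Mod_left_module[OF assms(3)] SB S0]) (rule Sa Sm Ss that; assumption)+
  have NM: "N \<in> Mods"
    using N(1,4) Mod_carrier[OF assms(3)] by (auto simp: Mod_cat_def intro: universe_lepoll subset_imp_lepoll)
  have qh: "restrict q (carrier B) \<in> Hom R B N"
    by (rule Hom_restrict) (use linear_mapD[OF N(2)] assms in auto)
  have "ses A i B (restrict q (carrier B)) N"
    using N assms NM qh SB unfolding ses_def exact_at_def kernel_of_def by auto
  then show thesis by (rule that)
qed

end

section \<open>Free modules and biproducts\<close>

definition regular :: "('r, 'x) ring_scheme \<Rightarrow> ('r, 'r) module" where
  "regular R = \<lparr>carrier = carrier R, mult = (\<otimes>\<^bsub>R\<^esub>), one = \<one>\<^bsub>R\<^esub>, zero = \<zero>\<^bsub>R\<^esub>,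
     add = (\<oplus>\<^bsub>R\<^esub>), smult = (\<otimes>\<^bsub>R\<^esub>)\<rparr>"

lemma left_module_regular:
  assumes "ring R" shows "left_module R (regular R)"
proof -
  interpret ring R by fact
  show ?thesis
    by (rule left_moduleI[OF assms])
      (auto simp: regular_def l_distr r_distr m_assoc a_ac intro!: abelian_groupI
        intro: bexI[of _ "\<ominus>\<^bsub>R\<^esub> _"] l_neg)
qed

text \<open>The direct sum of copies of \<open>N\<close> indexed by \<open>X\<close>. Functions are
  total and vanish off \<open>X\<close>, so that the operations are plain pointwise operations. With
  \<open>N\<close> the regular module this is the free module on \<open>X\<close>, with the
  rationals it is a rational vector space.\<close>

definition finsupp :: "'s set \<Rightarrow> ('r, 'a) module \<Rightarrow> ('r, 's \<Rightarrow> 'a) module" where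
  "finsupp X N = \<lparr>carrier = {c. (\<forall>x\<in>X. c x \<in> carrier N) \<and> (\<forall>x. x \<notin> X \<longrightarrow> c x = \<zero>\<^bsub>N\<^esub>) \<and>
       finite {x. c x \<noteq> \<zero>\<^bsub>N\<^esub>}},
     mult = undefined, one = undefined, zero = (\<lambda>_. \<zero>\<^bsub>N\<^esub>),
     add = (\<lambda>c c' x. c x \<oplus>\<^bsub>N\<^esub> c' x), smult = (\<lambda>a c x. a \<odot>\<^bsub>N\<^esub> c x)\<rparr>"

lemma finsupp_value:
  assumes "left_module R N" "c \<in> carrier (finsupp X N)"
  shows "c x \<in> carrier N"
  using assms(2) lmod_zero[OF assms(1)] by (cases "x \<in> X") (auto simp: finsupp_def)

lemma left_module_finsupp:
  assumes N: "left_module R N"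
  shows "left_module R (finsupp X N)"
proof -
  note v = finsupp_value[OF N, of _ X]
  note [simp] = lmod_zero[OF N] lmod_add[OF N] lmod_smult[OF N] lmod_add_0[OF N] lmod_0_add[OF N] lmod_smult_0[OF N]
    lmod_neg[OF N] lmod_neg_add[OF N]
  have ops: "zero (finsupp X N) = (\<lambda>_. \<zero>\<^bsub>N\<^esub>)" "add (finsupp X N) = (\<lambda>c c' x. c x \<oplus>\<^bsub>N\<^esub> c' x)"
    "smult (finsupp X N) = (\<lambda>a c x. a \<odot>\<^bsub>N\<^esub> c x)"
    by (simp_all add: finsupp_def)
  have carI: "c \<in> carrier (finsupp X N)"
    if "\<And>x. x \<in> X \<Longrightarrow> c x \<in> carrier N" "\<And>x. x \<notin> X \<Longrightarrow> c x = \<zero>\<^bsub>N\<^esub>"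
      "finite T" "\<And>x. x \<notin> T \<Longrightarrow> c x = \<zero>\<^bsub>N\<^esub>" for c T
  proof -
    have "{x. c x \<noteq> \<zero>\<^bsub>N\<^esub>} \<subseteq> T" using that by blast
    then have "finite {x. c x \<noteq> \<zero>\<^bsub>N\<^esub>}" using that(3) finite_subset by blast
    then show ?thesis using that by (simp add: finsupp_def)
  qed
  have carD: "x \<notin> X \<Longrightarrow> c x = \<zero>\<^bsub>N\<^esub>" "finite {x. c x \<noteq> \<zero>\<^bsub>N\<^esub>}" if "c \<in> carrier (finsupp X N)" for c x
    using that by (auto simp: finsupp_def)
  have add: "(\<lambda>x. c x \<oplus>\<^bsub>N\<^esub> c' x) \<in> carrier (finsupp X N)"
    if "c \<in> carrier (finsupp X N)" "c' \<in> carrier (finsupp X N)" for c c'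
    by (rule carI[of _ "{x. c x \<noteq> \<zero>\<^bsub>N\<^esub>} \<union> {x. c' x \<noteq> \<zero>\<^bsub>N\<^esub>}"])
      (simp_all add: carD[OF that(1)] carD[OF that(2)] v[OF that(1)] v[OF that(2)])
  have neg: "(\<lambda>x. \<ominus>\<^bsub>N\<^esub> c x) \<in> carrier (finsupp X N)" if "c \<in> carrier (finsupp X N)" for c
  proof -
    interpret N: abelian_group N by (rule left_module_group[OF N])
    show ?thesis
      by (rule carI[of _ "{x. c x \<noteq> \<zero>\<^bsub>N\<^esub>}"]) (simp_all add: carD[OF that] v[OF that])
  qed
  have smult: "(\<lambda>x. a \<odot>\<^bsub>N\<^esub> c x) \<in> carrier (finsupp X N)"
    if "a \<in> carrier R" "c \<in> carrier (finsupp X N)" for a c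
    by (rule carI[of _ "{x. c x \<noteq> \<zero>\<^bsub>N\<^esub>}"])
      (simp_all add: carD[OF that(2)] v[OF that(2)] that(1))
  have "abelian_group (finsupp X N)"
  proof (rule abelian_groupI)
    fix c assume c: "c \<in> carrier (finsupp X N)"
    show "\<exists>c' \<in> carrier (finsupp X N). c' \<oplus>\<^bsub>finsupp X N\<^esub> c = \<zero>\<^bsub>finsupp X N\<^esub>"
      using neg[OF c] v[OF c] by (intro bexI[of _ "\<lambda>x. \<ominus>\<^bsub>N\<^esub> c x"]) (auto simp: ops)
  next
    fix c c' assume "c \<in> carrier (finsupp X N)" "c' \<in> carrier (finsupp X N)"
    then show "c \<oplus>\<^bsub>finsupp X N\<^esub> c' = c' \<oplus>\<^bsub>finsupp X N\<^esub> c"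
      unfolding ops by (intro ext lmod_comm[OF N] v)
  next
    fix c c' c'' assume "c \<in> carrier (finsupp X N)" "c' \<in> carrier (finsupp X N)" "c'' \<in> carrier (finsupp X N)"
    then show "(c \<oplus>\<^bsub>finsupp X N\<^esub> c') \<oplus>\<^bsub>finsupp X N\<^esub> c'' = c \<oplus>\<^bsub>finsupp X N\<^esub> (c' \<oplus>\<^bsub>finsupp X N\<^esub> c'')"
      unfolding ops by (intro ext lmod_assoc[OF N] v)
  next
    show "\<zero>\<^bsub>finsupp X N\<^esub> \<in> carrier (finsupp X N)" by (simp add: finsupp_def)
  qed (simp_all add: ops add v)
  then show ?thesis
    by (rule left_moduleI[OF left_module_ring[OF N]])
      (auto simp: ops smult v left_module_l_distr[OF N] lmod_smult_add[OF N]
        left_module_smult_assoc[OF N] left_module_smult_one[OF N])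
qed

text \<open>A finitely supported function is determined by its level sets at nonzero values, and
  each of these is finite. Enumerating every level set by the naturals encodes the function as a
  family of points indexed by pairs (value, position). The spare point \<open>z\<close> outside
  \<open>X\<close> keeps every enumerated set nonempty.\<close>

lemma finsupp_lepoll_PiE:
  fixes N :: "('k, 'c) module" and A :: "'s set"
  assumes N: "left_module K N" and le: "carrier N \<times> (UNIV :: nat set) \<lesssim> I"
    and X: "X \<subseteq> A" "z \<in> A - X"
  shows "carrier (finsupp X N) \<lesssim> (\<Pi>\<^sub>E i \<in> I. A)"
proof -
  from le obtain u where u: "inj_on u (carrier N \<times> (UNIV :: nat set))" "u ` (carrier N \<times> UNIV) \<subseteq> I"
    unfolding lepoll_def by auto
  define w where "w = inv_into (carrier N \<times> (UNIV :: nat set)) u"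
  have w: "w (u (v, n)) = (v, n)" if "v \<in> carrier N" for v n
    unfolding w_def by (rule inv_into_f_f[OF u(1)]) (use that in simp)
  \<comment> \<open>The level at zero is dropped, since it may be uncountable; \<open>z\<close> is
    added to every level and is recognised later because it lies outside \<open>X\<close>.\<close>
  define S where "S c v = insert z (if v = \<zero>\<^bsub>N\<^esub> then {} else {x. c x = v})" for c :: "'s \<Rightarrow> 'c" and v
  \<comment> \<open>Coordinate \<open>u (v, n)\<close> holds the n-th point of the level set at
    \<open>v\<close>; the coordinates outside the image of \<open>u\<close> carry the default
    \<open>z\<close>.\<close>
  define e where "e c = (\<lambda>i\<in>I. if i \<in> u ` (carrier N \<times> UNIV)
     then from_nat_into (S c (fst (w i))) (snd (w i)) else z)" for c
  have S: "countable (S c v)" "S c v \<noteq> {}" "S c v \<subseteq> A" if "c \<in> carrier (finsupp X N)" for c v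
  proof -
    have "{x. c x = v} \<subseteq> {x. c x \<noteq> \<zero>\<^bsub>N\<^esub>}" if "v \<noteq> \<zero>\<^bsub>N\<^esub>" using that by auto
    then have "finite {x. c x = v}" if "v \<noteq> \<zero>\<^bsub>N\<^esub>"
      using that \<open>c \<in> _\<close> by (auto simp: finsupp_def intro: finite_subset)
    then show "countable (S c v)" by (auto simp: S_def intro: countable_finite)
    have "x \<in> X" if "c x = v" "v \<noteq> \<zero>\<^bsub>N\<^esub>" for x using that \<open>c \<in> _\<close> by (auto simp: finsupp_def)
    then show "S c v \<subseteq> A" using X by (auto simp: S_def)
  qed (simp add: S_def)
  have "inj_on e (carrier (finsupp X N))"
  proof (rule inj_onI)
    fix c c' assume c: "c \<in> carrier (finsupp X N)" "c' \<in> carrier (finsupp X N)" and eq: "e c = e c'"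
    have "from_nat_into (S c v) n = from_nat_into (S c' v) n" if "v \<in> carrier N" for v n
    proof -
      have "u (v, n) \<in> u ` (carrier N \<times> UNIV)" using that by blast
      moreover from this have "u (v, n) \<in> I" using u(2) by blast
      ultimately show ?thesis
        using fun_cong[OF eq, of "u (v, n)"] by (simp add: e_def w[OF that])
    qed
    then have SS: "S c v = S c' v" if "v \<in> carrier N" for v
      using range_from_nat_into[OF S(2,1)[OF c(1)], of v] range_from_nat_into[OF S(2,1)[OF c(2)], of v] that
      by (metis image_cong)
    \<comment> \<open>Equal level sets transfer nonzero values from \<open>c1\<close> to
      \<open>c2\<close>. Applied in both directions this also settles the points where one function
      vanishes.\<close>
    have aux: "c2 x = c1 x" if "c1 x \<noteq> \<zero>\<^bsub>N\<^esub>" "c1 \<in> carrier (finsupp X N)" "S c1 (c1 x) = S c2 (c1 x)"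
      for c1 c2 x
    proof -
      have "x \<in> X" using that by (auto simp: finsupp_def)
      then have "x \<noteq> z" using X by auto
      moreover have "x \<in> S c1 (c1 x)" using that(1) by (simp add: S_def)
      ultimately show ?thesis using that by (auto simp: S_def)
    qed
    show "c = c'"
    proof
      fix x
      show "c x = c' x"
        using aux[of c x c'] aux[of c' x c] SS finsupp_value[OF N c(1)] finsupp_value[OF N c(2)] c by metis
    qed
  qed
  moreover have "e c \<in> (\<Pi>\<^sub>E i \<in> I. A)" if "c \<in> carrier (finsupp X N)" for c
    using S(3)[OF that] from_nat_into[OF S(2)[OF that]] X unfolding e_def by fastforce
  ultimately show ?thesis unfolding lepoll_def by blast
qed

definition finsupp_unit :: "('r, 'x) ring_scheme \<Rightarrow> 's \<Rightarrow> 's \<Rightarrow> 'r" where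
  "finsupp_unit K x = (\<lambda>_. \<zero>\<^bsub>K\<^esub>)(x := \<one>\<^bsub>K\<^esub>)"

definition lincomb :: "('r, 'x) ring_scheme \<Rightarrow> ('r, 'a) module \<Rightarrow> ('s \<Rightarrow> 'a) \<Rightarrow> ('s \<Rightarrow> 'r) \<Rightarrow> 'a" where
  "lincomb K N t c = (\<Oplus>\<^bsub>N\<^esub>x\<in>{x. c x \<noteq> \<zero>\<^bsub>K\<^esub>}. c x \<odot>\<^bsub>N\<^esub> t x)"

context
  fixes K :: "('k, 'x) ring_scheme" and X :: "'s set"
  assumes K: "ring K"
begin

private abbreviation "F \<equiv> finsupp X (regular K)"

lemma carrier_free: "carrier F = {c. (\<forall>x. c x \<in> carrier K) \<and> (\<forall>x. x \<notin> X \<longrightarrow> c x = \<zero>\<^bsub>K\<^esub>) \<and>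
    finite {x. c x \<noteq> \<zero>\<^bsub>K\<^esub>}}"
proof -
  interpret ring K by (rule K)
  have "c x \<in> carrier K" if "\<forall>x\<in>X. c x \<in> carrier K" "\<forall>x. x \<notin> X \<longrightarrow> c x = \<zero>\<^bsub>K\<^esub>" for c x
    using that by (cases "x \<in> X") auto
  then show ?thesis by (auto simp: finsupp_def regular_def)
qed

lemma free_ops: "add F = (\<lambda>c c' x. c x \<oplus>\<^bsub>K\<^esub> c' x)" "smult F = (\<lambda>a c x. a \<otimes>\<^bsub>K\<^esub> c x)"
    "zero F = (\<lambda>_. \<zero>\<^bsub>K\<^esub>)"
  by (simp_all add: finsupp_def regular_def)

lemma finsupp_unit_closed: "x \<in> X \<Longrightarrow> finsupp_unit K x \<in> carrier F"
proof -
  interpret ring K by (rule K)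
  have "finite {y. finsupp_unit K x y \<noteq> \<zero>\<^bsub>K\<^esub>}"
    by (rule finite_subset[of _ "{x}"]) (auto simp: finsupp_unit_def)
  then show "x \<in> X \<Longrightarrow> ?thesis" by (auto simp: carrier_free finsupp_unit_def)
qed

context
  fixes N :: "('k, 'a) module" and t :: "'s \<Rightarrow> 'a"
  assumes N: "left_module K N" and t: "\<And>x. t x \<in> carrier N"
begin

text \<open>The support of a sum or a scalar multiple can shrink, so supports are first enlarged to
  a common finite set; the added terms are zero.\<close>

lemma lincomb_superset:
  assumes "c \<in> carrier F" "finite T" "{x. c x \<noteq> \<zero>\<^bsub>K\<^esub>} \<subseteq> T"
  shows "lincomb K N t c = (\<Oplus>\<^bsub>N\<^esub>x\<in>T. c x \<odot>\<^bsub>N\<^esub> t x)"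
proof -
  interpret N: abelian_group N by (rule left_module_group[OF N])
  show ?thesis unfolding lincomb_def
    by (rule N.add.finprod_mono_neutral_cong_left)
      (use assms t in \<open>auto simp: carrier_free lmod_smult[OF N] left_module_zero_smult[OF N]\<close>)
qed

lemma linear_map_lincomb: "linear_map K F N (lincomb K N t)"
proof -
  interpret K: ring K by (rule K)
  interpret N: abelian_group N by (rule left_module_group[OF N])
  note [simp] = lmod_smult[OF N] t
  have "lincomb K N t c \<in> carrier N" if "c \<in> carrier F" for c
    unfolding lincomb_def by (rule N.finsum_closed) (use that in \<open>auto simp: carrier_free\<close>)
  moreover have "lincomb K N t (c \<oplus>\<^bsub>F\<^esub> c') = lincomb K N t c \<oplus>\<^bsub>N\<^esub> lincomb K N t c'"
    if c: "c \<in> carrier F" "c' \<in> carrier F" for c c'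
  proof -
    let ?T = "{x. c x \<noteq> \<zero>\<^bsub>K\<^esub>} \<union> {x. c' x \<noteq> \<zero>\<^bsub>K\<^esub>}"
    have fin: "finite ?T" using c by (simp add: carrier_free)
    have cc: "c \<oplus>\<^bsub>F\<^esub> c' \<in> carrier F"
      using lmod_add[OF left_module_finsupp[OF left_module_regular[OF K]]] c by blast
    have "lincomb K N t (c \<oplus>\<^bsub>F\<^esub> c') = (\<Oplus>\<^bsub>N\<^esub>x\<in>?T. (c \<oplus>\<^bsub>F\<^esub> c') x \<odot>\<^bsub>N\<^esub> t x)"
      by (rule lincomb_superset[OF cc fin]) (use c in \<open>auto simp: free_ops carrier_free\<close>)
    also have "\<dots> = (\<Oplus>\<^bsub>N\<^esub>x\<in>?T. c x \<odot>\<^bsub>N\<^esub> t x \<oplus>\<^bsub>N\<^esub> c' x \<odot>\<^bsub>N\<^esub> t x)"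
      by (rule N.finsum_cong')
        (use c in \<open>auto simp: free_ops carrier_free left_module_l_distr[OF N]\<close>)
    also have "\<dots> = (\<Oplus>\<^bsub>N\<^esub>x\<in>?T. c x \<odot>\<^bsub>N\<^esub> t x) \<oplus>\<^bsub>N\<^esub> (\<Oplus>\<^bsub>N\<^esub>x\<in>?T. c' x \<odot>\<^bsub>N\<^esub> t x)"
      by (rule N.finsum_addf) (use c in \<open>auto simp: carrier_free\<close>)
    also have "\<dots> = lincomb K N t c \<oplus>\<^bsub>N\<^esub> lincomb K N t c'"
      using lincomb_superset[OF c(1) fin] lincomb_superset[OF c(2) fin] by simp
    finally show ?thesis .
  qed
  moreover have "lincomb K N t (a \<odot>\<^bsub>F\<^esub> c) = a \<odot>\<^bsub>N\<^esub> lincomb K N t c"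
    if a: "a \<in> carrier K" and c: "c \<in> carrier F" for a c
  proof -
    let ?T = "{x. c x \<noteq> \<zero>\<^bsub>K\<^esub>}"
    have fin: "finite ?T" using c by (simp add: carrier_free)
    have cc: "a \<odot>\<^bsub>F\<^esub> c \<in> carrier F"
      using lmod_smult[OF left_module_finsupp[OF left_module_regular[OF K]]] c a by blast
    have "lincomb K N t (a \<odot>\<^bsub>F\<^esub> c) = (\<Oplus>\<^bsub>N\<^esub>x\<in>?T. (a \<odot>\<^bsub>F\<^esub> c) x \<odot>\<^bsub>N\<^esub> t x)"
      by (rule lincomb_superset[OF cc fin]) (use c a in \<open>auto simp: free_ops carrier_free\<close>)
    also have "\<dots> = (\<Oplus>\<^bsub>N\<^esub>x\<in>?T. a \<odot>\<^bsub>N\<^esub> (c x \<odot>\<^bsub>N\<^esub> t x))"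
      by (rule N.finsum_cong')
        (use a c in \<open>auto simp: free_ops carrier_free left_module_smult_assoc[OF N]\<close>)
    also have "\<dots> = a \<odot>\<^bsub>N\<^esub> (\<Oplus>\<^bsub>N\<^esub>x\<in>?T. c x \<odot>\<^bsub>N\<^esub> t x)"
      using fin
    proof induction
      case (insert x T)
      have "(\<Oplus>\<^bsub>N\<^esub>x\<in>T. c x \<odot>\<^bsub>N\<^esub> t x) \<in> carrier N"
        by (rule N.finsum_closed) (use c in \<open>auto simp: carrier_free\<close>)
      then show ?case using insert a c
        by (simp add: N.finsum_insert Pi_def carrier_free lmod_smult_add[OF N])
    qed (use a in \<open>simp add: lmod_smult_0[OF N]\<close>)
    finally show ?thesis by (simp add: lincomb_def)
  qed
  ultimately show ?thesis by (simp add: linear_map_def)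
qed

lemma lincomb_unit: "x \<in> X \<Longrightarrow> lincomb K N t (finsupp_unit K x) = t x"
proof -
  assume x: "x \<in> X"
  interpret K: ring K by (rule K)
  interpret N: abelian_group N by (rule left_module_group[OF N])
  have "lincomb K N t (finsupp_unit K x) = (\<Oplus>\<^bsub>N\<^esub>y\<in>{x}. finsupp_unit K x y \<odot>\<^bsub>N\<^esub> t y)"
    by (rule lincomb_superset[OF finsupp_unit_closed[OF x]]) (auto simp: finsupp_unit_def)
  then show ?thesis
    using t by (simp add: N.finsum_insert lmod_smult[OF N] finsupp_unit_def left_module_smult_one[OF N])
qed

end

text \<open>Uniqueness of linear extensions from the basis: induction on a finite set containing the
  support, with the element \<open>c\<close> generalised because each step erases one
  coordinate.\<close>

lemma free_linear_eq:
  fixes N :: "('k, 'a) module"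
  assumes N: "left_module K N" and f: "linear_map K F N f" and g: "linear_map K F N g"
    and eq: "\<And>x. x \<in> X \<Longrightarrow> f (finsupp_unit K x) = g (finsupp_unit K x)" and c: "c \<in> carrier F"
  shows "f c = g c"
proof -
  interpret K: ring K by (rule K)
  have L: "left_module K F" by (rule left_module_finsupp[OF left_module_regular[OF K]])
  have fin: "finite {x. c x \<noteq> \<zero>\<^bsub>K\<^esub>}" using c by (simp add: carrier_free)
  have "f c = g c" if "finite T" "{x. c x \<noteq> \<zero>\<^bsub>K\<^esub>} \<subseteq> T" "c \<in> carrier F" for T c
    using that
  proof (induction T arbitrary: c)
    case empty
    then have "c = \<zero>\<^bsub>F\<^esub>" by (auto simp: free_ops)
    then show ?case using linear_map_zero[OF L N f] linear_map_zero[OF L N g] by simp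
  next
    case (insert x T)
    show ?case
    proof (cases "x \<in> X")
      case False
      then have "c x = \<zero>\<^bsub>K\<^esub>" using insert.prems by (simp add: carrier_free)
      then show ?thesis using insert by auto
    next
      case True
      let ?c = "c(x := \<zero>\<^bsub>K\<^esub>)"
      have "{y. ?c y \<noteq> \<zero>\<^bsub>K\<^esub>} \<subseteq> {y. c y \<noteq> \<zero>\<^bsub>K\<^esub>}" by auto
      then have c': "?c \<in> carrier F"
        using insert.prems by (auto simp: carrier_free intro: finite_subset)
      have cx: "c x \<in> carrier K" using insert.prems by (simp add: carrier_free)
      \<comment> \<open>The coordinate at \<open>x\<close> is split off as a multiple of a basis
        vector; what remains is supported in \<open>T\<close>.\<close>
      have dec: "c = ?c \<oplus>\<^bsub>F\<^esub> c x \<odot>\<^bsub>F\<^esub> finsupp_unit K x"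
        using insert.prems by (auto simp: free_ops finsupp_unit_def carrier_free)
      have u: "finsupp_unit K x \<in> carrier F" by (rule finsupp_unit_closed[OF True])
      have su: "c x \<odot>\<^bsub>F\<^esub> finsupp_unit K x \<in> carrier F" by (rule lmod_smult[OF L cx u])
      have IH: "f ?c = g ?c" by (rule insert.IH[OF _ c']) (use insert.prems in auto)
      show ?thesis
        by (subst (1 2) dec)
          (simp only: linear_mapD(2)[OF f c' su] linear_mapD(2)[OF g c' su]
            linear_mapD(3)[OF f cx u] linear_mapD(3)[OF g cx u] IH eq[OF True])
    qed
  qed
  from this[OF fin subset_refl c] show ?thesis .
qed

end

lemma linear_map_comp:
  assumes "linear_map R A B f" "linear_map R B C g"
  shows "linear_map R A C (\<lambda>x. g (f x))"
  using assms by (auto simp: linear_map_def)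

context module_category
begin

section \<open>Transport into the universe; projectives, injectives and biproducts\<close>

lemma transport:
  fixes M :: "('r, 't) module"
  assumes M: "left_module R M" and le: "carrier M \<lesssim> B" "B \<in> U"
  obtains N h k where "N \<in> Mods" "linear_map R M N h" "linear_map R N M k"
    "\<And>x. x \<in> carrier M \<Longrightarrow> k (h x) = x" "\<And>y. y \<in> carrier N \<Longrightarrow> h (k y) = y"
proof -
  from le obtain h where h: "inj_on h (carrier M)" "h ` carrier M \<subseteq> B" unfolding lepoll_def by auto
  note heq = inj_on_eq_iff[OF h(1)]
  obtain N :: "('r, 'm) module" where N: "left_module R N" "carrier N = h ` carrier M"
    "\<And>x y. \<lbrakk>x \<in> carrier M; y \<in> carrier M\<rbrakk> \<Longrightarrow> h (x \<oplus>\<^bsub>M\<^esub> y) = h x \<oplus>\<^bsub>N\<^esub> h y"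
    "\<And>a x. \<lbrakk>a \<in> carrier R; x \<in> carrier M\<rbrakk> \<Longrightarrow> h (a \<odot>\<^bsub>M\<^esub> x) = a \<odot>\<^bsub>N\<^esub> h x"
  proof (rule image_module[where q = h, OF M])
    show "h (x \<oplus>\<^bsub>M\<^esub> y) = h (x' \<oplus>\<^bsub>M\<^esub> y')" if "x \<in> carrier M" "x' \<in> carrier M" "y \<in> carrier M" "y' \<in> carrier M"
      "h x = h x'" "h y = h y'" for x x' y y' using that heq by auto
    show "h (a \<odot>\<^bsub>M\<^esub> x) = h (a \<odot>\<^bsub>M\<^esub> x')" if "a \<in> carrier R" "x \<in> carrier M" "x' \<in> carrier M" "h x = h x'"
      for a x x' using that heq by auto
  qed (rule that)
  have NM: "N \<in> Mods"
    using N(1,2) h(2) le(2) by (auto simp: Mod_cat_def intro: universe_lepoll subset_imp_lepoll)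
  have hl: "linear_map R M N h" using N by (auto simp: linear_map_def)
  define k where "k = inv_into (carrier M) h"
  have k: "k (h x) = x" if "x \<in> carrier M" for x
    unfolding k_def by (rule inv_into_f_f[OF h(1) that])
  have k2: "k y \<in> carrier M" "h (k y) = y" if "y \<in> carrier N" for y
    using that k by (auto simp: N(2))
  have "linear_map R N M k"
    unfolding linear_map_def
  proof (intro conjI ballI)
    fix x y assume "x \<in> carrier N" "y \<in> carrier N"
    then have "k (h (k x \<oplus>\<^bsub>M\<^esub> k y)) = k x \<oplus>\<^bsub>M\<^esub> k y" by (intro k lmod_add[OF M] k2)
    then show "k (x \<oplus>\<^bsub>N\<^esub> y) = k x \<oplus>\<^bsub>M\<^esub> k y"
      using \<open>x \<in> carrier N\<close> \<open>y \<in> carrier N\<close> by (simp add: N(3) k2)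
  next
    fix a y assume "a \<in> carrier R" "y \<in> carrier N"
    then have "k (h (a \<odot>\<^bsub>M\<^esub> k y)) = a \<odot>\<^bsub>M\<^esub> k y" by (intro k lmod_smult[OF M] k2)
    then show "k (a \<odot>\<^bsub>N\<^esub> y) = a \<odot>\<^bsub>M\<^esub> k y"
      using \<open>a \<in> carrier R\<close> \<open>y \<in> carrier N\<close> by (simp add: N(4) k2)
  qed (use k2 in auto)
  then show thesis by (rule that[OF NM hl _ k k2(2)])
qed

lemma Hom_linear_map: "f \<in> Hom R A B \<Longrightarrow> linear_map R A B f"
  by (auto simp: linear_map_def)

lemma linear_map_Hom: "\<lbrakk>linear_map R A B f; A \<in> Mods\<rbrakk> \<Longrightarrow> restrict f (carrier A) \<in> Hom R A B"
  by (rule Hom_restrict) (auto simp: linear_map_def)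

lemma ProjI:
  assumes "P \<in> Mods"
    and "\<And>A B p f. \<lbrakk>A \<in> Mods; B \<in> Mods; p \<in> Hom R A B; f \<in> Hom R P B; p ` carrier A = carrier B\<rbrakk> \<Longrightarrow>
       \<exists>g \<in> Hom R P A. \<forall>x \<in> carrier P. p (g x) = f x"
  shows "P \<in> Proj R U"
  unfolding Proj_def
proof (intro CollectI conjI assms(1) ballI impI)
  fix A B p f assume *: "A \<in> Mods" "B \<in> Mods" "p \<in> Hom R A B" "f \<in> Hom R P B" "p ` carrier A = carrier B"
  from assms(2)[OF *] obtain g where g: "g \<in> Hom R P A" "\<forall>x \<in> carrier P. p (g x) = f x" by blast
  have "compose (carrier P) p g = f"
    by (rule Hom_eqI[of _ P B]) (use g * assms(1) in auto)
  then show "\<exists>g\<in>Hom R P A. compose (carrier P) p g = f" using g by blast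
qed

lemma Proj_lift:
  assumes "P \<in> Proj R U" "A \<in> Mods" "B \<in> Mods" "p \<in> Hom R A B" "f \<in> Hom R P B" "p ` carrier A = carrier B"
  obtains g where "g \<in> Hom R P A" "\<And>x. x \<in> carrier P \<Longrightarrow> p (g x) = f x"
proof -
  obtain g where g: "g \<in> Hom R P A" "compose (carrier P) p g = f"
    using assms unfolding Proj_def by blast
  then have "p (g x) = f x" if "x \<in> carrier P" for x using that by auto
  then show thesis using that g by blast
qed

lemma Proj_Mods: "P \<in> Proj R U \<Longrightarrow> P \<in> Mods"
  unfolding Proj_def by blast

lemma InjI:
  assumes "E \<in> Mods"
    and "\<And>A B i f. \<lbrakk>A \<in> Mods; B \<in> Mods; i \<in> Hom R A B; f \<in> Hom R A E; inj_on i (carrier A)\<rbrakk> \<Longrightarrow>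
       \<exists>g \<in> Hom R B E. \<forall>x \<in> carrier A. g (i x) = f x"
  shows "E \<in> Inj R U"
  unfolding Inj_def
proof (intro CollectI conjI assms(1) ballI impI)
  fix A B i f assume *: "A \<in> Mods" "B \<in> Mods" "i \<in> Hom R A B" "f \<in> Hom R A E" "inj_on i (carrier A)"
  from assms(2)[OF *] obtain g where g: "g \<in> Hom R B E" "\<forall>x \<in> carrier A. g (i x) = f x" by blast
  have "compose (carrier A) g i = f"
    by (rule Hom_eqI[of _ A E]) (use g * in auto)
  then show "\<exists>g\<in>Hom R B E. compose (carrier A) g i = f" using g by blast
qed

lemma Inj_extend:
  assumes "E \<in> Inj R U" "A \<in> Mods" "B \<in> Mods" "i \<in> Hom R A B" "f \<in> Hom R A E" "inj_on i (carrier A)"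
  obtains g where "g \<in> Hom R B E" "\<And>x. x \<in> carrier A \<Longrightarrow> g (i x) = f x"
proof -
  obtain g where g: "g \<in> Hom R B E" "compose (carrier A) g i = f"
    using assms unfolding Inj_def by blast
  then have "g (i x) = f x" if "x \<in> carrier A" for x using that by auto
  then show thesis using that g by blast
qed

lemma Inj_Mods: "E \<in> Inj R U \<Longrightarrow> E \<in> Mods"
  unfolding Inj_def by blast

text \<open>Binary products come from the product axiom by taking the factor \<open>A\<close> at
  index \<open>n = 0\<close> and \<open>B\<close> at all other indices: a pair becomes a family that
  depends on \<open>n\<close> only. Injectivity is read off at \<open>0\<close> and
  \<open>1\<close>, with zero of \<open>R\<close> as first index.\<close>

lemma universe_times:
  assumes "A \<in> U" "B \<in> U"
  obtains C where "C \<in> U" "A \<times> B \<lesssim> C"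
proof -
  define F where "F = (\<lambda>(r :: 'r, n :: nat). if n = 0 then A else B)"
  obtain C where C: "C \<in> U" "(\<Pi>\<^sub>E i \<in> carrier R \<times> (UNIV :: nat set). F i) \<lesssim> C"
    by (rule universe_PiE[of F]) (use assms in \<open>auto simp: F_def\<close>)
  define e :: "'m \<times> 'm \<Rightarrow> 'r \<times> nat \<Rightarrow> 'm" where
    "e = (\<lambda>(a, b). \<lambda>i\<in>carrier R \<times> UNIV. if snd i = 0 then a else b)"
  have z: "\<zero>\<^bsub>R\<^esub> \<in> carrier R" using ring by (simp add: ring.ring_simprules(2))
  have "inj e"
  proof (rule injI)
    fix p q assume "e p = e q"
    then have "e p (\<zero>\<^bsub>R\<^esub>, n) = e q (\<zero>\<^bsub>R\<^esub>, n)" for n by simp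
    from this[of 0] this[of 1] show "p = q" using z by (auto simp: e_def split: prod.splits)
  qed
  then have "inj_on e (A \<times> B)" by (rule inj_on_subset) simp
  moreover have "e ` (A \<times> B) \<subseteq> (\<Pi>\<^sub>E i \<in> carrier R \<times> (UNIV :: nat set). F i)"
    by (clarsimp simp only: e_def restrict_PiE_iff) (auto simp: F_def)
  ultimately have "A \<times> B \<lesssim> (\<Pi>\<^sub>E i \<in> carrier R \<times> (UNIV :: nat set). F i)" unfolding lepoll_def by blast
  then show thesis using that C lepoll_trans by blast
qed

text \<open>Only the projections are recorded: jointly they are a bijection onto the pairs. Maps
  into \<open>S\<close> are then built from their components by \<open>biprod_pair\<close>, and maps
  out of \<open>S\<close> are sums of maps composed with \<open>p\<close> and
  \<open>q\<close>.\<close>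

definition biprod where
  "biprod S p q A B \<longleftrightarrow> S \<in> Mods \<and> p \<in> Hom R S A \<and> q \<in> Hom R S B \<and>
     (\<forall>a\<in>carrier A. \<forall>b\<in>carrier B. \<exists>s\<in>carrier S. p s = a \<and> q s = b) \<and>
     (\<forall>s\<in>carrier S. \<forall>s'\<in>carrier S. p s = p s' \<longrightarrow> q s = q s' \<longrightarrow> s = s')"

lemma biprod_exists:
  assumes A: "A \<in> Mods" and B: "B \<in> Mods"
  obtains S p q where "biprod S p q A B"
proof -
  define M :: "('r, 'm \<times> 'm) module" where
    "M = \<lparr>carrier = carrier A \<times> carrier B, mult = undefined, one = undefined, zero = (\<zero>\<^bsub>A\<^esub>, \<zero>\<^bsub>B\<^esub>),
      add = (\<lambda>(a, b) (a', b'). (a \<oplus>\<^bsub>A\<^esub> a', b \<oplus>\<^bsub>B\<^esub> b')), smult = (\<lambda>r (a, b). (r \<odot>\<^bsub>A\<^esub> a, r \<odot>\<^bsub>B\<^esub> b))\<rparr>"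
  note LA = Mod_left_module[OF A] and LB = Mod_left_module[OF B]
  have M: "left_module R M"
  proof (rule left_moduleI[OF ring])
    show "abelian_group M"
    proof (rule abelian_groupI)
      fix x assume "x \<in> carrier M"
      then show "\<exists>y\<in>carrier M. y \<oplus>\<^bsub>M\<^esub> x = \<zero>\<^bsub>M\<^esub>" using A B
        by (intro bexI[of _ "(\<ominus>\<^bsub>A\<^esub> fst x, \<ominus>\<^bsub>B\<^esub> snd x)"]) (auto simp: M_def)
    qed (use A B in \<open>auto simp: M_def mod_ac\<close>)
  qed (use A B in \<open>auto simp: M_def left_module_l_distr[OF LA] left_module_l_distr[OF LB] mod_smult_add
        left_module_smult_assoc[OF LA] left_module_smult_assoc[OF LB]
        left_module_smult_one[OF LA] left_module_smult_one[OF LB]\<close>)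
  obtain C where C: "C \<in> U" "carrier A \<times> carrier B \<lesssim> C"
    by (rule universe_times[OF Mod_carrier[OF A] Mod_carrier[OF B]])
  have le: "carrier M \<lesssim> C" using C(2) by (simp add: M_def)
  obtain S :: "('r, 'm) module" and h k where S: "S \<in> Mods" "linear_map R M S h" "linear_map R S M k"
    "\<And>x. x \<in> carrier M \<Longrightarrow> k (h x) = x" "\<And>y. y \<in> carrier S \<Longrightarrow> h (k y) = y"
    by (rule transport[OF M le C(1)]) (rule that)
  have "linear_map R M A fst" "linear_map R M B snd" by (auto simp: linear_map_def M_def)
  then have pq: "linear_map R S A (\<lambda>s. fst (k s))" "linear_map R S B (\<lambda>s. snd (k s))"
    using linear_map_comp[OF S(3)] by auto
  have "biprod S (\<lambda>s\<in>carrier S. fst (k s)) (\<lambda>s\<in>carrier S. snd (k s)) A B"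
    unfolding biprod_def
  proof (intro conjI ballI impI)
    fix a b assume "a \<in> carrier A" "b \<in> carrier B"
    then have "(a, b) \<in> carrier M" by (simp add: M_def)
    then show "\<exists>s\<in>carrier S. (\<lambda>s\<in>carrier S. fst (k s)) s = a \<and> (\<lambda>s\<in>carrier S. snd (k s)) s = b"
      using S(2,4) by (intro bexI[of _ "h (a, b)"]) (auto simp: linear_map_def)
  next
    fix s s' assume s: "s \<in> carrier S" "s' \<in> carrier S" "(\<lambda>s\<in>carrier S. fst (k s)) s = (\<lambda>s\<in>carrier S. fst (k s)) s'"
      "(\<lambda>s\<in>carrier S. snd (k s)) s = (\<lambda>s\<in>carrier S. snd (k s)) s'"
    then have "k s = k s'" by (simp add: prod_eq_iff)
    then show "s = s'" using S(5) s by metis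
  qed (rule S(1) linear_map_Hom[OF pq(1) S(1)] linear_map_Hom[OF pq(2) S(1)])+
  then show thesis by (rule that)
qed

lemma biprod_pair:
  assumes S: "biprod S p q A B" and f: "f \<in> Hom R X A" and g: "g \<in> Hom R X B"
    and M: "A \<in> Mods" "B \<in> Mods" "X \<in> Mods"
  obtains h where "h \<in> Hom R X S" "\<And>x. x \<in> carrier X \<Longrightarrow> p (h x) = f x"
    "\<And>x. x \<in> carrier X \<Longrightarrow> q (h x) = g x"
proof -
  have SM: "S \<in> Mods" "p \<in> Hom R S A" "q \<in> Hom R S B" using S by (auto simp: biprod_def)
  have eqI: "s = s'" if "s \<in> carrier S" "s' \<in> carrier S" "p s = p s'" "q s = q s'" for s s'
    using S that by (auto simp: biprod_def)
  have "\<forall>x\<in>carrier X. \<exists>s\<in>carrier S. p s = f x \<and> q s = g x"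
    using S f g by (auto simp: biprod_def)
  then obtain h where h: "\<And>x. x \<in> carrier X \<Longrightarrow> h x \<in> carrier S \<and> p (h x) = f x \<and> q (h x) = g x"
    by metis
  then have hs: "h x \<in> carrier S" "p (h x) = f x" "q (h x) = g x" if "x \<in> carrier X" for x
    using that by auto
  have "restrict h (carrier X) \<in> Hom R X S"
  proof (rule Hom_restrict)
    fix x y assume "x \<in> carrier X" "y \<in> carrier X"
    then show "h (x \<oplus>\<^bsub>X\<^esub> y) = h x \<oplus>\<^bsub>S\<^esub> h y"
      by - (rule eqI, simp_all add: hs Hom_add[OF SM(2)] Hom_add[OF SM(3)] Hom_add[OF f] Hom_add[OF g]
        Hom_smult[OF SM(2)] Hom_smult[OF SM(3)] Hom_smult[OF f] Hom_smult[OF g] SM M del: Hom_add Hom_smult)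
  next
    fix a x assume "a \<in> carrier R" "x \<in> carrier X"
    then show "h (a \<odot>\<^bsub>X\<^esub> x) = a \<odot>\<^bsub>S\<^esub> h x"
      by - (rule eqI, simp_all add: hs Hom_add[OF SM(2)] Hom_add[OF SM(3)] Hom_add[OF f] Hom_add[OF g]
        Hom_smult[OF SM(2)] Hom_smult[OF SM(3)] Hom_smult[OF f] Hom_smult[OF g] SM M del: Hom_add Hom_smult)
  qed (simp_all add: hs M)
  then show thesis using that hs by simp
qed

section \<open>Enough projectives\<close>

lemma universe_power:
  assumes "A \<in> U"
  obtains C where "C \<in> U" "(\<Pi>\<^sub>E i \<in> carrier R \<times> (UNIV :: nat set). A) \<lesssim> C"
  using assms by (rule universe_PiE)

text \<open>The set \<open>B\<close> may live in another type than the universe; a function on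
  \<open>R\<close> is read as a family over \<open>R\<close> times the naturals that ignores the
  second index. It bounds the set of additive maps from \<open>R\<close> to a divisible
  group.\<close>

lemma universe_power_carrier:
  assumes "A \<in> U" "B \<lesssim> A"
  obtains C where "C \<in> U" "(\<Pi>\<^sub>E i \<in> carrier R. B) \<lesssim> C"
proof -
  obtain C where C: "C \<in> U" "(\<Pi>\<^sub>E i \<in> carrier R \<times> (UNIV :: nat set). A) \<lesssim> C"
    by (rule universe_power[OF assms(1)])
  obtain u where u: "inj_on u B" "u ` B \<subseteq> A" using assms(2) unfolding lepoll_def by auto
  define e where "e f = (\<lambda>i\<in>carrier R \<times> (UNIV :: nat set). u (f (fst i)))" for f :: "'r \<Rightarrow> 'a"
  have "inj_on e (\<Pi>\<^sub>E i \<in> carrier R. B)"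
  proof (rule inj_onI)
    fix f g assume fg: "f \<in> (\<Pi>\<^sub>E i \<in> carrier R. B)" "g \<in> (\<Pi>\<^sub>E i \<in> carrier R. B)" "e f = e g"
    show "f = g"
    proof (rule PiE_ext[OF fg(1,2)])
      fix i assume i: "i \<in> carrier R"
      then have "u (f i) = u (g i)" using fun_cong[OF fg(3), of "(i, 0)"] by (simp add: e_def)
      then show "f i = g i" using inj_onD[OF u(1)] fg(1,2) i by (meson PiE_mem)
    qed
  qed
  moreover have "e ` (\<Pi>\<^sub>E i \<in> carrier R. B) \<subseteq> (\<Pi>\<^sub>E i \<in> carrier R \<times> (UNIV :: nat set). A)"
    using u(2) unfolding e_def by (fastforce simp: restrict_PiE_iff)
  ultimately have "(\<Pi>\<^sub>E i \<in> carrier R. B) \<lesssim> (\<Pi>\<^sub>E i \<in> carrier R \<times> (UNIV :: nat set). A)"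
    unfolding lepoll_def by blast
  then show thesis by (rule that[OF C(1) lepoll_trans[OF _ C(2)]])
qed

text \<open>The pairs (value, position) of the encoding must fit into the index set of the product
  axiom. This holds for coefficients in \<open>R\<close> itself and for countable coefficients such
  as the rationals.\<close>

lemma finsupp_universe:
  fixes N :: "('k, 'c) module"
  assumes N: "left_module K N" and le: "carrier N \<times> (UNIV :: nat set) \<lesssim> carrier R \<times> (UNIV :: nat set)"
    and A: "A \<in> U" "X \<subseteq> A" "z \<in> A - X"
  obtains C where "C \<in> U" "carrier (finsupp X N) \<lesssim> C"
proof -
  obtain C where C: "C \<in> U" "(\<Pi>\<^sub>E i \<in> carrier R \<times> (UNIV :: nat set). A) \<lesssim> C"
    by (rule universe_power[OF A(1)])
  show thesis by (rule that[OF C(1) lepoll_trans[OF finsupp_lepoll_PiE[OF N le A(2,3)] C(2)]])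
qed

text \<open>Leaving out \<open>0\<close> from the generators frees a point of the carrier for the encoding in
  \<open>finsupp_lepoll_PiE\<close>.\<close>

lemma enough_projectives:
  assumes X: "X \<in> Mods"
  obtains P p where "P \<in> Proj R U" "p \<in> Hom R P X" "p ` carrier P = carrier X"
proof -
  define B where "B = carrier X - {\<zero>\<^bsub>X\<^esub>}"
  let ?F = "finsupp B (regular R)"
  have L: "left_module R ?F" by (rule left_module_finsupp[OF left_module_regular[OF ring]])
  have LX: "left_module R X" by (rule Mod_left_module[OF X])
  obtain C where C: "C \<in> U" "carrier ?F \<lesssim> C"
    by (rule finsupp_universe[OF left_module_regular[OF ring], of "carrier X" B "\<zero>\<^bsub>X\<^esub>"])
      (use X Mod_carrier in \<open>auto simp: B_def regular_def lepoll_refl\<close>)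
  obtain P :: "('r, 'm) module" and h k where P: "P \<in> Mods" "linear_map R ?F P h" "linear_map R P ?F k"
    "\<And>x. x \<in> carrier ?F \<Longrightarrow> k (h x) = x" "\<And>y. y \<in> carrier P \<Longrightarrow> h (k y) = y"
    by (rule transport[OF L C(2,1)]) (rule that)
  have "P \<in> Proj R U"
  proof (rule ProjI[OF P(1)])
    fix A A' p f assume *: "A \<in> Mods" "A' \<in> Mods" "p \<in> Hom R A A'" "f \<in> Hom R P A'" "p ` carrier A = carrier A'"
    note LA = Mod_left_module[OF *(1)] and LA' = Mod_left_module[OF *(2)]
    have "\<exists>a\<in>carrier A. x \<in> B \<longrightarrow> p a = f (h (finsupp_unit R x))" for x
    proof (cases "x \<in> B")
      case True
      then have "f (h (finsupp_unit R x)) \<in> carrier A'"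
        using linear_mapD(1)[OF P(2) finsupp_unit_closed[OF ring True]] *(4) by simp
      then show ?thesis using *(5) by (metis imageE)
    qed (use *(1) mod_zero in blast)
    then obtain t where t: "\<And>x. t x \<in> carrier A" "\<And>x. x \<in> B \<Longrightarrow> p (t x) = f (h (finsupp_unit R x))"
      by metis
    note l = linear_map_lincomb[OF ring LA t(1), of B]
    have eq: "p (lincomb R A t c) = f (h c)" if "c \<in> carrier ?F" for c
      by (rule free_linear_eq[OF ring LA' linear_map_comp[OF l Hom_linear_map[OF *(3)]]
           linear_map_comp[OF P(2) Hom_linear_map[OF *(4)]] _ that])
        (simp add: lincomb_unit[OF ring LA t(1)] t(2))
    let ?g = "restrict (\<lambda>y. lincomb R A t (k y)) (carrier P)"
    have "?g \<in> Hom R P A"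
      by (rule linear_map_Hom[OF linear_map_comp[OF P(3) l] P(1)])
    moreover have "\<forall>x\<in>carrier P. p (?g x) = f x"
      using eq linear_mapD(1)[OF P(3)] P(5) by simp
    ultimately show "\<exists>g\<in>Hom R P A. \<forall>x\<in>carrier P. p (g x) = f x" by blast
  qed
  moreover
  \<comment> \<open>Zero is a default value off the carrier: \<open>lincomb\<close> requires a value
    in the module at every point of the type.\<close>
  define t where "t x = (if x \<in> carrier X then x else \<zero>\<^bsub>X\<^esub>)" for x
  have t: "t x \<in> carrier X" for x using X by (simp add: t_def)
  note l = linear_map_lincomb[OF ring LX t, of B]
  let ?p = "restrict (\<lambda>y. lincomb R X t (k y)) (carrier P)"
  have p: "?p \<in> Hom R P X"
    by (rule linear_map_Hom[OF linear_map_comp[OF P(3) l] P(1)])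
  moreover have "x \<in> ?p ` carrier P" if "x \<in> carrier X" for x
  proof (cases "x = \<zero>\<^bsub>X\<^esub>")
    case True
    then show ?thesis using Hom_zero[OF p P(1) X] mod_zero[OF P(1)] by (metis image_eqI)
  next
    case False
    then have "x \<in> B" using that by (simp add: B_def)
    then have u: "finsupp_unit R x \<in> carrier ?F" by (rule finsupp_unit_closed[OF ring])
    have "h (finsupp_unit R x) \<in> carrier P" by (rule linear_mapD(1)[OF P(2) u])
    moreover from this have "?p (h (finsupp_unit R x)) = x"
      using P(4)[OF u] lincomb_unit[where t = t, OF ring LX t \<open>x \<in> B\<close>] that by (simp add: t_def)
    ultimately show ?thesis by (metis image_eqI)
  qed
  ultimately show thesis
    using that[of P ?p] Hom_closed[OF p] by (intro that) auto
qed

end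

section \<open>Abelian groups as modules over the integers; divisible groups\<close>

definition int_ring :: "int ring" where
  "int_ring = \<lparr>carrier = UNIV, mult = (*), one = 1, zero = 0, add = (+)\<rparr>"

lemma ring_int_ring: "ring int_ring"
proof (rule ringI)
  show "abelian_group int_ring"
  proof (rule abelian_groupI)
    fix x assume "x \<in> carrier int_ring"
    show "\<exists>y\<in>carrier int_ring. y \<oplus>\<^bsub>int_ring\<^esub> x = \<zero>\<^bsub>int_ring\<^esub>"
      by (rule bexI[of _ "- x"]) (simp_all add: int_ring_def)
  qed (simp_all add: int_ring_def)
  show "monoid int_ring" by (rule monoidI) (simp_all add: int_ring_def)
qed (simp_all add: int_ring_def algebra_simps)

text \<open>Compatibility with integer multiples follows by two-sided induction from 0; the downward
  step cancels one copy of \<open>f x\<close>. Afterwards only additivity has to be checked for maps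
  of abelian groups.\<close>

lemma additive_int_linear:
  assumes M: "left_module int_ring M" and N: "left_module int_ring N"
    and closed: "\<And>x. x \<in> carrier M \<Longrightarrow> f x \<in> carrier N"
    and add: "\<And>x y. \<lbrakk>x \<in> carrier M; y \<in> carrier M\<rbrakk> \<Longrightarrow> f (x \<oplus>\<^bsub>M\<^esub> y) = f x \<oplus>\<^bsub>N\<^esub> f y"
  shows "linear_map int_ring M N f"
proof -
  have int: "k \<in> carrier int_ring" "\<zero>\<^bsub>int_ring\<^esub> = 0" "\<one>\<^bsub>int_ring\<^esub> = 1" "k \<oplus>\<^bsub>int_ring\<^esub> l = k + l" for k l
    by (simp_all add: int_ring_def)
  note [simp] = lmod_smult[OF M int(1)] lmod_smult[OF N int(1)] lmod_zero[OF M] closed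
  have f0: "f \<zero>\<^bsub>M\<^esub> = \<zero>\<^bsub>N\<^esub>" by (rule additive_zero[OF M N]) (auto simp: add)
  have s1: "(k + 1) \<odot>\<^bsub>M\<^esub> x = k \<odot>\<^bsub>M\<^esub> x \<oplus>\<^bsub>M\<^esub> x" if "x \<in> carrier M" for k x
    using left_module_l_distr[OF M int(1) int(1) that, of k 1] left_module_smult_one[OF M that]
    by (simp add: int)
  have s2: "(k + 1) \<odot>\<^bsub>N\<^esub> x = k \<odot>\<^bsub>N\<^esub> x \<oplus>\<^bsub>N\<^esub> x" if "x \<in> carrier N" for k x
    using left_module_l_distr[OF N int(1) int(1) that, of k 1] left_module_smult_one[OF N that]
    by (simp add: int)
  have "f (k \<odot>\<^bsub>M\<^esub> x) = k \<odot>\<^bsub>N\<^esub> f x" if x: "x \<in> carrier M" for k :: int and x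
  proof (induction k rule: int_induct[where k = 0])
    case base
    then show ?case
      using left_module_zero_smult[OF M x] left_module_zero_smult[OF N closed[OF x]] f0 by (simp add: int)
  next
    case (step1 i)
    then show ?case using x by (simp add: s1 s2 add)
  next
    case (step2 i)
    have "f ((i - 1) \<odot>\<^bsub>M\<^esub> x) \<oplus>\<^bsub>N\<^esub> f x = (i - 1) \<odot>\<^bsub>N\<^esub> f x \<oplus>\<^bsub>N\<^esub> f x"
      using step2 x s1[OF x, of "i - 1"] s2[OF closed[OF x], of "i - 1"] by (simp flip: add)
    then have "f x \<oplus>\<^bsub>N\<^esub> f ((i - 1) \<odot>\<^bsub>M\<^esub> x) = f x \<oplus>\<^bsub>N\<^esub> (i - 1) \<odot>\<^bsub>N\<^esub> f x"
      using lmod_comm[OF N] x by simp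
    then show ?case using lmod_cancel[OF N] x by simp
  qed
  then show ?thesis using closed add by (simp add: linear_map_def)
qed

text \<open>Baer's argument for the integers: a maximal partial extension, viewed as a single-valued
  graph, is total.\<close>

lemma divisible_extension:
  fixes A :: "(int, 'a) module" and B :: "(int, 'b) module" and D :: "(int, 'd) module"
  assumes A: "left_module int_ring A" and B: "left_module int_ring B" and D: "left_module int_ring D"
    and div: "\<And>d n. \<lbrakk>d \<in> carrier D; n > 0\<rbrakk> \<Longrightarrow> \<exists>e \<in> carrier D. n \<odot>\<^bsub>D\<^esub> e = d"
    and i: "linear_map int_ring A B i" "inj_on i (carrier A)" and f: "linear_map int_ring A D f"
  obtains g where "linear_map int_ring B D g" "\<And>x. x \<in> carrier A \<Longrightarrow> g (i x) = f x"
proof -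
  have int: "k \<in> carrier int_ring" "\<zero>\<^bsub>int_ring\<^esub> = 0" "\<one>\<^bsub>int_ring\<^esub> = 1" "k \<oplus>\<^bsub>int_ring\<^esub> l = k + l"
    "k \<otimes>\<^bsub>int_ring\<^esub> l = k * l" for k l
    by (simp_all add: int_ring_def)
  note [simp] = lmod_zero[OF A] lmod_zero[OF B] lmod_zero[OF D] lmod_add[OF A] lmod_add[OF B] lmod_add[OF D]
    lmod_smult[OF A int(1)] lmod_smult[OF B int(1)] lmod_smult[OF D int(1)]
    lmod_add_0[OF B] lmod_add_0[OF D] lmod_0_add[OF B] lmod_0_add[OF D]
    lmod_smult_0[OF B int(1)] lmod_smult_0[OF D int(1)]
  have Bsm: "(k * l) \<odot>\<^bsub>B\<^esub> x = k \<odot>\<^bsub>B\<^esub> (l \<odot>\<^bsub>B\<^esub> x)" "(k + l) \<odot>\<^bsub>B\<^esub> x = k \<odot>\<^bsub>B\<^esub> x \<oplus>\<^bsub>B\<^esub> l \<odot>\<^bsub>B\<^esub> x"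
    "1 \<odot>\<^bsub>B\<^esub> x = x" "0 \<odot>\<^bsub>B\<^esub> x = \<zero>\<^bsub>B\<^esub>" if "x \<in> carrier B" for k l x
    using left_module_smult_assoc[OF B int(1) int(1) that] left_module_l_distr[OF B int(1) int(1) that]
      left_module_smult_one[OF B that] left_module_zero_smult[OF B that] by (simp_all add: int)
  have Dsm: "(k * l) \<odot>\<^bsub>D\<^esub> x = k \<odot>\<^bsub>D\<^esub> (l \<odot>\<^bsub>D\<^esub> x)" "(k + l) \<odot>\<^bsub>D\<^esub> x = k \<odot>\<^bsub>D\<^esub> x \<oplus>\<^bsub>D\<^esub> l \<odot>\<^bsub>D\<^esub> x"
    "1 \<odot>\<^bsub>D\<^esub> x = x" "0 \<odot>\<^bsub>D\<^esub> x = \<zero>\<^bsub>D\<^esub>" if "x \<in> carrier D" for k l x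
    using left_module_smult_assoc[OF D int(1) int(1) that] left_module_l_distr[OF D int(1) int(1) that]
      left_module_smult_one[OF D that] left_module_zero_smult[OF D that] by (simp_all add: int)
  \<comment> \<open>The graphs of homomorphisms from a submodule of \<open>B\<close> to
    \<open>D\<close> that extend \<open>f\<close>. For a submodule of the product, the last clause
    is single-valuedness.\<close>
  define sub where "sub G \<longleftrightarrow> G \<subseteq> carrier B \<times> carrier D \<and> (\<lambda>x. (i x, f x)) ` carrier A \<subseteq> G \<and>
     (\<forall>x y x' y'. (x, y) \<in> G \<longrightarrow> (x', y') \<in> G \<longrightarrow> (x \<oplus>\<^bsub>B\<^esub> x', y \<oplus>\<^bsub>D\<^esub> y') \<in> G) \<and>
     (\<forall>k x y. (x, y) \<in> G \<longrightarrow> (k \<odot>\<^bsub>B\<^esub> x, k \<odot>\<^bsub>D\<^esub> y) \<in> G) \<and>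
     (\<forall>y. (\<zero>\<^bsub>B\<^esub>, y) \<in> G \<longrightarrow> y = \<zero>\<^bsub>D\<^esub>)" for G
  have i0: "i \<zero>\<^bsub>A\<^esub> = \<zero>\<^bsub>B\<^esub>" "f \<zero>\<^bsub>A\<^esub> = \<zero>\<^bsub>D\<^esub>"
    using linear_map_zero[OF A B i(1)] linear_map_zero[OF A D f] by auto
  have G0: "sub ((\<lambda>x. (i x, f x)) ` carrier A)"
    unfolding sub_def
  proof (intro conjI allI impI)
    fix y assume "(\<zero>\<^bsub>B\<^esub>, y) \<in> (\<lambda>x. (i x, f x)) ` carrier A"
    then obtain x where x: "x \<in> carrier A" "i x = \<zero>\<^bsub>B\<^esub>" "y = f x" by auto
    then have "x = \<zero>\<^bsub>A\<^esub>" using inj_onD[OF i(2), of x "\<zero>\<^bsub>A\<^esub>"] i0 by simp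
    then show "y = \<zero>\<^bsub>D\<^esub>" using x i0 by simp
  next
    fix x y x' y' assume "(x, y) \<in> (\<lambda>x. (i x, f x)) ` carrier A" "(x', y') \<in> (\<lambda>x. (i x, f x)) ` carrier A"
    then obtain a a' where "a \<in> carrier A" "a' \<in> carrier A" "x = i a" "y = f a" "x' = i a'" "y' = f a'" by auto
    then show "(x \<oplus>\<^bsub>B\<^esub> x', y \<oplus>\<^bsub>D\<^esub> y') \<in> (\<lambda>x. (i x, f x)) ` carrier A"
      using linear_mapD(2)[OF i(1)] linear_mapD(2)[OF f] by (intro image_eqI[of _ _ "a \<oplus>\<^bsub>A\<^esub> a'"]) auto
  next
    fix k x y assume "(x, y) \<in> (\<lambda>x. (i x, f x)) ` carrier A"
    then obtain a where "a \<in> carrier A" "x = i a" "y = f a" by auto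
    then show "(k \<odot>\<^bsub>B\<^esub> x, k \<odot>\<^bsub>D\<^esub> y) \<in> (\<lambda>x. (i x, f x)) ` carrier A"
      using linear_mapD(3)[OF i(1) int(1)] linear_mapD(3)[OF f int(1)]
      by (intro image_eqI[of _ _ "k \<odot>\<^bsub>A\<^esub> a"]) auto
  qed (use linear_mapD(1)[OF i(1)] linear_mapD(1)[OF f] in auto)
  have "\<exists>G\<in>Collect sub. \<forall>H\<in>Collect sub. G \<subseteq> H \<longrightarrow> H = G"
  proof (rule subset_Zorn_nonempty)
    show "Collect sub \<noteq> {}" using G0 by blast
    fix \<C> assume C: "\<C> \<noteq> {}" "subset.chain (Collect sub) \<C>"
    have s: "sub G" if "G \<in> \<C>" for G using C(2) that by (auto simp: subset.chain_def)
    have ch: "G \<subseteq> H \<or> H \<subseteq> G" if "G \<in> \<C>" "H \<in> \<C>" for G H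
      using C(2) that by (auto simp: subset.chain_def)
    have "sub (\<Union>\<C>)"
      unfolding sub_def
    proof (intro conjI allI impI)
      fix x y x' y' assume "(x, y) \<in> \<Union>\<C>" "(x', y') \<in> \<Union>\<C>"
      then obtain G H where GH: "G \<in> \<C>" "H \<in> \<C>" "(x, y) \<in> G" "(x', y') \<in> H" by blast
      then obtain J where J: "J \<in> \<C>" "(x, y) \<in> J" "(x', y') \<in> J" using ch by blast
      then have "(x \<oplus>\<^bsub>B\<^esub> x', y \<oplus>\<^bsub>D\<^esub> y') \<in> J" using s[OF J(1)] unfolding sub_def by blast
      then show "(x \<oplus>\<^bsub>B\<^esub> x', y \<oplus>\<^bsub>D\<^esub> y') \<in> \<Union>\<C>" using J by blast
    next
      show "\<Union>\<C> \<subseteq> carrier B \<times> carrier D" using s unfolding sub_def by blast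
      show "(\<lambda>x. (i x, f x)) ` carrier A \<subseteq> \<Union>\<C>" using s C(1) unfolding sub_def by blast
    next
      fix k x y assume "(x, y) \<in> \<Union>\<C>"
      then show "(k \<odot>\<^bsub>B\<^esub> x, k \<odot>\<^bsub>D\<^esub> y) \<in> \<Union>\<C>" using s unfolding sub_def by blast
    next
      fix y assume "(\<zero>\<^bsub>B\<^esub>, y) \<in> \<Union>\<C>"
      then show "y = \<zero>\<^bsub>D\<^esub>" using s unfolding sub_def by blast
    qed
    then show "\<Union>\<C> \<in> Collect sub" by blast
  qed
  then obtain G where G: "sub G" "\<And>H. sub H \<Longrightarrow> G \<subseteq> H \<Longrightarrow> H = G" by blast
  have Gc: "x \<in> carrier B" "y \<in> carrier D" if "(x, y) \<in> G" for x y
    using that G(1) unfolding sub_def by blast+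
  have Ga: "(x \<oplus>\<^bsub>B\<^esub> x', y \<oplus>\<^bsub>D\<^esub> y') \<in> G" if "(x, y) \<in> G" "(x', y') \<in> G" for x y x' y'
    using that G(1) unfolding sub_def by blast
  have Gs: "(k \<odot>\<^bsub>B\<^esub> x, k \<odot>\<^bsub>D\<^esub> y) \<in> G" if "(x, y) \<in> G" for k x y
    using that G(1) unfolding sub_def by blast
  have G0': "y = \<zero>\<^bsub>D\<^esub>" if "(\<zero>\<^bsub>B\<^esub>, y) \<in> G" for y
    using that G(1) unfolding sub_def by blast
  have GA: "(i x, f x) \<in> G" if "x \<in> carrier A" for x
    using that G(1) unfolding sub_def by blast
  have G00: "(\<zero>\<^bsub>B\<^esub>, \<zero>\<^bsub>D\<^esub>) \<in> G" using GA[of "\<zero>\<^bsub>A\<^esub>"] i0 by simp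
  have sm1: "(- 1) \<odot>\<^bsub>D\<^esub> y \<oplus>\<^bsub>D\<^esub> y = \<zero>\<^bsub>D\<^esub>" if "y \<in> carrier D" for y
    using Dsm(2)[OF that, of "-1" 1] Dsm(3,4)[OF that] by simp
  have sm1B: "x \<oplus>\<^bsub>B\<^esub> (- 1) \<odot>\<^bsub>B\<^esub> x = \<zero>\<^bsub>B\<^esub>" if "x \<in> carrier B" for x
    using Bsm(2)[OF that, of 1 "-1"] Bsm(3,4)[OF that] by simp
  have Gu: "y = y'" if "(x, y) \<in> G" "(x, y') \<in> G" for x y y'
  proof -
    have "(x \<oplus>\<^bsub>B\<^esub> (- 1) \<odot>\<^bsub>B\<^esub> x, y \<oplus>\<^bsub>D\<^esub> (- 1) \<odot>\<^bsub>D\<^esub> y') \<in> G" by (rule Ga[OF that(1) Gs[OF that(2)]])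
    then have "y \<oplus>\<^bsub>D\<^esub> (- 1) \<odot>\<^bsub>D\<^esub> y' = \<zero>\<^bsub>D\<^esub>" using G0' Gc[OF that(2)] by (simp add: sm1B)
    then have "y \<oplus>\<^bsub>D\<^esub> (- 1) \<odot>\<^bsub>D\<^esub> y' \<oplus>\<^bsub>D\<^esub> y' = y'" using Gc[OF that(2)] by simp
    then show ?thesis using Gc[OF that(1)] Gc[OF that(2)] by (simp add: lmod_assoc[OF D] sm1)
  qed
  have total: "\<exists>y. (b, y) \<in> G" if b: "b \<in> carrier B" for b
  proof -
    \<comment> \<open>A value for \<open>b\<close> is admissible when it agrees with the graph on
      every multiple of \<open>b\<close> that already lies in the domain. If no positive multiple
      does, then \<open>k = 0\<close> is the only case and zero is admissible.\<close>
    have "\<exists>d\<in>carrier D. \<forall>k y. (k \<odot>\<^bsub>B\<^esub> b, y) \<in> G \<longrightarrow> y = k \<odot>\<^bsub>D\<^esub> d"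
    proof (cases "\<exists>k>0. \<exists>y. (k \<odot>\<^bsub>B\<^esub> b, y) \<in> G")
      case True
      \<comment> \<open>The generator of the ideal of integers \<open>k\<close> for which
        \<open>k\<close> times \<open>b\<close> is in the domain; divisibility provides
        \<open>d\<close> whose n-th multiple is the value there. Every other such \<open>k\<close>
        is a multiple of \<open>n\<close>, as its remainder would contradict minimality.\<close>
      define n where "n = (LEAST n. n > 0 \<and> (\<exists>y. (int n \<odot>\<^bsub>B\<^esub> b, y) \<in> G))"
      from True have "\<exists>n. n > 0 \<and> (\<exists>y. (int n \<odot>\<^bsub>B\<^esub> b, y) \<in> G)"
        by (metis pos_int_cases)
      from LeastI_ex[OF this] obtain y where n: "n > 0" "(int n \<odot>\<^bsub>B\<^esub> b, y) \<in> G" by (auto simp: n_def)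
      obtain d where d: "d \<in> carrier D" "int n \<odot>\<^bsub>D\<^esub> d = y" using div[OF Gc(2)[OF n(2)], of "int n"] n by auto
      have "y' = k \<odot>\<^bsub>D\<^esub> d" if k: "(k \<odot>\<^bsub>B\<^esub> b, y') \<in> G" for k y'
      proof -
        have "((- (k div int n)) \<odot>\<^bsub>B\<^esub> (int n \<odot>\<^bsub>B\<^esub> b) \<oplus>\<^bsub>B\<^esub> k \<odot>\<^bsub>B\<^esub> b,
            (- (k div int n)) \<odot>\<^bsub>D\<^esub> y \<oplus>\<^bsub>D\<^esub> y') \<in> G" by (rule Ga[OF Gs[OF n(2)] k])
        moreover have "(- (k div int n)) \<odot>\<^bsub>B\<^esub> (int n \<odot>\<^bsub>B\<^esub> b) \<oplus>\<^bsub>B\<^esub> k \<odot>\<^bsub>B\<^esub> b = (k mod int n) \<odot>\<^bsub>B\<^esub> b"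
          by (simp only: Bsm(1,2)[OF b, symmetric]) (simp add: minus_div_mult_eq_mod[symmetric])
        ultimately have "\<exists>y. (int (nat (k mod int n)) \<odot>\<^bsub>B\<^esub> b, y) \<in> G" using n by auto
        moreover have "nat (k mod int n) < n" using n by (simp add: nat_less_iff)
        ultimately have "nat (k mod int n) = 0"
          using not_less_Least[of "nat (k mod int n)" "\<lambda>n. n > 0 \<and> (\<exists>y. (int n \<odot>\<^bsub>B\<^esub> b, y) \<in> G)"]
          unfolding n_def[symmetric] by (metis gr_zeroI)
        moreover have "k mod int n \<ge> 0" using n by simp
        ultimately have "k = (k div int n) * int n"
          by (metis add.right_neutral div_mult_mod_eq nat_eq_iff of_nat_0 order_antisym_conv nat_le_0)
        then obtain m where m: "k = m * int n" by blast
        have "(m \<odot>\<^bsub>B\<^esub> (int n \<odot>\<^bsub>B\<^esub> b), m \<odot>\<^bsub>D\<^esub> y) \<in> G" by (rule Gs[OF n(2)])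
        then have "(k \<odot>\<^bsub>B\<^esub> b, k \<odot>\<^bsub>D\<^esub> d) \<in> G" by (simp only: m Bsm(1)[OF b] Dsm(1)[OF d(1)] d(2))
        then show ?thesis using Gu k by blast
      qed
      then show ?thesis using d by blast
    next
      case False
      have k0: "k = 0" if k: "(k \<odot>\<^bsub>B\<^esub> b, y) \<in> G" for k y
      proof (rule ccontr)
        assume "k \<noteq> 0"
        then have "k < 0" using False k by (metis linorder_neqE_linordered_idom)
        moreover have "((- 1) * k) \<odot>\<^bsub>B\<^esub> b = (- 1) \<odot>\<^bsub>B\<^esub> (k \<odot>\<^bsub>B\<^esub> b)" by (rule Bsm(1)[OF b])
        then have "((- k) \<odot>\<^bsub>B\<^esub> b, (- 1) \<odot>\<^bsub>D\<^esub> y) \<in> G" using Gs[OF k, of "- 1"] by simp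
        ultimately show False using False by (metis neg_0_less_iff_less)
      qed
      have zz: "y = k \<odot>\<^bsub>D\<^esub> \<zero>\<^bsub>D\<^esub>" if k: "(k \<odot>\<^bsub>B\<^esub> b, y) \<in> G" for k y
      proof -
        have "(\<zero>\<^bsub>B\<^esub>, y) \<in> G" using k k0[OF k] Bsm(4)[OF b] by simp
        then have "y = \<zero>\<^bsub>D\<^esub>" by (rule G0')
        then show ?thesis by simp
      qed
      show ?thesis by (rule bexI[of _ "\<zero>\<^bsub>D\<^esub>"]) (use zz in blast, simp)
    qed
    then obtain d where d: "d \<in> carrier D" "\<And>k y. (k \<odot>\<^bsub>B\<^esub> b, y) \<in> G \<Longrightarrow> y = k \<odot>\<^bsub>D\<^esub> d" by blast
    \<comment> \<open>The graph enlarged by sending \<open>b\<close> to \<open>d\<close>; maximality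
      of \<open>G\<close> will force \<open>H = G\<close>, so that \<open>b\<close> was in the
      domain all along.\<close>
    define H where "H = {(x \<oplus>\<^bsub>B\<^esub> k \<odot>\<^bsub>B\<^esub> b, y \<oplus>\<^bsub>D\<^esub> k \<odot>\<^bsub>D\<^esub> d) |k x y. (x, y) \<in> G}"
    have HI: "(x \<oplus>\<^bsub>B\<^esub> k \<odot>\<^bsub>B\<^esub> b, y \<oplus>\<^bsub>D\<^esub> k \<odot>\<^bsub>D\<^esub> d) \<in> H" if "(x, y) \<in> G" for k x y
      using that unfolding H_def by blast
    have GH: "G \<subseteq> H"
    proof clarify
      fix x y assume "(x, y) \<in> G"
      then show "(x, y) \<in> H" using HI[of x y 0] Gc b d by (simp add: Bsm Dsm)
    qed
    have "sub H"
      unfolding sub_def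
    proof (intro conjI allI impI)
      show "H \<subseteq> carrier B \<times> carrier D" using Gc b d by (auto simp: H_def)
      show "(\<lambda>x. (i x, f x)) ` carrier A \<subseteq> H" using GA GH by blast
    next
      fix x y x' y' assume "(x, y) \<in> H" "(x', y') \<in> H"
      then obtain k l u v u' v' where *: "(u, v) \<in> G" "(u', v') \<in> G" "x = u \<oplus>\<^bsub>B\<^esub> k \<odot>\<^bsub>B\<^esub> b" "y = v \<oplus>\<^bsub>D\<^esub> k \<odot>\<^bsub>D\<^esub> d"
         "x' = u' \<oplus>\<^bsub>B\<^esub> l \<odot>\<^bsub>B\<^esub> b" "y' = v' \<oplus>\<^bsub>D\<^esub> l \<odot>\<^bsub>D\<^esub> d" unfolding H_def by blast
      have "x \<oplus>\<^bsub>B\<^esub> x' = (u \<oplus>\<^bsub>B\<^esub> u') \<oplus>\<^bsub>B\<^esub> (k + l) \<odot>\<^bsub>B\<^esub> b" "y \<oplus>\<^bsub>D\<^esub> y' = (v \<oplus>\<^bsub>D\<^esub> v') \<oplus>\<^bsub>D\<^esub> (k + l) \<odot>\<^bsub>D\<^esub> d"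
        using Gc[OF *(1)] Gc[OF *(2)] b d(1)
        by (simp_all add: * Bsm(2) Dsm(2) lmod_assoc[OF B] lmod_assoc[OF D] lmod_lcomm[OF B, of "k \<odot>\<^bsub>B\<^esub> b"]
          lmod_lcomm[OF D, of "k \<odot>\<^bsub>D\<^esub> d"])
      then show "(x \<oplus>\<^bsub>B\<^esub> x', y \<oplus>\<^bsub>D\<^esub> y') \<in> H" using HI[OF Ga[OF *(1,2)]] by simp
    next
      fix k x y assume "(x, y) \<in> H"
      then obtain l u v where *: "(u, v) \<in> G" "x = u \<oplus>\<^bsub>B\<^esub> l \<odot>\<^bsub>B\<^esub> b" "y = v \<oplus>\<^bsub>D\<^esub> l \<odot>\<^bsub>D\<^esub> d" unfolding H_def by blast
      then have "k \<odot>\<^bsub>B\<^esub> x = k \<odot>\<^bsub>B\<^esub> u \<oplus>\<^bsub>B\<^esub> (k * l) \<odot>\<^bsub>B\<^esub> b" "k \<odot>\<^bsub>D\<^esub> y = k \<odot>\<^bsub>D\<^esub> v \<oplus>\<^bsub>D\<^esub> (k * l) \<odot>\<^bsub>D\<^esub> d"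
        using Gc[OF *(1)] b d(1)
        by (simp_all add: Bsm(1) Dsm(1) lmod_smult_add[OF B int(1)] lmod_smult_add[OF D int(1)])
      then show "(k \<odot>\<^bsub>B\<^esub> x, k \<odot>\<^bsub>D\<^esub> y) \<in> H" using HI[OF Gs[OF *(1)]] by simp
    next
      \<comment> \<open>If the first component is zero, then a multiple of \<open>b\<close> equals
        minus an element of the old domain, and the admissibility of \<open>d\<close> makes the
        second component zero.\<close>
      fix y assume "(\<zero>\<^bsub>B\<^esub>, y) \<in> H"
      then obtain l u v where *: "(u, v) \<in> G" "\<zero>\<^bsub>B\<^esub> = u \<oplus>\<^bsub>B\<^esub> l \<odot>\<^bsub>B\<^esub> b" "y = v \<oplus>\<^bsub>D\<^esub> l \<odot>\<^bsub>D\<^esub> d" unfolding H_def by blast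
      have uB: "u \<in> carrier B" "v \<in> carrier D" using Gc *(1) by auto
      have "(- 1) \<odot>\<^bsub>B\<^esub> u = l \<odot>\<^bsub>B\<^esub> b"
      proof -
        have "u \<oplus>\<^bsub>B\<^esub> (- 1) \<odot>\<^bsub>B\<^esub> u = u \<oplus>\<^bsub>B\<^esub> l \<odot>\<^bsub>B\<^esub> b" using *(2) sm1B[OF uB(1)] by simp
        then show ?thesis using lmod_cancel[OF B] uB b by simp
      qed
      then have "(l \<odot>\<^bsub>B\<^esub> b, (- 1) \<odot>\<^bsub>D\<^esub> v) \<in> G" using Gs[OF *(1), of "- 1"] by simp
      then have "(- 1) \<odot>\<^bsub>D\<^esub> v = l \<odot>\<^bsub>D\<^esub> d" by (rule d(2))
      then show "y = \<zero>\<^bsub>D\<^esub>" using *(3) sm1[OF uB(2)] uB d(1) lmod_comm[OF D, of v "(- 1) \<odot>\<^bsub>D\<^esub> v"] by simp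
    qed
    then have "H = G" using G(2) GH by blast
    moreover have "(b, d) \<in> H" using HI[OF G00, of 1] b d by (simp add: Bsm Dsm)
    ultimately show ?thesis by blast
  qed
  then obtain g where g: "\<And>b. b \<in> carrier B \<Longrightarrow> (b, g b) \<in> G" by metis
  have "linear_map int_ring B D g"
    unfolding linear_map_def
  proof (intro conjI ballI)
    show "g x \<in> carrier D" if "x \<in> carrier B" for x by (rule Gc(2)[OF g[OF that]])
  qed (rule Gu[OF g], simp_all add: g Ga Gs)+
  moreover have "g (i x) = f x" if "x \<in> carrier A" for x
    using Gu[OF g GA[OF that]] linear_mapD(1)[OF i(1) that] by simp
  ultimately show thesis by (rule that)
qed

section \<open>Enough injectives\<close>

definition int_module :: "('r, 'a) module \<Rightarrow> (int, 'a) module" where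
  "int_module M = \<lparr>carrier = carrier M, mult = undefined, one = undefined, zero = \<zero>\<^bsub>M\<^esub>,
     add = add M, smult = (\<lambda>k x. add_pow M k x)\<rparr>"

lemma left_module_int_module:
  assumes "abelian_group M"
  shows "left_module int_ring (int_module M)"
proof -
  interpret M: abelian_group M by fact
  have ab: "abelian_group (int_module M)"
  proof (rule abelian_groupI)
    fix x assume "x \<in> carrier (int_module M)"
    then show "\<exists>y\<in>carrier (int_module M). y \<oplus>\<^bsub>int_module M\<^esub> x = \<zero>\<^bsub>int_module M\<^esub>"
      by (intro bexI[of _ "\<ominus>\<^bsub>M\<^esub> x"]) (simp_all add: int_module_def M.l_neg)
  qed (simp_all add: int_module_def M.a_ac)
  show ?thesis
  proof (rule left_moduleI[OF ring_int_ring ab])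
    fix a b :: int and x assume "x \<in> carrier (int_module M)"
    then have x: "x \<in> carrier M" by (simp add: int_module_def)
    show "(a \<oplus>\<^bsub>int_ring\<^esub> b) \<odot>\<^bsub>int_module M\<^esub> x = a \<odot>\<^bsub>int_module M\<^esub> x \<oplus>\<^bsub>int_module M\<^esub> b \<odot>\<^bsub>int_module M\<^esub> x"
      using M.add.int_pow_mult[OF x] by (simp add: int_module_def int_ring_def)
    show "(a \<otimes>\<^bsub>int_ring\<^esub> b) \<odot>\<^bsub>int_module M\<^esub> x = a \<odot>\<^bsub>int_module M\<^esub> (b \<odot>\<^bsub>int_module M\<^esub> x)"
      using M.add.int_pow_pow[OF x, of a b] by (simp add: int_module_def int_ring_def mult.commute)
  next
    fix a :: int and x y assume "x \<in> carrier (int_module M)" "y \<in> carrier (int_module M)"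
    then show "a \<odot>\<^bsub>int_module M\<^esub> (x \<oplus>\<^bsub>int_module M\<^esub> y) = a \<odot>\<^bsub>int_module M\<^esub> x \<oplus>\<^bsub>int_module M\<^esub> a \<odot>\<^bsub>int_module M\<^esub> y"
      using M.add.int_pow_distrib[of x y a] by (simp add: int_module_def)
  next
    fix x assume "x \<in> carrier (int_module M)"
    then show "\<one>\<^bsub>int_ring\<^esub> \<odot>\<^bsub>int_module M\<^esub> x = x"
      using M.add.int_pow_1[of x] by (simp add: int_module_def int_ring_def)
  qed (simp add: int_module_def)
qed

definition rat_module :: "(int, rat) module" where
  "rat_module = \<lparr>carrier = UNIV, mult = undefined, one = undefined, zero = 0,
     add = (+), smult = (\<lambda>k x. of_int k * x)\<rparr>"

lemma left_module_rat_module: "left_module int_ring rat_module"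
proof (rule left_moduleI[OF ring_int_ring])
  show "abelian_group rat_module"
  proof (rule abelian_groupI)
    fix x assume "x \<in> carrier rat_module"
    show "\<exists>y\<in>carrier rat_module. y \<oplus>\<^bsub>rat_module\<^esub> x = \<zero>\<^bsub>rat_module\<^esub>"
      by (rule bexI[of _ "- x"]) (simp_all add: rat_module_def)
  qed (simp_all add: rat_module_def)
qed (simp_all add: rat_module_def int_ring_def algebra_simps)

text \<open>The divisible module is \<open>\<rat>\<^sup>(\<^sup>X\<^sup>) / ker(\<int>\<^sup>(\<^sup>X\<^sup>) \<rightarrow> X)\<close>.\<close>

lemma divisible_embedding:
  fixes X :: "(int, 'a) module"
  assumes X: "left_module int_ring X"
  obtains D :: "(int, 'a \<Rightarrow> rat) module" and i where "left_module int_ring D"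
    "carrier D \<subseteq> carrier (finsupp (carrier X - {\<zero>\<^bsub>X\<^esub>}) rat_module)"
    "\<And>d n. \<lbrakk>d \<in> carrier D; n > 0\<rbrakk> \<Longrightarrow> \<exists>e \<in> carrier D. n \<odot>\<^bsub>D\<^esub> e = d"
    "linear_map int_ring X D i" "inj_on i (carrier X)"
proof -
  define B where "B = carrier X - {\<zero>\<^bsub>X\<^esub>}"
  let ?V = "finsupp B rat_module" and ?F = "finsupp B (regular int_ring)"
  have V: "left_module int_ring ?V" by (rule left_module_finsupp[OF left_module_rat_module])
  have F: "left_module int_ring ?F" by (rule left_module_finsupp[OF left_module_regular[OF ring_int_ring]])
  have V_ops: "carrier ?V = {c. (\<forall>x. x \<notin> B \<longrightarrow> c x = 0) \<and> finite {x. c x \<noteq> 0}}"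
    "zero ?V = (\<lambda>_. 0)" "add ?V = (\<lambda>c c' x. c x + c' x)" "smult ?V = (\<lambda>k c x. of_int k * c x)"
    by (auto simp: finsupp_def rat_module_def)
  have F_ops: "carrier ?F = {c. (\<forall>x. x \<notin> B \<longrightarrow> c x = 0) \<and> finite {x. c x \<noteq> 0}}"
    "zero ?F = (\<lambda>_. 0)" "add ?F = (\<lambda>c c' x. c x + c' x)" "smult ?F = (\<lambda>k c x. k * c x)"
    by (auto simp: finsupp_def regular_def int_ring_def)
  define \<phi> :: "('a \<Rightarrow> int) \<Rightarrow> 'a \<Rightarrow> rat" where "\<phi> c = (\<lambda>x. of_int (c x))" for c
  have \<phi>: "linear_map int_ring ?F ?V \<phi>" by (auto simp: linear_map_def F_ops V_ops \<phi>_def)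
  have \<phi>_inj: "\<phi> c = \<phi> c' \<longleftrightarrow> c = c'" for c c' by (auto simp: \<phi>_def fun_eq_iff)
  define t where "t x = (if x \<in> carrier X then x else \<zero>\<^bsub>X\<^esub>)" for x
  have t: "t x \<in> carrier X" for x using lmod_zero[OF X] by (simp add: t_def)
  define l where "l = lincomb int_ring X t"
  have l: "linear_map int_ring ?F X l" unfolding l_def by (rule linear_map_lincomb[OF ring_int_ring X t])
  define S where "S = \<phi> ` {c \<in> carrier ?F. l c = \<zero>\<^bsub>X\<^esub>}"
  have mem: "\<phi> c \<in> S \<longleftrightarrow> l c = \<zero>\<^bsub>X\<^esub>" if "c \<in> carrier ?F" for c
    using that by (auto simp: S_def \<phi>_inj)
  obtain D :: "(int, 'a \<Rightarrow> rat) module" and q where D: "left_module int_ring D" "linear_map int_ring ?V D q"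
    "carrier D = q ` carrier ?V" "carrier D \<subseteq> carrier ?V"
    "\<And>x. x \<in> carrier ?V \<Longrightarrow> q x = \<zero>\<^bsub>D\<^esub> \<longleftrightarrow> x \<in> S"
  proof (rule quotient_module[OF V, of S])
    show "S \<subseteq> carrier ?V" using linear_mapD(1)[OF \<phi>] by (auto simp: S_def)
    show "\<zero>\<^bsub>?V\<^esub> \<in> S"
      using mem[OF lmod_zero[OF F]] linear_map_zero[OF F X l] linear_map_zero[OF F V \<phi>] by simp
    show "x \<oplus>\<^bsub>?V\<^esub> y \<in> S" if xy: "x \<in> S" "y \<in> S" for x y
    proof -
      obtain c c' where c: "c \<in> carrier ?F" "l c = \<zero>\<^bsub>X\<^esub>" "x = \<phi> c" "c' \<in> carrier ?F" "l c' = \<zero>\<^bsub>X\<^esub>" "y = \<phi> c'"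
        using xy by (auto simp: S_def)
      then show ?thesis
        using mem[OF lmod_add[OF F c(1,4)]] linear_mapD(2)[OF l c(1,4)] linear_mapD(2)[OF \<phi> c(1,4)]
          lmod_add_0[OF X lmod_zero[OF X]] by simp
    qed
    show "x \<ominus>\<^bsub>?V\<^esub> y \<in> S" if xy: "x \<in> S" "y \<in> S" for x y
    proof -
      obtain c c' where c: "c \<in> carrier ?F" "l c = \<zero>\<^bsub>X\<^esub>" "x = \<phi> c" "c' \<in> carrier ?F" "l c' = \<zero>\<^bsub>X\<^esub>" "y = \<phi> c'"
        using xy by (auto simp: S_def)
      then show ?thesis
        using mem[OF lmod_minus[OF F c(1,4)]] linear_map_minus[OF F X l c(1,4)] linear_map_minus[OF F V \<phi> c(1,4)]
          lmod_minus_0[OF X lmod_zero[OF X]] by simp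
    qed
    show "k \<odot>\<^bsub>?V\<^esub> x \<in> S" if k: "k \<in> carrier int_ring" and x: "x \<in> S" for k x
    proof -
      obtain c where c: "c \<in> carrier ?F" "l c = \<zero>\<^bsub>X\<^esub>" "x = \<phi> c"
        using x by (auto simp: S_def)
      then show ?thesis
        using mem[OF lmod_smult[OF F k c(1)]] linear_mapD(3)[OF l k c(1)] linear_mapD(3)[OF \<phi> k c(1)]
          lmod_smult_0[OF X k] by simp
    qed
  qed (rule that)
  have int: "k \<in> carrier int_ring" for k by (simp add: int_ring_def)
  have div: "\<exists>e \<in> carrier D. n \<odot>\<^bsub>D\<^esub> e = d" if dn: "d \<in> carrier D" "n > 0" for d n
  proof -
    obtain v where v: "v \<in> carrier ?V" "d = q v" using dn(1) D(3) by blast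
    define w where "w x = v x / of_int n" for x
    have w: "w \<in> carrier ?V" "n \<odot>\<^bsub>?V\<^esub> w = v" using v(1) dn(2) by (auto simp: V_ops w_def)
    have "n \<odot>\<^bsub>D\<^esub> q w = d" using linear_mapD(3)[OF D(2) int w(1), of n] w(2) v(2) by simp
    then show ?thesis using D(3) w(1) by blast
  qed
  \<comment> \<open>A section of \<open>l\<close>. Zero is treated separately because it was left
    out of the set \<open>B\<close> of generators.\<close>
  define \<delta> where "\<delta> x = (if x = \<zero>\<^bsub>X\<^esub> then \<zero>\<^bsub>?F\<^esub> else finsupp_unit int_ring x)" for x
  have \<delta>: "\<delta> x \<in> carrier ?F" "l (\<delta> x) = x" if x: "x \<in> carrier X" for x
  proof -
    show "\<delta> x \<in> carrier ?F"
      using lmod_zero[OF F] finsupp_unit_closed[OF ring_int_ring, of x B] x by (auto simp: \<delta>_def B_def)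
    show "l (\<delta> x) = x"
      using linear_map_zero[OF F X l] lincomb_unit[where t = t, OF ring_int_ring X t, of x B] x
      by (auto simp: \<delta>_def B_def l_def t_def)
  qed
  \<comment> \<open>On the integral part, \<open>q\<close> identifies exactly what \<open>l\<close>
    identifies. Hence \<open>q (\<phi> (\<delta> x))\<close> is additive and injective in
    \<open>x\<close>, although the section \<delta> itself is not additive.\<close>
  have q_eq: "q (\<phi> c) = q (\<phi> c') \<longleftrightarrow> l c = l c'" if c: "c \<in> carrier ?F" "c' \<in> carrier ?F" for c c'
  proof -
    note \<phi>c = linear_mapD(1)[OF \<phi> c(1)] linear_mapD(1)[OF \<phi> c(2)]
    have "q (\<phi> c) = q (\<phi> c') \<longleftrightarrow> q (\<phi> c) \<ominus>\<^bsub>D\<^esub> q (\<phi> c') = \<zero>\<^bsub>D\<^esub>"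
      by (rule lmod_minus_eq_0[OF D(1), symmetric]) (use linear_mapD(1)[OF D(2)] \<phi>c in auto)
    also have "\<dots> \<longleftrightarrow> q (\<phi> (c \<ominus>\<^bsub>?F\<^esub> c')) = \<zero>\<^bsub>D\<^esub>"
      by (simp add: linear_map_minus[OF F V \<phi> c] linear_map_minus[OF V D(1,2) \<phi>c])
    also have "\<dots> \<longleftrightarrow> l c \<ominus>\<^bsub>X\<^esub> l c' = \<zero>\<^bsub>X\<^esub>"
      using D(5)[OF linear_mapD(1)[OF \<phi> lmod_minus[OF F c]]] mem[OF lmod_minus[OF F c]]
      by (simp add: linear_map_minus[OF F X l c])
    also have "\<dots> \<longleftrightarrow> l c = l c'"
      by (rule lmod_minus_eq_0[OF X linear_mapD(1)[OF l c(1)] linear_mapD(1)[OF l c(2)]])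
    finally show ?thesis .
  qed
  define i where "i x = q (\<phi> (\<delta> x))" for x
  have "linear_map int_ring X D i"
  proof (rule additive_int_linear[OF X D(1)])
    show "i x \<in> carrier D" if "x \<in> carrier X" for x
      unfolding i_def using linear_mapD(1)[OF D(2)] linear_mapD(1)[OF \<phi>] \<delta>(1)[OF that] by blast
    fix x y assume xy: "x \<in> carrier X" "y \<in> carrier X"
    note d = \<delta>(1)[OF xy(1)] \<delta>(1)[OF xy(2)]
    have "i (x \<oplus>\<^bsub>X\<^esub> y) = q (\<phi> (\<delta> x \<oplus>\<^bsub>?F\<^esub> \<delta> y))"
      unfolding i_def
      by (subst q_eq) (use \<delta> xy lmod_add[OF X xy] lmod_add[OF F d] linear_mapD(2)[OF l d] in auto)
    also have "\<dots> = i x \<oplus>\<^bsub>D\<^esub> i y"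
      unfolding i_def
      by (simp add: linear_mapD(2)[OF \<phi> d] linear_mapD(2)[OF D(2) linear_mapD(1)[OF \<phi> d(1)] linear_mapD(1)[OF \<phi> d(2)]])
    finally show "i (x \<oplus>\<^bsub>X\<^esub> y) = i x \<oplus>\<^bsub>D\<^esub> i y" .
  qed
  moreover have "inj_on i (carrier X)"
    by (rule inj_onI) (use \<delta> q_eq in \<open>auto simp: i_def\<close>)
  moreover have "carrier D \<subseteq> carrier (finsupp (carrier X - {\<zero>\<^bsub>X\<^esub>}) rat_module)"
    using D(4) by (simp add: B_def)
  ultimately show thesis using div D(1) by (intro that) auto
qed

context module_category
begin

text \<open>The injective module is the coinduced module of additive maps from \<open>R\<close> to
  \<open>D\<close>, where \<open>D\<close> is a divisible group containing the additive group of
  \<open>X\<close>. By adjunction, R-linear maps into it are additive maps into \<open>D\<close>,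
  and these extend along injections because \<open>D\<close> is divisible.\<close>

lemma enough_injectives:
  assumes X: "X \<in> Mods"
  obtains E i where "E \<in> Inj R U" "i \<in> Hom R X E" "inj_on i (carrier X)"
proof -
  interpret R: ring R by (rule ring)
  note LX = Mod_left_module[OF X]
  have ZM: "left_module int_ring (int_module M)" if "M \<in> Mods" for M :: "('r, 'm) module"
    by (rule left_module_int_module[OF Mod_group[OF that]])
  obtain D :: "(int, 'm \<Rightarrow> rat) module" and u where D: "left_module int_ring D"
    "carrier D \<subseteq> carrier (finsupp (carrier (int_module X) - {\<zero>\<^bsub>int_module X\<^esub>}) rat_module)"
    "\<And>d n. \<lbrakk>d \<in> carrier D; n > 0\<rbrakk> \<Longrightarrow> \<exists>e \<in> carrier D. n \<odot>\<^bsub>D\<^esub> e = d"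
    and u: "linear_map int_ring (int_module X) D u" "inj_on u (carrier (int_module X))"
    by (rule divisible_embedding[OF ZM[OF X]]) (rule that)
  have uX: "u x \<in> carrier D" "u (x \<oplus>\<^bsub>X\<^esub> y) = u x \<oplus>\<^bsub>D\<^esub> u y" if "x \<in> carrier X" "y \<in> carrier X" for x y
    using u(1) that by (auto simp: linear_map_def int_module_def)
  \<comment> \<open>The rationals are countable, so pairs (value, position) are coded by naturals,
    with zero of \<open>R\<close> as a dummy first index.\<close>
  have le: "carrier rat_module \<times> (UNIV :: nat set) \<lesssim> carrier R \<times> (UNIV :: nat set)"
  proof -
    have "inj_on (\<lambda>p :: rat \<times> nat. (\<zero>\<^bsub>R\<^esub>, to_nat p)) (carrier rat_module \<times> UNIV)"
      by (rule inj_onI) simp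
    then show ?thesis unfolding lepoll_def by (intro exI conjI) auto
  qed
  obtain C0 where C0: "C0 \<in> U" "carrier (finsupp (carrier X - {\<zero>\<^bsub>X\<^esub>}) rat_module) \<lesssim> C0"
    by (rule finsupp_universe[OF left_module_rat_module le, of "carrier X" "carrier X - {\<zero>\<^bsub>X\<^esub>}" "\<zero>\<^bsub>X\<^esub>"])
      (use X Mod_carrier in auto)
  have "carrier D \<lesssim> C0"
    using lepoll_trans[OF subset_imp_lepoll[OF D(2)]] C0(2) by (simp add: int_module_def)
  then obtain C where C: "C \<in> U" "(\<Pi>\<^sub>E i \<in> carrier R. carrier D) \<lesssim> C"
    by (rule universe_power_carrier[OF C0(1)])
  \<comment> \<open>Left scalars act by multiplying the argument on the right, which is what turns
    the additive maps on \<open>R\<close> into a left module.\<close>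
  define H :: "('r, 'r \<Rightarrow> 'm \<Rightarrow> rat) module" where
    "H = \<lparr>carrier = {\<phi> \<in> carrier R \<rightarrow>\<^sub>E carrier D. \<forall>r\<in>carrier R. \<forall>s\<in>carrier R. \<phi> (r \<oplus>\<^bsub>R\<^esub> s) = \<phi> r \<oplus>\<^bsub>D\<^esub> \<phi> s},
      mult = undefined, one = undefined, zero = (\<lambda>r\<in>carrier R. \<zero>\<^bsub>D\<^esub>),
      add = (\<lambda>\<phi> \<psi>. \<lambda>r\<in>carrier R. \<phi> r \<oplus>\<^bsub>D\<^esub> \<psi> r), smult = (\<lambda>a \<phi>. \<lambda>r\<in>carrier R. \<phi> (r \<otimes>\<^bsub>R\<^esub> a))\<rparr>"
  have Hops: "zero H = (\<lambda>r\<in>carrier R. \<zero>\<^bsub>D\<^esub>)" "add H = (\<lambda>\<phi> \<psi>. \<lambda>r\<in>carrier R. \<phi> r \<oplus>\<^bsub>D\<^esub> \<psi> r)"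
    "smult H = (\<lambda>a \<phi>. \<lambda>r\<in>carrier R. \<phi> (r \<otimes>\<^bsub>R\<^esub> a))" by (simp_all add: H_def)
  have Hcl: "\<phi> r \<in> carrier D" if "\<phi> \<in> carrier H" "r \<in> carrier R" for \<phi> r
    using that by (auto simp: H_def)
  have Hadd: "\<phi> (r \<oplus>\<^bsub>R\<^esub> s) = \<phi> r \<oplus>\<^bsub>D\<^esub> \<phi> s" if "\<phi> \<in> carrier H" "r \<in> carrier R" "s \<in> carrier R" for \<phi> r s
    using that by (auto simp: H_def)
  have HI: "restrict f (carrier R) \<in> carrier H"
    if "\<And>r. r \<in> carrier R \<Longrightarrow> f r \<in> carrier D"
      "\<And>r s. \<lbrakk>r \<in> carrier R; s \<in> carrier R\<rbrakk> \<Longrightarrow> f (r \<oplus>\<^bsub>R\<^esub> s) = f r \<oplus>\<^bsub>D\<^esub> f s" for f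
    using that by (auto simp: H_def)
  have Heq: "\<phi> = \<psi>" if "\<phi> \<in> carrier H" "\<psi> \<in> carrier H" "\<And>r. r \<in> carrier R \<Longrightarrow> \<phi> r = \<psi> r" for \<phi> \<psi>
    by (rule PiE_ext[of \<phi> "carrier R" "\<lambda>_. carrier D" \<psi>]) (use that in \<open>simp_all add: H_def\<close>)
  interpret D: abelian_group D by (rule left_module_group[OF D(1)])
  have add_cl: "\<phi> \<oplus>\<^bsub>H\<^esub> \<psi> \<in> carrier H" if "\<phi> \<in> carrier H" "\<psi> \<in> carrier H" for \<phi> \<psi>
    unfolding Hops by (rule HI) (use that in \<open>simp_all add: Hcl Hadd D.a_ac\<close>)
  have smult_cl: "a \<odot>\<^bsub>H\<^esub> \<phi> \<in> carrier H" if "a \<in> carrier R" "\<phi> \<in> carrier H" for a \<phi>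
    unfolding Hops by (rule HI) (use that in \<open>simp_all add: Hcl Hadd R.l_distr\<close>)
  have zero_cl: "\<zero>\<^bsub>H\<^esub> \<in> carrier H" unfolding Hops by (rule HI) simp_all
  have Hval: "(\<phi> \<oplus>\<^bsub>H\<^esub> \<psi>) r = \<phi> r \<oplus>\<^bsub>D\<^esub> \<psi> r" "(a \<odot>\<^bsub>H\<^esub> \<phi>) r = \<phi> (r \<otimes>\<^bsub>R\<^esub> a)" "\<zero>\<^bsub>H\<^esub> r = \<zero>\<^bsub>D\<^esub>"
    if "r \<in> carrier R" for \<phi> \<psi> r a using that by (simp_all add: Hops)
  have LH: "left_module R H"
  proof (rule left_moduleI[OF ring])
    show "abelian_group H"
    proof (rule abelian_groupI)
      fix \<phi> assume p: "\<phi> \<in> carrier H"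
      have n: "(\<lambda>r\<in>carrier R. \<ominus>\<^bsub>D\<^esub> \<phi> r) \<in> carrier H"
        by (rule HI) (use p in \<open>simp_all add: Hcl Hadd D.minus_add\<close>)
      have "(\<lambda>r\<in>carrier R. \<ominus>\<^bsub>D\<^esub> \<phi> r) \<oplus>\<^bsub>H\<^esub> \<phi> = \<zero>\<^bsub>H\<^esub>"
        by (rule Heq[OF add_cl[OF n p] zero_cl]) (use p in \<open>simp add: Hval Hcl D.l_neg\<close>)
      then show "\<exists>\<psi>\<in>carrier H. \<psi> \<oplus>\<^bsub>H\<^esub> \<phi> = \<zero>\<^bsub>H\<^esub>" using n by blast
    next
      fix x y z assume *: "x \<in> carrier H" "y \<in> carrier H" "z \<in> carrier H"
      show "(x \<oplus>\<^bsub>H\<^esub> y) \<oplus>\<^bsub>H\<^esub> z = x \<oplus>\<^bsub>H\<^esub> (y \<oplus>\<^bsub>H\<^esub> z)"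
        by (rule Heq[OF add_cl[OF add_cl[OF *(1,2)] *(3)] add_cl[OF *(1) add_cl[OF *(2,3)]]])
          (use * in \<open>simp add: Hval Hcl D.a_assoc\<close>)
    next
      fix x y assume *: "x \<in> carrier H" "y \<in> carrier H"
      show "x \<oplus>\<^bsub>H\<^esub> y = y \<oplus>\<^bsub>H\<^esub> x"
        by (rule Heq[OF add_cl[OF *] add_cl[OF *(2,1)]]) (use * in \<open>simp add: Hval Hcl D.a_comm\<close>)
    next
      fix x assume *: "x \<in> carrier H"
      show "\<zero>\<^bsub>H\<^esub> \<oplus>\<^bsub>H\<^esub> x = x"
        by (rule Heq[OF add_cl[OF zero_cl *] *]) (use * in \<open>simp add: Hval Hcl\<close>)
    qed (rule add_cl zero_cl; assumption?)+
  next
    fix a b x assume *: "a \<in> carrier R" "b \<in> carrier R" "x \<in> carrier H"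
    show "(a \<oplus>\<^bsub>R\<^esub> b) \<odot>\<^bsub>H\<^esub> x = a \<odot>\<^bsub>H\<^esub> x \<oplus>\<^bsub>H\<^esub> b \<odot>\<^bsub>H\<^esub> x"
      by (rule Heq[OF smult_cl add_cl[OF smult_cl smult_cl]]) (use * in \<open>simp_all add: Hval Hcl Hadd R.r_distr\<close>)
    show "(a \<otimes>\<^bsub>R\<^esub> b) \<odot>\<^bsub>H\<^esub> x = a \<odot>\<^bsub>H\<^esub> (b \<odot>\<^bsub>H\<^esub> x)"
      by (rule Heq[OF smult_cl smult_cl[OF _ smult_cl]]) (use * in \<open>simp_all add: Hval R.m_assoc\<close>)
  next
    fix a x y assume *: "a \<in> carrier R" "x \<in> carrier H" "y \<in> carrier H"
    show "a \<odot>\<^bsub>H\<^esub> (x \<oplus>\<^bsub>H\<^esub> y) = a \<odot>\<^bsub>H\<^esub> x \<oplus>\<^bsub>H\<^esub> a \<odot>\<^bsub>H\<^esub> y"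
      by (rule Heq[OF smult_cl[OF _ add_cl] add_cl[OF smult_cl smult_cl]]) (use * in \<open>simp_all add: Hval\<close>)
  next
    fix x assume *: "x \<in> carrier H"
    show "\<one>\<^bsub>R\<^esub> \<odot>\<^bsub>H\<^esub> x = x"
      by (rule Heq[OF smult_cl]) (use * in \<open>simp_all add: Hval\<close>)
  qed (rule smult_cl)
  have "carrier H \<lesssim> C"
    by (rule lepoll_trans[OF subset_imp_lepoll C(2)]) (auto simp: H_def)
  then obtain E :: "('r, 'm) module" and h k where E: "E \<in> Mods" "linear_map R H E h" "linear_map R E H k"
    "\<And>x. x \<in> carrier H \<Longrightarrow> k (h x) = x" "\<And>y. y \<in> carrier E \<Longrightarrow> h (k y) = y"
    by (rule transport[OF LH _ C(1)]) (rule that)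
  have "E \<in> Inj R U"
  proof (rule InjI[OF E(1)])
    fix A B i f assume *: "A \<in> Mods" "B \<in> Mods" "i \<in> Hom R A B" "f \<in> Hom R A E" "inj_on i (carrier A)"
    have kf: "k (f a) \<in> carrier H" if "a \<in> carrier A" for a
      using linear_mapD(1)[OF E(3)] *(4) that by simp
    \<comment> \<open>One direction of the adjunction: evaluation at the identity of
      \<open>R\<close> turns an R-linear map into \<open>H\<close> into an additive map into
      \<open>D\<close>.\<close>
    have "linear_map int_ring (int_module A) D (\<lambda>a. k (f a) \<one>\<^bsub>R\<^esub>)"
    proof (rule additive_int_linear[OF ZM[OF *(1)] D(1)])
      fix x y assume "x \<in> carrier (int_module A)" "y \<in> carrier (int_module A)"
      then show "k (f (x \<oplus>\<^bsub>int_module A\<^esub> y)) \<one>\<^bsub>R\<^esub> = k (f x) \<one>\<^bsub>R\<^esub> \<oplus>\<^bsub>D\<^esub> k (f y) \<one>\<^bsub>R\<^esub>"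
        using *(4) linear_mapD(2)[OF E(3)] by (simp add: int_module_def Hval)
    qed (simp add: int_module_def Hcl kf)
    moreover have "linear_map int_ring (int_module A) (int_module B) i"
      by (rule additive_int_linear[OF ZM[OF *(1)] ZM[OF *(2)]]) (use *(3) in \<open>simp_all add: int_module_def\<close>)
    moreover have "inj_on i (carrier (int_module A))" using *(5) by (simp add: int_module_def)
    ultimately obtain g where g: "linear_map int_ring (int_module B) D g"
      "\<And>x. x \<in> carrier (int_module A) \<Longrightarrow> g (i x) = k (f x) \<one>\<^bsub>R\<^esub>"
      using divisible_extension[OF ZM[OF *(1)] ZM[OF *(2)] D(1,3)] by metis
    have gB: "g x \<in> carrier D" "g (x \<oplus>\<^bsub>B\<^esub> y) = g x \<oplus>\<^bsub>D\<^esub> g y" if "x \<in> carrier B" "y \<in> carrier B" for x y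
      using g(1) that by (auto simp: linear_map_def int_module_def)
    note LB = Mod_left_module[OF *(2)]
    \<comment> \<open>The opposite direction of the adjunction, applied to the extension
      \<open>g\<close> over the integers.\<close>
    define \<gamma> where "\<gamma> b = (\<lambda>r\<in>carrier R. g (r \<odot>\<^bsub>B\<^esub> b))" for b
    have \<gamma>: "\<gamma> b \<in> carrier H" if "b \<in> carrier B" for b
      unfolding \<gamma>_def by (rule HI) (use that *(2) in \<open>simp_all add: gB left_module_l_distr[OF LB]\<close>)
    have lin: "linear_map R B H \<gamma>"
      unfolding linear_map_def
    proof (intro conjI ballI)
      fix x y assume xy: "x \<in> carrier B" "y \<in> carrier B"
      show "\<gamma> (x \<oplus>\<^bsub>B\<^esub> y) = \<gamma> x \<oplus>\<^bsub>H\<^esub> \<gamma> y"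
        by (rule Heq[OF \<gamma> add_cl[OF \<gamma> \<gamma>]]) (use xy *(2) in \<open>simp_all add: Hval\<close>, simp add: \<gamma>_def gB mod_smult_add)
    next
      fix a x assume x: "a \<in> carrier R" "x \<in> carrier B"
      show "\<gamma> (a \<odot>\<^bsub>B\<^esub> x) = a \<odot>\<^bsub>H\<^esub> \<gamma> x"
        by (rule Heq[OF \<gamma> smult_cl[OF _ \<gamma>]])
          (use x *(2) in \<open>simp_all add: Hval\<close>, simp add: \<gamma>_def left_module_smult_assoc[OF LB])
    qed (rule \<gamma>)
    let ?g = "restrict (\<lambda>b. h (\<gamma> b)) (carrier B)"
    have "?g \<in> Hom R B E" by (rule linear_map_Hom[OF linear_map_comp[OF lin E(2)] *(2)])
    moreover have "?g (i a) = f a" if a: "a \<in> carrier A" for a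
    proof -
      have ia: "i a \<in> carrier B" using *(3) a by simp
      have "\<gamma> (i a) = k (f a)"
      proof (rule Heq[OF \<gamma>[OF ia] kf[OF a]])
        fix r assume r: "r \<in> carrier R"
        have "\<gamma> (i a) r = g (i (r \<odot>\<^bsub>A\<^esub> a))" using *(1,3) a r by (simp add: \<gamma>_def)
        also have "\<dots> = k (f (r \<odot>\<^bsub>A\<^esub> a)) \<one>\<^bsub>R\<^esub>" using g(2) *(1) a r by (simp add: int_module_def)
        also have "\<dots> = k (f a) r" using *(4) a r linear_mapD(3)[OF E(3)] by (simp add: Hval)
        finally show "\<gamma> (i a) r = k (f a) r" .
      qed
      then show ?thesis using E(5) *(4) a ia by simp
    qed
    ultimately show "\<exists>g\<in>Hom R B E. \<forall>x\<in>carrier A. g (i x) = f x" by blast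
  qed
  moreover
  \<comment> \<open>The adjoint of the embedding \<open>u\<close>; evaluation at the identity of
    \<open>R\<close> recovers \<open>u x\<close>, hence injectivity.\<close>
  define \<eta> where "\<eta> x = (\<lambda>r\<in>carrier R. u (r \<odot>\<^bsub>X\<^esub> x))" for x
  have \<eta>: "\<eta> x \<in> carrier H" if "x \<in> carrier X" for x
    unfolding \<eta>_def by (rule HI) (use that X in \<open>simp_all add: uX left_module_l_distr[OF LX]\<close>)
  have lin: "linear_map R X H \<eta>"
    unfolding linear_map_def
  proof (intro conjI ballI)
    fix x y assume xy: "x \<in> carrier X" "y \<in> carrier X"
    show "\<eta> (x \<oplus>\<^bsub>X\<^esub> y) = \<eta> x \<oplus>\<^bsub>H\<^esub> \<eta> y"
      by (rule Heq[OF \<eta> add_cl[OF \<eta> \<eta>]]) (use xy X in \<open>simp_all add: Hval\<close>, simp add: \<eta>_def uX mod_smult_add)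
  next
    fix a x assume x: "a \<in> carrier R" "x \<in> carrier X"
    show "\<eta> (a \<odot>\<^bsub>X\<^esub> x) = a \<odot>\<^bsub>H\<^esub> \<eta> x"
      by (rule Heq[OF \<eta> smult_cl[OF _ \<eta>]])
        (use x X in \<open>simp_all add: Hval\<close>, simp add: \<eta>_def left_module_smult_assoc[OF LX])
  qed (rule \<eta>)
  let ?i = "restrict (\<lambda>x. h (\<eta> x)) (carrier X)"
  have "?i \<in> Hom R X E" by (rule linear_map_Hom[OF linear_map_comp[OF lin E(2)] X])
  moreover have "inj_on ?i (carrier X)"
  proof (rule inj_onI)
    fix x y assume xy: "x \<in> carrier X" "y \<in> carrier X" "?i x = ?i y"
    then have "h (\<eta> x) = h (\<eta> y)" by simp
    then have "\<eta> x = \<eta> y" using E(4)[OF \<eta>[OF xy(1)]] E(4)[OF \<eta>[OF xy(2)]] by metis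
    then have "\<eta> x \<one>\<^bsub>R\<^esub> = \<eta> y \<one>\<^bsub>R\<^esub>" by simp
    then have "u x = u y" using xy by (simp add: \<eta>_def left_module_smult_one[OF LX])
    then show "x = y" using inj_onD[OF u(2)] xy by (simp add: int_module_def)
  qed
  ultimately show thesis by (rule that)
qed

section \<open>Vanishing of Ext\<close>

text \<open>Vanishing of the first Ext group in the form in which it is applied: maps out of a
  submodule with quotient \<open>X\<close> extend to the whole module. This refers to no resolution,
  so no choice has to be proved irrelevant.\<close>

definition orth :: "('r, 'm) module \<Rightarrow> ('r, 'm) module \<Rightarrow> bool" where
  "orth X N \<longleftrightarrow> (\<forall>A B i p f. ses A i B p X \<longrightarrow> f \<in> Hom R A N \<longrightarrow>
     (\<exists>g \<in> Hom R B N. \<forall>a \<in> carrier A. g (i a) = f a))"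

lemma orth_extend:
  assumes "orth X N" "ses A i B p X" "f \<in> Hom R A N"
  obtains g where "g \<in> Hom R B N" "\<And>a. a \<in> carrier A \<Longrightarrow> g (i a) = f a"
  using assms unfolding orth_def by blast

lemma syzygy:
  assumes "X \<in> Mods"
  obtains K j P q where "P \<in> Proj R U" "ses K j P q X"
proof -
  obtain P q where P: "P \<in> Proj R U" "q \<in> Hom R P X" "q ` carrier P = carrier X"
    by (rule enough_projectives[OF assms])
  show thesis by (rule that[OF P(1) ses_kernel[OF P(2) Proj_Mods[OF P(1)] assms P(3)]])
qed

lemma cosyzygy:
  assumes "N \<in> Mods"
  obtains i E p L where "E \<in> Inj R U" "ses N i E p L"
proof -
  obtain E i where E: "E \<in> Inj R U" "i \<in> Hom R N E" "inj_on i (carrier N)"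
    by (rule enough_injectives[OF assms])
  obtain L p where "ses N i E p L" by (rule cokernel_ses[OF E(2) assms Inj_Mods[OF E(1)] E(3)])
  then show thesis by (rule that[OF E(1)])
qed

text \<open>One projective presentation decides. Any other \<open>B\<close> over \<open>X\<close> is
  the quotient of the biproduct of \<open>A\<close> and \<open>P\<close> by the antidiagonal copy of
  \<open>K\<close> (a pushout), so \<open>f\<close> on \<open>A\<close> and the extension on
  \<open>P\<close> together descend to \<open>B\<close>.\<close>

lemma orthI_proj:
  assumes K: "ses K j P q X" and P: "P \<in> Proj R U" and N: "N \<in> Mods"
    and ext: "\<And>f. f \<in> Hom R K N \<Longrightarrow> \<exists>h \<in> Hom R P N. \<forall>k \<in> carrier K. h (j k) = f k"
  shows "orth X N"
  unfolding orth_def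
proof (intro allI impI)
  fix A B i p f assume B: "ses A i B p X" and f: "f \<in> Hom R A N"
  note Bd = sesD[OF B] and Kd = sesD[OF K]
  obtain l where l: "l \<in> Hom R P B" "\<And>x. x \<in> carrier P \<Longrightarrow> p (l x) = q x"
    by (rule Proj_lift[OF P Bd(2,3,5) Kd(5) Bd(7)]) (rule that)
  obtain lj where lj: "lj \<in> Hom R K B" "\<And>k. k \<in> carrier K \<Longrightarrow> lj k = l (j k)"
    by (rule Hom_comp[OF Kd(4) l(1) Kd(1)]) (rule that)
  obtain u where u: "u \<in> Hom R K A" "\<And>k. k \<in> carrier K \<Longrightarrow> i (u k) = lj k"
    by (rule ses_factor_left[OF B lj(1) Kd(1)]) (use lj l Kd(4) ses_zero[OF K] in auto)
  obtain fu where fu: "fu \<in> Hom R K N" "\<And>k. k \<in> carrier K \<Longrightarrow> fu k = f (u k)"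
    by (rule Hom_comp[OF u(1) f Kd(1)]) (rule that)
  obtain h where h: "h \<in> Hom R P N" "\<And>k. k \<in> carrier K \<Longrightarrow> h (j k) = fu k"
    using ext[OF fu(1)] by blast
  obtain S a b where S: "biprod S a b A P" by (rule biprod_exists[OF Bd(1) Kd(2)])
  have Sd: "S \<in> Mods" "a \<in> Hom R S A" "b \<in> Hom R S P" using S by (simp_all add: biprod_def)
  have Spair: "\<exists>s\<in>carrier S. a s = y \<and> b s = x" if "y \<in> carrier A" "x \<in> carrier P" for x y
    using S that by (simp add: biprod_def)
  obtain ia where ia: "ia \<in> Hom R S B" "\<And>s. s \<in> carrier S \<Longrightarrow> ia s = i (a s)"
    by (rule Hom_comp[OF Sd(2) Bd(4) Sd(1)]) (rule that)
  obtain lb where lb: "lb \<in> Hom R S B" "\<And>s. s \<in> carrier S \<Longrightarrow> lb s = l (b s)"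
    by (rule Hom_comp[OF Sd(3) l(1) Sd(1)]) (rule that)
  obtain fa where fa: "fa \<in> Hom R S N" "\<And>s. s \<in> carrier S \<Longrightarrow> fa s = f (a s)"
    by (rule Hom_comp[OF Sd(2) f Sd(1)]) (rule that)
  obtain hb where hb: "hb \<in> Hom R S N" "\<And>s. s \<in> carrier S \<Longrightarrow> hb s = h (b s)"
    by (rule Hom_comp[OF Sd(3) h(1) Sd(1)]) (rule that)
  obtain s where s: "s \<in> Hom R S B" "\<And>x. x \<in> carrier S \<Longrightarrow> s x = ia x \<oplus>\<^bsub>B\<^esub> lb x"
    using Hom_sum[OF ia(1) lb(1) Sd(1) Bd(2)] by blast
  obtain t where t: "t \<in> Hom R S N" "\<And>x. x \<in> carrier S \<Longrightarrow> t x = fa x \<oplus>\<^bsub>N\<^esub> hb x"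
    using Hom_sum[OF fa(1) hb(1) Sd(1) N] by blast
  have surj: "s ` carrier S = carrier B"
  proof (intro subset_antisym subsetI)
    fix y assume y: "y \<in> carrier B"
    then have "p y \<in> carrier X" using Bd(5) by simp
    then obtain x where x: "x \<in> carrier P" "q x = p y" using ses_surj[OF K] by blast
    have lx: "l x \<in> carrier B" using l(1) x(1) by simp
    have "p (y \<ominus>\<^bsub>B\<^esub> l x) = \<zero>\<^bsub>X\<^esub>" using Bd(2,3,5) y lx x l(2) by simp
    then obtain z where z: "z \<in> carrier A" "i z = y \<ominus>\<^bsub>B\<^esub> l x"
      using ses_mid[OF B] mod_minus[OF Bd(2) y lx] by blast
    obtain w where w: "w \<in> carrier S" "a w = z" "b w = x" using Spair[OF z(1) x(1)] by blast
    have "s w = y" using w z x lx y Bd(2) by (simp add: s(2) ia(2) lb(2))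
    then show "y \<in> s ` carrier S" using w(1) by blast
  qed (use Hom_closed[OF s(1)] in blast)
  obtain g where g: "g \<in> Hom R B N" "\<And>x. x \<in> carrier S \<Longrightarrow> g (s x) = t x"
  proof (rule factor_surj[OF s(1) surj t(1) Sd(1) Bd(2) N])
    fix w assume w: "w \<in> carrier S" "s w = \<zero>\<^bsub>B\<^esub>"
    define y x where "y = a w" and "x = b w"
    have yx: "y \<in> carrier A" "x \<in> carrier P" using w Sd by (simp_all add: y_def x_def)
    have lx: "l x \<in> carrier B" "i y \<in> carrier B" using l(1) yx Bd(4) by simp_all
    have e: "i y \<oplus>\<^bsub>B\<^esub> l x = \<zero>\<^bsub>B\<^esub>" using w by (simp add: s(2) ia(2) lb(2) y_def x_def)
    have "p (i y \<oplus>\<^bsub>B\<^esub> l x) = p (i y) \<oplus>\<^bsub>X\<^esub> p (l x)" using Hom_add[OF Bd(5) lx(2,1)] .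
    then have "q x = \<zero>\<^bsub>X\<^esub>"
      using e ses_zero[OF B yx(1)] l(2)[OF yx(2)] Hom_closed[OF Kd(5) yx(2)] Hom_zero[OF Bd(5,2,3)] Bd(3) by simp
    then obtain k where k: "k \<in> carrier K" "j k = x" using ses_mid[OF K yx(2)] by blast
    have uk: "u k \<in> carrier A" using u(1) k by simp
    have "i (y \<oplus>\<^bsub>A\<^esub> u k) = \<zero>\<^bsub>B\<^esub>" using e Hom_add[OF Bd(4) yx(1) uk] u(2)[OF k(1)] lj(2)[OF k(1)] k by simp
    then have "y \<oplus>\<^bsub>A\<^esub> u k = \<zero>\<^bsub>A\<^esub>" by (rule ses_inj_0[OF B mod_add[OF Bd(1) yx(1) uk]])
    then have "f y \<oplus>\<^bsub>N\<^esub> f (u k) = \<zero>\<^bsub>N\<^esub>" using Hom_add[OF f yx(1) uk] Hom_zero[OF f Bd(1) N] by simp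
    then show "t w = \<zero>\<^bsub>N\<^esub>"
      using w h(2)[OF k(1)] fu(2)[OF k(1)] k(2) by (simp add: t(2) fa(2) hb(2) y_def x_def)
  qed (rule that)
  have "g (i y) = f y" if y: "y \<in> carrier A" for y
  proof -
    obtain w where w: "w \<in> carrier S" "a w = y" "b w = \<zero>\<^bsub>P\<^esub>" using Spair[OF y mod_zero[OF Kd(2)]] by blast
    have "s w = i y" "t w = f y"
      using w y Hom_zero[OF l(1) Kd(2) Bd(2)] Hom_zero[OF h(1) Kd(2) N] Bd(2) N Hom_closed[OF Bd(4) y] Hom_closed[OF f y]
      by (simp_all add: s(2) t(2) ia(2) lb(2) fa(2) hb(2))
    then show ?thesis using g(2)[OF w(1)] by simp
  qed
  then show "\<exists>g\<in>Hom R B N. \<forall>a\<in>carrier A. g (i a) = f a" using g(1) by blast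
qed

text \<open>The same vanishing read on the other side: maps from \<open>X\<close> lift through an
  epimorphism with kernel \<open>N\<close>. The obstruction to descending a lift on \<open>P\<close>
  is a map from \<open>K\<close> to \<open>N\<close>, and \<open>orth\<close> extends it to
  \<open>P\<close>.\<close>

lemma orth_lift:
  assumes X: "orth X N" "X \<in> Mods" and B: "ses N i B p C" and f: "f \<in> Hom R X C"
  obtains g where "g \<in> Hom R X B" "\<And>x. x \<in> carrier X \<Longrightarrow> p (g x) = f x"
proof -
  note Bd = sesD[OF B]
  obtain K j P q where P: "P \<in> Proj R U" and K: "ses K j P q X" by (rule syzygy[OF X(2)])
  note Kd = sesD[OF K]
  obtain fq where fq: "fq \<in> Hom R P C" "\<And>x. x \<in> carrier P \<Longrightarrow> fq x = f (q x)"
    by (rule Hom_comp[OF Kd(5) f Kd(2)]) (rule that)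
  obtain h where h: "h \<in> Hom R P B" "\<And>x. x \<in> carrier P \<Longrightarrow> p (h x) = fq x"
    by (rule Proj_lift[OF P Bd(2,3,5) fq(1) Bd(7)]) (rule that)
  obtain hj where hj: "hj \<in> Hom R K B" "\<And>k. k \<in> carrier K \<Longrightarrow> hj k = h (j k)"
    by (rule Hom_comp[OF Kd(4) h(1) Kd(1)]) (rule that)
  obtain u where u: "u \<in> Hom R K N" "\<And>k. k \<in> carrier K \<Longrightarrow> i (u k) = hj k"
    by (rule ses_factor_left[OF B hj(1) Kd(1)])
      (use hj h fq Kd(4) ses_zero[OF K] Hom_zero[OF f X(2) Bd(3)] in auto)
  obtain v where v: "v \<in> Hom R P N" "\<And>k. k \<in> carrier K \<Longrightarrow> v (j k) = u k"
    by (rule orth_extend[OF X(1) K u(1)]) (rule that)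
  obtain iv where iv: "iv \<in> Hom R P B" "\<And>x. x \<in> carrier P \<Longrightarrow> iv x = i (v x)"
    by (rule Hom_comp[OF v(1) Bd(4) Kd(2)]) (rule that)
  \<comment> \<open>The correction makes the lift vanish on \<open>K\<close>, so that it descends to
    \<open>X\<close>; as it takes values in \<open>N\<close>, composition with \<open>p\<close> does
    not notice it.\<close>
  obtain m where m: "m \<in> Hom R P B" "\<And>x. x \<in> carrier P \<Longrightarrow> m x = h x \<ominus>\<^bsub>B\<^esub> iv x"
    using Hom_diff[OF h(1) iv(1) Kd(2) Bd(2)] by blast
  obtain g where g: "g \<in> Hom R X B" "\<And>x. x \<in> carrier P \<Longrightarrow> g (q x) = m x"
  proof (rule ses_factor_right[OF K m(1) Bd(2)])
    fix k assume k: "k \<in> carrier K"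
    then have "j k \<in> carrier P" "h (j k) \<in> carrier B" using Kd(4) h(1) by simp_all
    then show "m (j k) = \<zero>\<^bsub>B\<^esub>" using k Bd(2) by (simp add: m(2) iv(2) v(2) u(2) hj(2))
  qed (rule that)
  have "p (g x) = f x" if x: "x \<in> carrier X" for x
  proof -
    obtain y where y: "y \<in> carrier P" "q y = x" using ses_surj[OF K x] by blast
    have "iv y \<in> carrier B" "h y \<in> carrier B" "v y \<in> carrier N" using y h iv(1) v(1) by simp_all
    then have "p (m y) = f x \<ominus>\<^bsub>C\<^esub> \<zero>\<^bsub>C\<^esub>"
      using y Bd(2,3,5) h(2) fq(2) ses_zero[OF B] by (simp add: m(2) iv(2) del: mod_minus_0)
    then show ?thesis using g(2)[OF y(1)] y(2) Hom_closed[OF f x] Bd(3) by simp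
  qed
  then show thesis using g(1) that by blast
qed

text \<open>The dual test: one embedding of \<open>N\<close> into an injective decides. It converts
  the lifting property back into the extension property.\<close>

lemma orthI_inj:
  assumes E: "ses N i E p L" "E \<in> Inj R U" and X: "X \<in> Mods"
    and lift: "\<And>f. f \<in> Hom R X L \<Longrightarrow> \<exists>g \<in> Hom R X E. \<forall>x \<in> carrier X. p (g x) = f x"
  shows "orth X N"
  unfolding orth_def
proof (intro allI impI)
  fix A B j q f assume B: "ses A j B q X" and f: "f \<in> Hom R A N"
  note Bd = sesD[OF B] and Ed = sesD[OF E(1)]
  obtain ff where ff: "ff \<in> Hom R A E" "\<And>x. x \<in> carrier A \<Longrightarrow> ff x = i (f x)"
    by (rule Hom_comp[OF f Ed(4) Bd(1)]) (rule that)
  obtain h where h: "h \<in> Hom R B E" "\<And>x. x \<in> carrier A \<Longrightarrow> h (j x) = ff x"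
    by (rule Inj_extend[OF E(2) Bd(1,2,4) ff(1) Bd(6)]) (rule that)
  obtain ph where ph: "ph \<in> Hom R B L" "\<And>x. x \<in> carrier B \<Longrightarrow> ph x = p (h x)"
    by (rule Hom_comp[OF h(1) Ed(5) Bd(2)]) (rule that)
  obtain m where m: "m \<in> Hom R X L" "\<And>x. x \<in> carrier B \<Longrightarrow> m (q x) = ph x"
    by (rule ses_factor_right[OF B ph(1) Ed(3)])
      (use ph(2) h(2) ff(2) Bd(4) f ses_zero[OF E(1)] in simp_all)
  obtain n where n: "n \<in> Hom R X E" "\<And>x. x \<in> carrier X \<Longrightarrow> p (n x) = m x" using lift[OF m(1)] by blast
  obtain nq where nq: "nq \<in> Hom R B E" "\<And>x. x \<in> carrier B \<Longrightarrow> nq x = n (q x)"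
    by (rule Hom_comp[OF Bd(5) n(1) Bd(2)]) (rule that)
  \<comment> \<open>The subtracted map is zero on \<open>A\<close>, since \<open>q\<close> kills
    \<open>A\<close>, and it moves \<open>h\<close> into the kernel of \<open>p\<close>, which is
    \<open>N\<close>.\<close>
  obtain d where d: "d \<in> Hom R B E" "\<And>x. x \<in> carrier B \<Longrightarrow> d x = h x \<ominus>\<^bsub>E\<^esub> nq x"
    using Hom_diff[OF h(1) nq(1) Bd(2) Ed(2)] by blast
  obtain g where g: "g \<in> Hom R B N" "\<And>x. x \<in> carrier B \<Longrightarrow> i (g x) = d x"
  proof (rule ses_factor_left[OF E(1) d(1) Bd(2)])
    fix x assume x: "x \<in> carrier B"
    have "p (d x) = p (h x) \<ominus>\<^bsub>L\<^esub> p (nq x)"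
      using x h(1) nq(1) Ed(2,3,5) by (simp add: d(2))
    also have "\<dots> = \<zero>\<^bsub>L\<^esub>"
      using x Bd(5) n(2) m(2) ph(2) Hom_closed[OF ph(1) x] Ed(3) by (simp add: nq(2))
    finally show "p (d x) = \<zero>\<^bsub>L\<^esub>" .
  qed (rule that)
  have "g (j x) = f x" if x: "x \<in> carrier A" for x
  proof -
    have jx: "j x \<in> carrier B" using Bd(4) x by simp
    have "nq (j x) = \<zero>\<^bsub>E\<^esub>" using ses_zero[OF B x] Hom_zero[OF n(1) X Ed(2)] by (simp add: nq(2)[OF jx])
    then have "i (g (j x)) = i (f x)"
      using g(2)[OF jx] d(2)[OF jx] h(2)[OF x] ff(2)[OF x] Hom_closed[OF Ed(4) Hom_closed[OF f x]] Ed(2) by simp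
    then show ?thesis by (rule ses_inj[OF E(1) Hom_closed[OF g(1) jx] Hom_closed[OF f x]])
  qed
  then show "\<exists>g\<in>Hom R B N. \<forall>a\<in>carrier A. g (j a) = f a" using g(1) by blast
qed

text \<open>Both sides say that every \<open>K \<rightarrow> L\<close> extends to \<open>P\<close>, equivalently lifts to \<open>E\<close>.\<close>

lemma orth_balance:
  assumes K: "ses K j P q X" "P \<in> Proj R U" and E: "ses N i E p L" "E \<in> Inj R U"
  shows "orth K N \<longleftrightarrow> orth X L"
proof
  note Kd = sesD[OF K(1)] and Ed = sesD[OF E(1)]
  assume o: "orth K N"
  show "orth X L"
  proof (rule orthI_proj[OF K Ed(3)])
    fix f assume f: "f \<in> Hom R K L"
    obtain g where g: "g \<in> Hom R K E" "\<And>x. x \<in> carrier K \<Longrightarrow> p (g x) = f x"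
      by (rule orth_lift[OF o Kd(1) E(1) f]) (rule that)
    obtain h where h: "h \<in> Hom R P E" "\<And>x. x \<in> carrier K \<Longrightarrow> h (j x) = g x"
      by (rule Inj_extend[OF E(2) Kd(1,2,4) g(1) Kd(6)]) (rule that)
    obtain ph where "ph \<in> Hom R P L" "\<And>x. x \<in> carrier P \<Longrightarrow> ph x = p (h x)"
      by (rule Hom_comp[OF h(1) Ed(5) Kd(2)]) (rule that)
    then show "\<exists>h\<in>Hom R P L. \<forall>k\<in>carrier K. h (j k) = f k"
      using g h Kd(4) by (intro bexI[of _ ph]) simp_all
  qed
next
  note Kd = sesD[OF K(1)] and Ed = sesD[OF E(1)]
  assume o: "orth X L"
  show "orth K N"
  proof (rule orthI_inj[OF E Kd(1)])
    fix f assume f: "f \<in> Hom R K L"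
    obtain g where g: "g \<in> Hom R P L" "\<And>x. x \<in> carrier K \<Longrightarrow> g (j x) = f x"
      by (rule orth_extend[OF o K(1) f]) (rule that)
    obtain h where h: "h \<in> Hom R P E" "\<And>x. x \<in> carrier P \<Longrightarrow> p (h x) = g x"
      by (rule Proj_lift[OF K(2) Ed(2,3,5) g(1) Ed(7)]) (rule that)
    obtain hj where "hj \<in> Hom R K E" "\<And>x. x \<in> carrier K \<Longrightarrow> hj x = h (j x)"
      by (rule Hom_comp[OF Kd(4) h(1) Kd(1)]) (rule that)
    then show "\<exists>g\<in>Hom R K E. \<forall>x\<in>carrier K. p (g x) = f x"
      using g h Kd(4) by (intro bexI[of _ hj]) simp_all
  qed
qed

text \<open>\<open>ext_zero n X N\<close> means that \<open>Ext\<^sup>n\<^sup>+\<^sup>1(X, N) = 0\<close>.\<close>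

primrec ext_zero :: "nat \<Rightarrow> ('r, 'm) module \<Rightarrow> ('r, 'm) module \<Rightarrow> bool" where
  "ext_zero 0 X N \<longleftrightarrow> orth X N"
| "ext_zero (Suc n) X N \<longleftrightarrow> (\<forall>K j P q. P \<in> Proj R U \<longrightarrow> ses K j P q X \<longrightarrow> ext_zero n K N)"

text \<open>Dimension shifting in the second variable. The induction generalises \<open>X\<close>,
  because unfolding \<open>ext_zero\<close> replaces \<open>X\<close> by its syzygies, and
  \<open>orth_balance\<close> is the base.\<close>

lemma ext_zero_cosyzygy:
  assumes "X \<in> Mods" "ses N i E p L" "E \<in> Inj R U"
  shows "ext_zero (Suc n) X N \<longleftrightarrow> ext_zero n X L"
  using assms(1)
proof (induction n arbitrary: X)
  case 0
  obtain K j P q where P: "P \<in> Proj R U" "ses K j P q X" by (rule syzygy[OF 0])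
  show ?case using orth_balance[OF _ _ assms(2,3)] P by (simp, metis)
next
  case (Suc n)
  have "ext_zero (Suc n) K N \<longleftrightarrow> ext_zero n K L" if "ses K j P q X" for K j P q
    by (rule Suc.IH[OF sesD(1)[OF that]])
  then show ?case unfolding ext_zero.simps(2)[of "Suc n"] ext_zero.simps(2)[of n _ L] by blast
qed

text \<open>\<open>ext_zero\<close> quantifies over all projective presentations; here an arbitrary
  single one is shown to decide. The dependence on the presentation disappears by moving to a
  cosyzygy of \<open>N\<close>, where \<open>X\<close> itself reappears.\<close>

lemma ext_zero_syzygy:
  assumes "N \<in> Mods" "ses K j P q X" "P \<in> Proj R U"
  shows "ext_zero (Suc n) X N \<longleftrightarrow> ext_zero n K N"
  using assms(1)
proof (induction n arbitrary: N)
  case 0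
  obtain i E p L where E: "E \<in> Inj R U" "ses N i E p L" by (rule cosyzygy[OF 0])
  show ?case using orth_balance[OF assms(2,3) E(2,1)] ext_zero_cosyzygy[OF sesD(3)[OF assms(2)] E(2,1), of 0]
    by simp
next
  case (Suc n)
  obtain i E p L where E: "E \<in> Inj R U" "ses N i E p L" by (rule cosyzygy[OF Suc.prems])
  show ?case
    using Suc.IH[OF sesD(3)[OF E(2)]] ext_zero_cosyzygy[OF sesD(3)[OF assms(2)] E(2,1)]
      ext_zero_cosyzygy[OF sesD(1)[OF assms(2)] E(2,1)] by metis
qed

end

section \<open>Long exact sequences and the comparison with Ext\<close>

text \<open>Dependent choice for building (co)resolutions: \<open>y n\<close> stores the modules and
  maps that link consecutive terms, and \<open>Q\<close> is the invariant that keeps the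
  construction going.\<close>

lemma nat_chain:
  assumes "Q M" "\<And>M. Q M \<Longrightarrow> \<exists>y M'. S M y M' \<and> Q M'"
  obtains T y where "T 0 = M" "\<And>n :: nat. Q (T n)" "\<And>n. S (T n) (y n) (T (Suc n))"
proof -
  obtain g h where gh: "\<And>M. Q M \<Longrightarrow> S M (g M) (h M) \<and> Q (h M)" using assms(2) by metis
  define T where "T = rec_nat M (\<lambda>_. h)"
  have Q: "Q (T n)" for n by (induction n) (use assms(1) gh in \<open>auto simp: T_def\<close>)
  show thesis
    by (rule that[of T "\<lambda>n. g (T n)"]) (use Q gh in \<open>auto simp: T_def\<close>)
qed

text \<open>In \<open>enat\<close> the infimum of a nonempty set is attained, while the empty set
  gives \<infinity>, which is not below any \<open>enat n\<close>. Bounds on a dimension thereby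
  become statements about the existence of a sequence.\<close>

lemma Inf_enat_le_iff: "Inf {enat k |k. P k} \<le> enat n \<longleftrightarrow> (\<exists>k\<le>n. P k)"
proof
  assume *: "Inf {enat k |k. P k} \<le> enat n"
  have "{enat k |k. P k} \<noteq> {}" using * by (auto simp: Inf_enat_def simp del: Collect_empty_eq)
  then have "Inf {enat k |k. P k} \<in> {enat k |k. P k}" unfolding Inf_enat_def by (metis (lifting) LeastI_ex ex_in_conv)
  then show "\<exists>k\<le>n. P k" using * by auto
next
  assume "\<exists>k\<le>n. P k"
  then obtain k where "k \<le> n" "P k" by blast
  then show "Inf {enat k |k. P k} \<le> enat n" by (intro Inf_lower2[of "enat k"]) auto
qed

context module_category
begin

text \<open>Exactness of Ext(X, A) -> Ext(X, B) -> Ext(X, C) in a fixed positive degree. In degree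
  one, the map to \<open>C\<close> is extended and lifted back to \<open>B\<close>; the error takes
  values in \<open>A\<close> and is extended separately. Higher degrees shift to a syzygy.\<close>

lemma ext_zero_middle:
  assumes B: "ses A i B p C" and "X \<in> Mods" "ext_zero n X A" "ext_zero n X C"
  shows "ext_zero n X B"
  using assms(2-)
proof (induction n arbitrary: X)
  case 0
  note Bd = sesD[OF B]
  obtain K j P q where P: "P \<in> Proj R U" and K: "ses K j P q X" by (rule syzygy[OF 0(1)])
  note Kd = sesD[OF K]
  have o: "orth X A" "orth X C" using 0 by simp_all
  have "orth X B"
  proof (rule orthI_proj[OF K P Bd(2)])
    fix f assume f: "f \<in> Hom R K B"
    obtain pf where pf: "pf \<in> Hom R K C" "\<And>x. x \<in> carrier K \<Longrightarrow> pf x = p (f x)"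
      by (rule Hom_comp[OF f Bd(5) Kd(1)]) (rule that)
    obtain m where m: "m \<in> Hom R P C" "\<And>x. x \<in> carrier K \<Longrightarrow> m (j x) = pf x"
      by (rule orth_extend[OF o(2) K pf(1)]) (rule that)
    obtain h where h: "h \<in> Hom R P B" "\<And>x. x \<in> carrier P \<Longrightarrow> p (h x) = m x"
      by (rule Proj_lift[OF P Bd(2,3,5) m(1) Bd(7)]) (rule that)
    obtain hj where hj: "hj \<in> Hom R K B" "\<And>x. x \<in> carrier K \<Longrightarrow> hj x = h (j x)"
      by (rule Hom_comp[OF Kd(4) h(1) Kd(1)]) (rule that)
    obtain d where d: "d \<in> Hom R K B" "\<And>x. x \<in> carrier K \<Longrightarrow> d x = f x \<ominus>\<^bsub>B\<^esub> hj x"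
      using Hom_diff[OF f hj(1) Kd(1) Bd(2)] by blast
    obtain e where e: "e \<in> Hom R K A" "\<And>x. x \<in> carrier K \<Longrightarrow> i (e x) = d x"
    proof (rule ses_factor_left[OF B d(1) Kd(1)])
      fix x assume x: "x \<in> carrier K"
      have "p (d x) = p (f x) \<ominus>\<^bsub>C\<^esub> p (hj x)"
        using x f hj(1) Bd(2,3,5) by (simp add: d(2))
      also have "\<dots> = \<zero>\<^bsub>C\<^esub>"
        using x Kd(4) h(2) m(2) pf(2) Hom_closed[OF pf(1) x] Bd(3) by (simp add: hj(2))
      finally show "p (d x) = \<zero>\<^bsub>C\<^esub>" .
    qed (rule that)
    obtain e' where e': "e' \<in> Hom R P A" "\<And>x. x \<in> carrier K \<Longrightarrow> e' (j x) = e x"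
      by (rule orth_extend[OF o(1) K e(1)]) (rule that)
    obtain ie where ie: "ie \<in> Hom R P B" "\<And>x. x \<in> carrier P \<Longrightarrow> ie x = i (e' x)"
      by (rule Hom_comp[OF e'(1) Bd(4) Kd(2)]) (rule that)
    obtain g where g: "g \<in> Hom R P B" "\<And>x. x \<in> carrier P \<Longrightarrow> g x = h x \<oplus>\<^bsub>B\<^esub> ie x"
      using Hom_sum[OF h(1) ie(1) Kd(2) Bd(2)] by blast
    have "g (j x) = f x" if x: "x \<in> carrier K" for x
    proof -
      have jx: "j x \<in> carrier P" using Kd(4) x by simp
      have "g (j x) = hj x \<oplus>\<^bsub>B\<^esub> (f x \<ominus>\<^bsub>B\<^esub> hj x)"
        using x by (simp only: g(2)[OF jx] ie(2)[OF jx] e'(2)[OF x] e(2)[OF x] d(2)[OF x] hj(2)[OF x])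
      then show ?thesis using Hom_closed[OF hj(1) x] Hom_closed[OF f x] Bd(2) by simp
    qed
    then show "\<exists>h\<in>Hom R P B. \<forall>k\<in>carrier K. h (j k) = f k" using g(1) by blast
  qed
  then show ?case by simp
next
  case (Suc n)
  obtain K j P q where P: "P \<in> Proj R U" and K: "ses K j P q X" by (rule syzygy[OF Suc.prems(1)])
  show ?case
    using Suc.IH[OF sesD(1)[OF K]] Suc.prems(2,3)
      ext_zero_syzygy[OF sesD(1)[OF B] K P] ext_zero_syzygy[OF sesD(2)[OF B] K P]
      ext_zero_syzygy[OF sesD(3)[OF B] K P] by blast
qed

text \<open>Ext(X, C) sits between Ext(X, B) in the same degree and Ext(X, A) one degree higher. In
  degree one this is lifting to \<open>B\<close> on a syzygy of \<open>X\<close>, followed by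
  extension.\<close>

lemma ext_zero_right:
  assumes B: "ses A i B p C" and "X \<in> Mods" "ext_zero n X B" "ext_zero (Suc n) X A"
  shows "ext_zero n X C"
  using assms(2-)
proof (induction n arbitrary: X)
  case 0
  note Bd = sesD[OF B]
  obtain K j P q where P: "P \<in> Proj R U" and K: "ses K j P q X" by (rule syzygy[OF 0(1)])
  note Kd = sesD[OF K]
  have o: "orth X B" "orth K A" using 0 ext_zero_syzygy[OF Bd(1) K P, of 0] by simp_all
  have "orth X C"
  proof (rule orthI_proj[OF K P Bd(3)])
    fix f assume f: "f \<in> Hom R K C"
    obtain g where g: "g \<in> Hom R K B" "\<And>x. x \<in> carrier K \<Longrightarrow> p (g x) = f x"
      by (rule orth_lift[OF o(2) Kd(1) B f]) (rule that)
    obtain h where h: "h \<in> Hom R P B" "\<And>x. x \<in> carrier K \<Longrightarrow> h (j x) = g x"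
      by (rule orth_extend[OF o(1) K g(1)]) (rule that)
    obtain ph where "ph \<in> Hom R P C" "\<And>x. x \<in> carrier P \<Longrightarrow> ph x = p (h x)"
      by (rule Hom_comp[OF h(1) Bd(5) Kd(2)]) (rule that)
    then show "\<exists>h\<in>Hom R P C. \<forall>k\<in>carrier K. h (j k) = f k"
      using g h Kd(4) by (intro bexI[of _ ph]) simp_all
  qed
  then show ?case by simp
next
  case (Suc n)
  obtain K j P q where P: "P \<in> Proj R U" and K: "ses K j P q X" by (rule syzygy[OF Suc.prems(1)])
  show ?case
    using Suc.IH[OF sesD(1)[OF K]] Suc.prems(2,3)
      ext_zero_syzygy[OF sesD(1)[OF B] K P] ext_zero_syzygy[OF sesD(2)[OF B] K P]
      ext_zero_syzygy[OF sesD(3)[OF B] K P] by blast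
qed

text \<open>Exactness at the target of the connecting map: Ext(X, A) sits between Ext(X, C) one
  degree lower and Ext(X, B) in the same degree. The base case already needs two syzygies of
  \<open>X\<close>.\<close>

lemma ext_zero_left:
  assumes B: "ses A i B p C" and "X \<in> Mods" "ext_zero n X C" "ext_zero (Suc n) X B"
  shows "ext_zero (Suc n) X A"
  using assms(2-)
proof (induction n arbitrary: X)
  case 0
  note Bd = sesD[OF B]
  obtain K j P q where P: "P \<in> Proj R U" and K: "ses K j P q X" by (rule syzygy[OF 0(1)])
  note Kd = sesD[OF K]
  obtain K' j' P' q' where P': "P' \<in> Proj R U" and K': "ses K' j' P' q' K" by (rule syzygy[OF Kd(1)])
  note Kd' = sesD[OF K']
  have o: "orth X C" "orth K B" using 0 ext_zero_syzygy[OF Bd(2) K P, of 0] by simp_all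
  have "orth K A"
  proof (rule orthI_proj[OF K' P' Bd(1)])
    fix f assume f: "f \<in> Hom R K' A"
    obtain f' where f': "f' \<in> Hom R K' B" "\<And>x. x \<in> carrier K' \<Longrightarrow> f' x = i (f x)"
      by (rule Hom_comp[OF f Bd(4) Kd'(1)]) (rule that)
    obtain h where h: "h \<in> Hom R P' B" "\<And>x. x \<in> carrier K' \<Longrightarrow> h (j' x) = f' x"
      by (rule orth_extend[OF o(2) K' f'(1)]) (rule that)
    obtain ph where ph: "ph \<in> Hom R P' C" "\<And>x. x \<in> carrier P' \<Longrightarrow> ph x = p (h x)"
      by (rule Hom_comp[OF h(1) Bd(5) Kd'(2)]) (rule that)
    obtain m where m: "m \<in> Hom R K C" "\<And>x. x \<in> carrier P' \<Longrightarrow> m (q' x) = ph x"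
    proof (rule ses_factor_right[OF K' ph(1) Bd(3)])
      fix x assume x: "x \<in> carrier K'"
      then show "ph (j' x) = \<zero>\<^bsub>C\<^esub>"
        using Kd'(4) ses_zero[OF B] f by (simp add: ph(2) h(2) f'(2))
    qed (rule that)
    obtain n where n: "n \<in> Hom R P C" "\<And>x. x \<in> carrier K \<Longrightarrow> n (j x) = m x"
      by (rule orth_extend[OF o(1) K m(1)]) (rule that)
    obtain g where g: "g \<in> Hom R P B" "\<And>x. x \<in> carrier P \<Longrightarrow> p (g x) = n x"
      by (rule Proj_lift[OF P Bd(2,3,5) n(1) Bd(7)]) (rule that)
    obtain gj where gj: "gj \<in> Hom R K B" "\<And>x. x \<in> carrier K \<Longrightarrow> gj x = g (j x)"
      by (rule Hom_comp[OF Kd(4) g(1) Kd(1)]) (rule that)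
    obtain gq where gq: "gq \<in> Hom R P' B" "\<And>x. x \<in> carrier P' \<Longrightarrow> gq x = gj (q' x)"
      by (rule Hom_comp[OF Kd'(5) gj(1) Kd'(2)]) (rule that)
    \<comment> \<open>The extension \<open>h\<close> of \<open>f\<close> lands in \<open>B\<close>.
      Its image in \<open>C\<close> factors through \<open>K\<close>, extends to \<open>P\<close>
      and lifts to \<open>g\<close>; subtracting \<open>g\<close> brings \<open>h\<close> into
      \<open>A\<close> without changing it on \<open>K'\<close>.\<close>
    obtain d where d: "d \<in> Hom R P' B" "\<And>x. x \<in> carrier P' \<Longrightarrow> d x = h x \<ominus>\<^bsub>B\<^esub> gq x"
      using Hom_diff[OF h(1) gq(1) Kd'(2) Bd(2)] by blast
    obtain e where e: "e \<in> Hom R P' A" "\<And>x. x \<in> carrier P' \<Longrightarrow> i (e x) = d x"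
    proof (rule ses_factor_left[OF B d(1) Kd'(2)])
      fix x assume x: "x \<in> carrier P'"
      have qx: "q' x \<in> carrier K" using Kd'(5) x by simp
      have "p (d x) = p (h x) \<ominus>\<^bsub>C\<^esub> p (gq x)"
        using x h(1) gq(1) Bd(2,3,5) by (simp add: d(2))
      also have "p (gq x) = p (h x)"
        using Hom_closed[OF Kd(4) qx] by (simp add: gq(2)[OF x] gj(2)[OF qx] g(2) n(2)[OF qx] m(2)[OF x] ph(2)[OF x])
      finally show "p (d x) = \<zero>\<^bsub>C\<^esub>" using Hom_closed[OF Bd(5) Hom_closed[OF h(1) x]] Bd(3) by simp
    qed (rule that)
    have "e (j' x) = f x" if x: "x \<in> carrier K'" for x
    proof -
      have jx: "j' x \<in> carrier P'" using Kd'(4) x by simp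
      have "gq (j' x) = \<zero>\<^bsub>B\<^esub>"
        using ses_zero[OF K' x] Hom_zero[OF gj(1) Kd(1) Bd(2)] by (simp add: gq(2)[OF jx])
      then have "i (e (j' x)) = i (f x)"
        using e(2)[OF jx] d(2)[OF jx] h(2)[OF x] f'(2)[OF x] Hom_closed[OF Bd(4) Hom_closed[OF f x]] Bd(2) by simp
      then show ?thesis by (rule ses_inj[OF B Hom_closed[OF e(1) jx] Hom_closed[OF f x]])
    qed
    then show "\<exists>h\<in>Hom R P' A. \<forall>k\<in>carrier K'. h (j' k) = f k" using e(1) by blast
  qed
  then show ?case using ext_zero_syzygy[OF Bd(1) K P, of 0] by simp
next
  case (Suc n)
  obtain K j P q where P: "P \<in> Proj R U" and K: "ses K j P q X" by (rule syzygy[OF Suc.prems(1)])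
  show ?case
    using Suc.IH[OF sesD(1)[OF K]] Suc.prems(2,3)
      ext_zero_syzygy[OF sesD(1)[OF B] K P] ext_zero_syzygy[OF sesD(2)[OF B] K P]
      ext_zero_syzygy[OF sesD(3)[OF B] K P] by blast
qed

text \<open>The long exact sequence in the first variable: Ext(A, N) sits between Ext(B, N) in the
  same degree and Ext(C, N) one degree higher. Induction shifts along cosyzygies of
  \<open>N\<close>, which leaves the given sequence untouched.\<close>

lemma ext_zero_subobject:
  assumes B: "ses A i B p C" and "N \<in> Mods" "ext_zero n B N" "ext_zero (Suc n) C N"
  shows "ext_zero n A N"
  using assms(2-)
proof (induction n arbitrary: N)
  case 0
  note Bd = sesD[OF B]
  obtain j E q L where E: "E \<in> Inj R U" "ses N j E q L" by (rule cosyzygy[OF 0(1)])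
  note Ed = sesD[OF E(2)]
  have o: "orth B N" "orth C L" using 0 ext_zero_cosyzygy[OF Bd(3) E(2,1), of 0] by simp_all
  have "orth A N"
  proof (rule orthI_inj[OF E(2,1) Bd(1)])
    fix f assume f: "f \<in> Hom R A L"
    obtain g where g: "g \<in> Hom R B L" "\<And>x. x \<in> carrier A \<Longrightarrow> g (i x) = f x"
      by (rule orth_extend[OF o(2) B f]) (rule that)
    obtain h where h: "h \<in> Hom R B E" "\<And>x. x \<in> carrier B \<Longrightarrow> q (h x) = g x"
      by (rule orth_lift[OF o(1) Bd(2) E(2) g(1)]) (rule that)
    obtain hi where "hi \<in> Hom R A E" "\<And>x. x \<in> carrier A \<Longrightarrow> hi x = h (i x)"
      by (rule Hom_comp[OF Bd(4) h(1) Bd(1)]) (rule that)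
    then show "\<exists>g\<in>Hom R A E. \<forall>x\<in>carrier A. q (g x) = f x"
      using g h Bd(4) by (intro bexI[of _ hi]) simp_all
  qed
  then show ?case by simp
next
  case (Suc n)
  obtain j E q L where E: "E \<in> Inj R U" "ses N j E q L" by (rule cosyzygy[OF Suc.prems(1)])
  show ?case
    using Suc.IH[OF sesD(3)[OF E(2)]] Suc.prems(2,3)
      ext_zero_cosyzygy[OF sesD(1)[OF B] E(2,1)] ext_zero_cosyzygy[OF sesD(2)[OF B] E(2,1)]
      ext_zero_cosyzygy[OF sesD(3)[OF B] E(2,1)] by blast
qed

lemma ext_zero_retract:
  assumes N: "N \<in> Mods" "N' \<in> Mods" and s: "s \<in> Hom R N N'" and r: "r \<in> Hom R N' N"
    and rs: "\<And>x. x \<in> carrier N \<Longrightarrow> r (s x) = x" and X: "X \<in> Mods" "ext_zero n X N'"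
  shows "ext_zero n X N"
  using X
proof (induction n arbitrary: X)
  case 0
  have "orth X N"
    unfolding orth_def
  proof (intro allI impI)
    fix A B i p f assume B: "ses A i B p X" and f: "f \<in> Hom R A N"
    note Bd = sesD[OF B]
    obtain sf where sf: "sf \<in> Hom R A N'" "\<And>x. x \<in> carrier A \<Longrightarrow> sf x = s (f x)"
      by (rule Hom_comp[OF f s Bd(1)]) (rule that)
    obtain g where g: "g \<in> Hom R B N'" "\<And>x. x \<in> carrier A \<Longrightarrow> g (i x) = sf x"
      using 0 orth_extend[OF _ B sf(1)] by auto
    obtain rg where rg: "rg \<in> Hom R B N" "\<And>x. x \<in> carrier B \<Longrightarrow> rg x = r (g x)"
      by (rule Hom_comp[OF g(1) r Bd(2)]) (rule that)
    show "\<exists>g\<in>Hom R B N. \<forall>a\<in>carrier A. g (i a) = f a"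
      by (rule bexI[OF _ rg(1)]) (use Bd(4) f in \<open>simp add: rg(2) g(2) sf(2) rs\<close>)
  qed
  then show ?case by simp
next
  case (Suc n)
  obtain K j P q where P: "P \<in> Proj R U" and K: "ses K j P q X" by (rule syzygy[OF Suc.prems(1)])
  show ?case
    using Suc.IH[OF sesD(1)[OF K]] Suc.prems(2) ext_zero_syzygy[OF N(1) K P] ext_zero_syzygy[OF N(2) K P]
    by blast
qed

lemma Hom_inverse:
  assumes "f \<in> Hom R A B" "bij_betw f (carrier A) (carrier B)" "A \<in> Mods" "B \<in> Mods"
  obtains g where "g \<in> Hom R B A" "\<And>x. x \<in> carrier B \<Longrightarrow> f (g x) = x" "\<And>x. x \<in> carrier A \<Longrightarrow> g (f x) = x"
proof -
  have f: "inj_on f (carrier A)" "f ` carrier A = carrier B" using assms(2) by (simp_all add: bij_betw_def)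
  obtain g where g: "g \<in> Hom R B A" "\<And>x. x \<in> carrier B \<Longrightarrow> f (g x) = (\<lambda>x\<in>carrier B. x) x"
    by (rule factor_inj[OF assms(1) f(1) Hom_id[OF assms(4)] assms(3,4,4)]) (use f(2) that in auto)
  then have fg: "f (g x) = x" if "x \<in> carrier B" for x using that by simp
  moreover have "g (f x) = x" if x: "x \<in> carrier A" for x
    using fg[OF Hom_closed[OF assms(1) x]] inj_onD[OF f(1)] g(1) assms(1) x by simp
  ultimately show thesis using that g(1) by blast
qed

lemma ext_zero_Inj: "\<lbrakk>N \<in> Inj R U; X \<in> Mods\<rbrakk> \<Longrightarrow> ext_zero n X N"
proof (induction n arbitrary: X)
  case 0
  have "orth X N" unfolding orth_def
  proof (intro allI impI)
    fix A B i p f assume B: "ses A i B p X" and f: "f \<in> Hom R A N"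
    note Bd = sesD[OF B]
    obtain g where "g \<in> Hom R B N" "\<And>x. x \<in> carrier A \<Longrightarrow> g (i x) = f x"
      by (rule Inj_extend[OF 0(1) Bd(1,2,4) f Bd(6)]) (rule that)
    then show "\<exists>g\<in>Hom R B N. \<forall>a\<in>carrier A. g (i a) = f a" by blast
  qed
  then show ?case by simp
next
  case (Suc n)
  then show ?case using sesD(1) unfolding ext_zero.simps by blast
qed

lemma ext_zero_Proj: "\<lbrakk>X \<in> Proj R U; N \<in> Mods\<rbrakk> \<Longrightarrow> ext_zero n X N"
proof (induction n arbitrary: N)
  case 0
  obtain j E q L where E: "E \<in> Inj R U" "ses N j E q L" by (rule cosyzygy[OF 0(2)])
  note Ed = sesD[OF E(2)]
  have "orth X N"
  proof (rule orthI_inj[OF E(2,1) Proj_Mods[OF 0(1)]])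
    fix f assume f: "f \<in> Hom R X L"
    obtain g where "g \<in> Hom R X E" "\<And>x. x \<in> carrier X \<Longrightarrow> q (g x) = f x"
      by (rule Proj_lift[OF 0(1) Ed(2,3,5) f Ed(7)]) (rule that)
    then show "\<exists>g\<in>Hom R X E. \<forall>x\<in>carrier X. q (g x) = f x" by blast
  qed
  then show ?case by simp
next
  case (Suc n)
  obtain j E q L where E: "E \<in> Inj R U" "ses N j E q L" by (rule cosyzygy[OF Suc.prems(2)])
  show ?case
    using Suc.IH[OF Suc.prems(1) sesD(3)[OF E(2)]] ext_zero_cosyzygy[OF Proj_Mods[OF Suc.prems(1)] E(2,1)]
    by blast
qed

lemma ProjI_orth:
  assumes "X \<in> Mods" "\<And>N. N \<in> Mods \<Longrightarrow> orth X N"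
  shows "X \<in> Proj R U"
proof (rule ProjI[OF assms(1)])
  fix A B p f assume *: "A \<in> Mods" "B \<in> Mods" "p \<in> Hom R A B" "f \<in> Hom R X B" "p ` carrier A = carrier B"
  note s = ses_kernel[OF *(3,1,2,5)]
  obtain g where "g \<in> Hom R X A" "\<And>x. x \<in> carrier X \<Longrightarrow> p (g x) = f x"
    by (rule orth_lift[OF assms(2)[OF sesD(1)[OF s]] assms(1) s *(4)]) (rule that)
  then show "\<exists>g\<in>Hom R X A. \<forall>x\<in>carrier X. p (g x) = f x" by blast
qed

lemma InjI_orth:
  assumes "N \<in> Mods" "\<And>X. X \<in> Mods \<Longrightarrow> orth X N"
  shows "N \<in> Inj R U"
proof (rule InjI[OF assms(1)])
  fix A B i f assume *: "A \<in> Mods" "B \<in> Mods" "i \<in> Hom R A B" "f \<in> Hom R A N" "inj_on i (carrier A)"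
  obtain C p where s: "ses A i B p C" by (rule cokernel_ses[OF *(3,1,2,5)])
  obtain g where "g \<in> Hom R B N" "\<And>x. x \<in> carrier A \<Longrightarrow> g (i x) = f x"
    by (rule orth_extend[OF assms(2)[OF sesD(3)[OF s]] s *(4)]) (rule that)
  then show "\<exists>g\<in>Hom R B N. \<forall>x\<in>carrier A. g (i x) = f x" by blast
qed

text \<open>Vanishing passes to higher degrees because it is assumed for all \<open>X\<close> at
  once, in particular for the syzygies of a given one.\<close>

lemma ext_zero_mono_inj:
  assumes "N \<in> Mods" "\<And>X. X \<in> Mods \<Longrightarrow> ext_zero n X N" "n \<le> m" "X \<in> Mods"
  shows "ext_zero m X N"
  using assms(3,4)
proof (induction m arbitrary: X rule: dec_induct)
  case (step m)
  obtain K j P q where P: "P \<in> Proj R U" and K: "ses K j P q X" by (rule syzygy[OF step.prems])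
  then show ?case using ext_zero_syzygy[OF assms(1) K P] step.IH[OF sesD(1)[OF K]] by blast
qed (rule assms(2))

lemma ext_zero_mono_proj:
  assumes "X \<in> Mods" "\<And>N. N \<in> Mods \<Longrightarrow> ext_zero n X N" "n \<le> m" "N \<in> Mods"
  shows "ext_zero m X N"
  using assms(3,4)
proof (induction m arbitrary: N rule: dec_induct)
  case (step m)
  obtain j E q L where E: "E \<in> Inj R U" "ses N j E q L" by (rule cosyzygy[OF step.prems])
  then show ?case using ext_zero_cosyzygy[OF assms(1) E(2,1)] step.IH[OF sesD(3)[OF E(2)]] by blast
qed (rule assms(2))

text \<open>Exactness identifies the kernel of \<open>g\<close> with the image of \<open>f\<close>,
  so \<open>f\<close> is onto it. This cuts exact complexes into short exact sequences of their
  cycles.\<close>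

lemma ses_kernel_exact:
  assumes f: "f \<in> Hom R A B" and g: "g \<in> Hom R B C" and M: "A \<in> Mods" "B \<in> Mods" "C \<in> Mods"
    and ex: "exact_at A f B g C"
  shows "ses (kernel_module A f B) (\<lambda>x\<in>kernel_of A f B. x) A f (kernel_module B g C)"
proof -
  let ?Z = "kernel_module B g C"
  have c: "carrier ?Z = f ` carrier A" using ex by (simp add: kernel_module_def exact_at_def)
  have o: "add ?Z = add B" "smult ?Z = smult B" "zero ?Z = zero B" by (simp_all add: kernel_module_def)
  have "f \<in> Hom R A ?Z"
    using f Hom_PiE[OF f] unfolding Hom_def by (auto simp: c o)
  moreover have "kernel_module A f ?Z = kernel_module A f B" "kernel_of A f ?Z = kernel_of A f B"
    by (simp_all add: kernel_module_def kernel_of_def)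
  ultimately show ?thesis
    using ses_kernel[of f A ?Z] kernel_Mod[OF g M(2,3)] M c by simp
qed

section \<open>Projective resolutions and the vanishing of the Ext groups\<close>

lemma proj_resolution_exists:
  assumes "X \<in> Mods"
  shows "\<exists>Pd. proj_resolution R U X Pd"
proof -
  have step: "\<exists>y M'. (case y of (j, P, q) \<Rightarrow> P \<in> Proj R U \<and> ses M' j P q M) \<and> M' \<in> Mods" if M: "M \<in> Mods" for M
  proof -
    obtain K j P q where "P \<in> Proj R U" "ses K j P q M" by (rule syzygy[OF M])
    then show ?thesis using sesD(1) by (intro exI[of _ "(j, P, q)"] exI[of _ K]) auto
  qed
  obtain T y where T: "T 0 = X" "\<And>n. case y n of (j, P, q) \<Rightarrow> P \<in> Proj R U \<and> ses (T (Suc n)) j P q (T n)"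
    by (rule nat_chain[where Q = "\<lambda>M. M \<in> Mods"
          and S = "\<lambda>M y M'. case y of (j, P, q) \<Rightarrow> P \<in> Proj R U \<and> ses M' j P q M", OF assms step])
      (assumption, rule that)
  define j P q where "j n = fst (y n)" and "P n = fst (snd (y n))" and "q n = snd (snd (y n))" for n
  have P: "P n \<in> Proj R U" "ses (T (Suc n)) (j n) (P n) (q n) (T n)" for n
    using T(2)[of n] by (auto simp: j_def P_def q_def split: prod.splits)
  \<comment> \<open>The augmentation is kept as it is; each later differential is spliced through
    the syzygy between two neighbouring projectives.\<close>
  define d where "d n = (case n of 0 \<Rightarrow> q 0 | Suc m \<Rightarrow> compose (carrier (P n)) (j m) (q n))" for n
  note D = sesD[OF P(2)]
  have d0: "d 0 = q 0" and dS: "d (Suc n) = compose (carrier (P (Suc n))) (j n) (q (Suc n))" for n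
    by (simp_all add: d_def)
  have im: "d (Suc n) ` carrier (P (Suc n)) = j n ` carrier (T (Suc n))" for n
  proof -
    have "d (Suc n) ` carrier (P (Suc n)) = j n ` (q (Suc n) ` carrier (P (Suc n)))"
      by (auto simp: dS image_image)
    then show ?thesis using D(7)[of "Suc n"] by simp
  qed
  have ker: "kernel_of (P (Suc n)) (d (Suc n)) N = {x \<in> carrier (P (Suc n)). q (Suc n) x = \<zero>\<^bsub>T (Suc n)\<^esub>}"
    if N: "\<zero>\<^bsub>N\<^esub> = \<zero>\<^bsub>P n\<^esub>" for N n
  proof -
    have "j n (q (Suc n) x) = \<zero>\<^bsub>P n\<^esub> \<longleftrightarrow> q (Suc n) x = \<zero>\<^bsub>T (Suc n)\<^esub>" if "x \<in> carrier (P (Suc n))" for x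
      using ses_inj_0[OF P(2)[of n] Hom_closed[OF D(5)[of "Suc n"] that]] Hom_zero[OF D(4)[of n] D(1)[of n] D(2)[of n]]
      by auto
    then show ?thesis by (auto simp: kernel_of_def dS N Hom_zero[OF D(4) D(1) D(2)])
  qed
  have "proj_resolution R U X (P, d)"
    unfolding proj_resolution_def prod.case
  proof (intro conjI allI)
    show "P n \<in> Proj R U" for n by (rule P(1))
    show "d 0 \<in> Hom R (P 0) X" "d 0 ` carrier (P 0) = carrier X" using D(5,7)[of 0] by (simp_all add: d0 T(1))
    show "d (Suc n) \<in> Hom R (P (Suc n)) (P n)" for n
      unfolding dS by (rule Hom_compose[OF D(5) D(4) D(2)])
    show "exact_at (P (Suc 0)) (d (Suc 0)) (P 0) (d 0) X"
      using im[of 0] D(8)[of 0] by (simp add: exact_at_def kernel_of_def d0 T(1))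
    show "exact_at (P (Suc (Suc n))) (d (Suc (Suc n))) (P (Suc n)) (d (Suc n)) (P n)" for n
      unfolding exact_at_def im ker[OF refl] by (rule D(8))
  qed
  then show ?thesis by blast
qed

text \<open>A cocycle on \<open>P (Suc m)\<close> kills the next cycles, so it is a map on the
  kernel \<open>Z m\<close> of \<open>d m\<close>; it is a coboundary exactly when that map extends
  to \<open>P m\<close>. The extension property for all such maps is \<open>orth\<close> of the
  image of \<open>d m\<close>, an m-th syzygy of \<open>X\<close>.\<close>

lemma ext_zero_iff_cocycles:
  assumes X: "X \<in> Mods" and N: "N \<in> Mods" and res: "proj_resolution R U X Pd"
  shows "ext_zero m X N \<longleftrightarrow> cocycles R Pd (Suc m) N \<subseteq> coboundaries R Pd (Suc m) N"
proof -
  obtain P d where Pd: "Pd = (P, d)" by (cases Pd)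
  note r = res[unfolded Pd proj_resolution_def prod.case]
  have P: "P n \<in> Proj R U" for n using r by blast
  have PM: "P n \<in> Mods" for n by (rule Proj_Mods[OF P])
  \<comment> \<open>The target of \<open>d n\<close>, which lets the augmentation and the
    differentials be treated uniformly.\<close>
  define T where "T n = (case n of 0 \<Rightarrow> X | Suc k \<Rightarrow> P k)" for n
  define Z where "Z n = kernel_module (P n) (d n) (T n)" for n
  \<comment> \<open>The image of \<open>d n\<close>: all of \<open>X\<close> for the augmentation,
    and by exactness the preceding kernel otherwise.\<close>
  define Im where "Im n = (case n of 0 \<Rightarrow> X | Suc k \<Rightarrow> Z k)" for n
  have dH: "d n \<in> Hom R (P n) (T n)" for n using r by (cases n) (auto simp: T_def)
  have TM: "T n \<in> Mods" for n using X PM by (cases n) (auto simp: T_def)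
  have ex: "exact_at (P (Suc n)) (d (Suc n)) (P n) (d n) (T n)" for n
    using r by (cases n) (auto simp: T_def)
  define inc where "inc n = (\<lambda>x\<in>kernel_of (P n) (d n) (T n). x)" for n
  have Zc: "carrier (Z n) = kernel_of (P n) (d n) (T n)" for n by (simp add: Z_def kernel_module_def)
  have S: "ses (Z n) (inc n) (P n) (d n) (Im n)" for n
  proof (cases n)
    case 0
    have "d 0 ` carrier (P 0) = carrier X" using r by blast
    then show ?thesis using ses_kernel[OF dH[of 0] PM TM] by (simp add: 0 Z_def inc_def Im_def T_def)
  next
    case (Suc k)
    show ?thesis
      using ses_kernel_exact[OF _ dH[of k] PM PM TM ex[of k]] dH[of "Suc k"]
      by (simp add: Suc Z_def inc_def Im_def T_def)
  qed
  note D = sesD[OF S]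
  have shift: "ext_zero m (Im k) N \<longleftrightarrow> orth (Im (k + m)) N" for k m
  proof (induction m arbitrary: k)
    case (Suc m)
    have "ext_zero (Suc m) (Im k) N \<longleftrightarrow> ext_zero m (Im (Suc k)) N"
      using ext_zero_syzygy[OF N S P] by (simp add: Im_def)
    then show ?case using Suc.IH[of "Suc k"] by simp
  qed simp
  have ImS: "Im (Suc m) = Z m" by (simp add: Im_def)
  have coc: "\<phi> \<in> cocycles R Pd (Suc m) N \<longleftrightarrow> \<phi> \<in> Hom R (P (Suc m)) N \<and>
      (\<forall>x\<in>carrier (Z (Suc m)). \<phi> (inc (Suc m) x) = \<zero>\<^bsub>N\<^esub>)" for \<phi>
  proof -
    have "carrier (Z (Suc m)) = d (Suc (Suc m)) ` carrier (P (Suc (Suc m)))"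
      using ex[of "Suc m"] by (simp add: Zc exact_at_def)
    then have "(\<forall>x\<in>carrier (Z (Suc m)). \<phi> (inc (Suc m) x) = \<zero>\<^bsub>N\<^esub>) \<longleftrightarrow>
      (\<forall>x\<in>carrier (P (Suc (Suc m))). \<phi> (d (Suc (Suc m)) x) = \<zero>\<^bsub>N\<^esub>)"
      by (simp add: inc_def Zc[symmetric])
    also have "\<dots> \<longleftrightarrow> compose (carrier (P (Suc (Suc m)))) \<phi> (d (Suc (Suc m))) = (\<lambda>x\<in>carrier (P (Suc (Suc m))). \<zero>\<^bsub>N\<^esub>)"
      by (auto simp: compose_def fun_eq_iff)
    finally show ?thesis by (simp add: cocycles_def Pd)
  qed
  have cob: "\<phi> \<in> coboundaries R Pd (Suc m) N \<longleftrightarrow> (\<exists>\<psi>\<in>Hom R (P m) N. \<phi> = compose (carrier (P (Suc m))) \<psi> (d (Suc m)))" for \<phi>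
    by (auto simp: coboundaries_def Pd)
  have dinc: "inc m (d (Suc m) x) = d (Suc m) x" "d (Suc m) x \<in> carrier (Z m)" if "x \<in> carrier (P (Suc m))" for x
    using Hom_closed[OF D(5)[of "Suc m"] that] by (simp_all add: inc_def Zc ImS)
  have "orth (Im m) N \<longleftrightarrow> cocycles R Pd (Suc m) N \<subseteq> coboundaries R Pd (Suc m) N"
  proof
    assume o: "orth (Im m) N"
    show "cocycles R Pd (Suc m) N \<subseteq> coboundaries R Pd (Suc m) N"
    proof
      fix \<phi> assume "\<phi> \<in> cocycles R Pd (Suc m) N"
      then have \<phi>: "\<phi> \<in> Hom R (P (Suc m)) N" "\<And>x. x \<in> carrier (Z (Suc m)) \<Longrightarrow> \<phi> (inc (Suc m) x) = \<zero>\<^bsub>N\<^esub>"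
        by (simp_all add: coc)
      obtain f where f: "f \<in> Hom R (Z m) N" "\<And>x. x \<in> carrier (P (Suc m)) \<Longrightarrow> f (d (Suc m) x) = \<phi> x"
        by (rule ses_factor_right[OF S[of "Suc m", unfolded ImS] \<phi>(1) N \<phi>(2)]) (assumption, rule that)
      obtain \<psi> where \<psi>: "\<psi> \<in> Hom R (P m) N" "\<And>x. x \<in> carrier (Z m) \<Longrightarrow> \<psi> (inc m x) = f x"
        by (rule orth_extend[OF o S f(1)]) (rule that)
      have "\<psi> (d (Suc m) x) = \<phi> x" if x: "x \<in> carrier (P (Suc m))" for x
        using \<psi>(2)[OF dinc(2)[OF x]] by (simp add: dinc(1)[OF x] f(2)[OF x])
      moreover have "compose (carrier (P (Suc m))) \<psi> (d (Suc m)) \<in> Hom R (P (Suc m)) N"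
        using Hom_compose[OF _ \<psi>(1) PM] dH[of "Suc m"] by (simp add: T_def)
      ultimately have "\<phi> = compose (carrier (P (Suc m))) \<psi> (d (Suc m))"
        by (intro Hom_eqI[OF \<phi>(1)]) simp_all
      then show "\<phi> \<in> coboundaries R Pd (Suc m) N" using \<psi>(1) by (auto simp: cob)
    qed
  next
    assume sub: "cocycles R Pd (Suc m) N \<subseteq> coboundaries R Pd (Suc m) N"
    show "orth (Im m) N"
    proof (rule orthI_proj[OF S P N])
      fix f assume f: "f \<in> Hom R (Z m) N"
      obtain \<phi> where \<phi>: "\<phi> \<in> Hom R (P (Suc m)) N" "\<And>x. x \<in> carrier (P (Suc m)) \<Longrightarrow> \<phi> x = f (d (Suc m) x)"
        by (rule Hom_comp[OF D(5)[of "Suc m", unfolded ImS] f PM]) (rule that)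
      have "\<phi> \<in> cocycles R Pd (Suc m) N"
        unfolding coc
        using \<phi>(1) ses_zero[OF S[of "Suc m", unfolded ImS]] Hom_closed[OF D(4)] Hom_zero[OF f D(1) N]
        by (simp add: \<phi>(2))
      then obtain \<psi> where \<psi>: "\<psi> \<in> Hom R (P m) N" "\<phi> = compose (carrier (P (Suc m))) \<psi> (d (Suc m))"
        using sub cob by blast
      have "\<psi> (inc m z) = f z" if z: "z \<in> carrier (Z m)" for z
      proof -
        obtain x where x: "x \<in> carrier (P (Suc m))" "d (Suc m) x = z"
          using ses_surj[OF S[of "Suc m", unfolded ImS] z] by blast
        have "\<psi> (d (Suc m) x) = f (d (Suc m) x)" using fun_cong[OF \<psi>(2), of x] x(1) by (simp add: \<phi>(2))
        then show ?thesis using dinc(1)[OF x(1)] x(2) by simp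
      qed
      then show "\<exists>h\<in>Hom R (P m) N. \<forall>k\<in>carrier (Z m). h (inc m k) = f k" using \<psi>(1) by blast
    qed
  qed
  then show ?thesis using shift[of m 0] by (simp add: Im_def)
qed

text \<open>The factor group is trivial iff every cocycle is a coboundary, once the cocycles are
  known to form a group with the coboundaries as a subgroup. The right-hand side mentions no
  resolution, so the one chosen inside \<open>Ext\<close> drops out of all later arguments.\<close>

lemma trivial_Ext_iff:
  assumes X: "X \<in> Mods" and N: "N \<in> Mods"
  shows "trivial_group (Ext R U (Suc m) X N) \<longleftrightarrow> ext_zero m X N"
proof -
  define Pd where "Pd = (SOME Pd. proj_resolution R U X Pd)"
  have res: "proj_resolution R U X Pd"
    unfolding Pd_def by (rule someI_ex[OF proj_resolution_exists[OF X]])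
  obtain P d where P: "Pd = (P, d)" by (cases Pd)
  have PM: "P n \<in> Mods" for n using res by (auto simp: P proj_resolution_def Proj_Mods)
  have dH: "d (Suc n) \<in> Hom R (P (Suc n)) (P n)" for n using res by (auto simp: P proj_resolution_def)
  let ?n = "Suc m"
  define G where "G = Hom_group R (P ?n) N \<lparr>carrier := cocycles R Pd ?n N\<rparr>"
  define H where "H = coboundaries R Pd ?n N"
  have Ext: "Ext R U ?n X N = G Mod H"
    by (simp add: Ext_def Let_def G_def H_def P flip: Pd_def)
  have Gc: "f \<in> carrier G \<longleftrightarrow> f \<in> Hom R (P ?n) N \<and> (\<forall>x\<in>carrier (P (Suc ?n)). f (d (Suc ?n) x) = \<zero>\<^bsub>N\<^esub>)" for f
    by (auto simp: G_def cocycles_def P compose_def fun_eq_iff)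
  have Gm: "f \<otimes>\<^bsub>G\<^esub> g = (\<lambda>x\<in>carrier (P ?n). f x \<oplus>\<^bsub>N\<^esub> g x)" and Go: "\<one>\<^bsub>G\<^esub> = (\<lambda>x\<in>carrier (P ?n). \<zero>\<^bsub>N\<^esub>)" for f g
    by (simp_all add: G_def Hom_group_def)
  have Hm: "f \<in> H \<longleftrightarrow> (\<exists>\<psi>\<in>Hom R (P m) N. f = compose (carrier (P ?n)) \<psi> (d ?n))" for f
    by (auto simp: H_def coboundaries_def P)
  have dcl: "d (Suc ?n) x \<in> carrier (P ?n)" if "x \<in> carrier (P (Suc ?n))" for x
    using Hom_closed[OF dH that] .
  have v: "f x \<in> carrier N" if "f \<in> carrier G" "x \<in> carrier (P ?n)" for f x
    by (rule Hom_closed[OF _ that(2)]) (use that(1) in \<open>simp add: Gc\<close>)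
  have sumH: "(\<lambda>x\<in>carrier (P k). f x \<oplus>\<^bsub>N\<^esub> g x) \<in> Hom R (P k) N" if fg: "f \<in> Hom R (P k) N" "g \<in> Hom R (P k) N" for f g k
    by (rule Hom_restrict) (use fg N PM in \<open>auto simp: mod_ac mod_smult_add\<close>)
  have negH: "(\<lambda>x\<in>carrier (P k). \<zero>\<^bsub>N\<^esub> \<ominus>\<^bsub>N\<^esub> f x) \<in> Hom R (P k) N" if f: "f \<in> Hom R (P k) N" for f k
  proof -
    obtain h where h: "h \<in> Hom R (P k) N" "\<And>x. x \<in> carrier (P k) \<Longrightarrow> h x = (\<lambda>x\<in>carrier (P k). \<zero>\<^bsub>N\<^esub>) x \<ominus>\<^bsub>N\<^esub> f x"
      using Hom_diff[OF Hom_0[OF PM N] f PM N] by blast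
    have "(\<lambda>x\<in>carrier (P k). \<zero>\<^bsub>N\<^esub> \<ominus>\<^bsub>N\<^esub> f x) = h"
      using Hom_PiE[OF h(1)] by (intro extensionalityI[of _ "carrier (P k)"]) (auto simp: h(2) PiE_def)
    then show ?thesis using h(1) by simp
  qed
  have mc: "f \<otimes>\<^bsub>G\<^esub> g \<in> carrier G" if "f \<in> carrier G" "g \<in> carrier G" for f g
    using that sumH N unfolding Gm Gc by (simp add: dcl)
  have oc: "\<one>\<^bsub>G\<^esub> \<in> carrier G" unfolding Go Gc using Hom_0[OF PM N] by (simp add: dcl)
  have ge: "f = g" if "f \<in> carrier G" "g \<in> carrier G" "\<And>x. x \<in> carrier (P ?n) \<Longrightarrow> f x = g x" for f g
    using that unfolding Gc by (intro Hom_eqI[of f "P ?n" N g]) simp_all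
  have "comm_group G"
  proof (rule comm_groupI)
    fix x y z assume *: "x \<in> carrier G" "y \<in> carrier G" "z \<in> carrier G"
    show "x \<otimes>\<^bsub>G\<^esub> y \<otimes>\<^bsub>G\<^esub> z = x \<otimes>\<^bsub>G\<^esub> (y \<otimes>\<^bsub>G\<^esub> z)"
      by (rule ge[OF mc[OF mc[OF *(1,2)] *(3)] mc[OF *(1) mc[OF *(2,3)]]])
        (use * in \<open>simp add: Gm v mod_assoc[OF N]\<close>)
  next
    fix x y assume *: "x \<in> carrier G" "y \<in> carrier G"
    show "x \<otimes>\<^bsub>G\<^esub> y = y \<otimes>\<^bsub>G\<^esub> x"
      by (rule ge[OF mc[OF *] mc[OF *(2,1)]]) (use * in \<open>simp add: Gm v mod_comm[OF N]\<close>)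
  next
    fix x assume *: "x \<in> carrier G"
    show "\<one>\<^bsub>G\<^esub> \<otimes>\<^bsub>G\<^esub> x = x"
      by (rule ge[OF mc[OF oc *] *]) (use * N in \<open>simp add: Gm Go v\<close>)
    have n: "(\<lambda>y\<in>carrier (P ?n). \<zero>\<^bsub>N\<^esub> \<ominus>\<^bsub>N\<^esub> x y) \<in> carrier G"
      using * negH N unfolding Gc by (simp add: dcl)
    have "(\<lambda>y\<in>carrier (P ?n). \<zero>\<^bsub>N\<^esub> \<ominus>\<^bsub>N\<^esub> x y) \<otimes>\<^bsub>G\<^esub> x = \<one>\<^bsub>G\<^esub>"
      by (rule ge[OF mc[OF n *] oc]) (use * N in \<open>simp add: Gm Go v\<close>)
    then show "\<exists>y\<in>carrier G. y \<otimes>\<^bsub>G\<^esub> x = \<one>\<^bsub>G\<^esub>" using n by blast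
  qed (rule mc oc; assumption?)+
  then interpret G: comm_group G .
  have cz: "\<psi> (d ?n (d (Suc ?n) x)) = \<zero>\<^bsub>N\<^esub>" if "x \<in> carrier (P (Suc ?n))" "\<psi> \<in> Hom R (P m) N" for x \<psi>
  proof -
    have "exact_at (P (Suc (Suc m))) (d (Suc (Suc m))) (P (Suc m)) (d (Suc m)) (P m)"
      using res by (auto simp: P proj_resolution_def)
    then have "d (Suc ?n) x \<in> kernel_of (P ?n) (d ?n) (P m)" using that(1) unfolding exact_at_def by blast
    then show ?thesis using Hom_zero[OF that(2) PM N] by (simp add: kernel_of_def)
  qed
  have HG: "H \<subseteq> carrier G"
  proof
    fix f assume "f \<in> H"
    then obtain \<psi> where \<psi>: "\<psi> \<in> Hom R (P m) N" "f = compose (carrier (P ?n)) \<psi> (d ?n)" by (auto simp: Hm)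
    then show "f \<in> carrier G" using Hom_compose[OF dH \<psi>(1) PM] cz[OF _ \<psi>(1)] by (simp add: Gc dcl)
  qed
  have sub: "subgroup H G"
  proof (rule G.subgroupI[OF HG])
    have "compose (carrier (P ?n)) (\<lambda>x\<in>carrier (P m). \<zero>\<^bsub>N\<^esub>) (d ?n) \<in> H"
      using Hom_0[OF PM N] by (auto simp: Hm)
    then show "H \<noteq> {}" by blast
  next
    fix f assume "f \<in> H"
    then obtain \<psi> where \<psi>: "\<psi> \<in> Hom R (P m) N" "f = compose (carrier (P ?n)) \<psi> (d ?n)" by (auto simp: Hm)
    have fG: "f \<in> carrier G" using HG \<open>f \<in> H\<close> by blast
    let ?g = "compose (carrier (P ?n)) (\<lambda>x\<in>carrier (P m). \<zero>\<^bsub>N\<^esub> \<ominus>\<^bsub>N\<^esub> \<psi> x) (d ?n)"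
    have g: "?g \<in> H" using negH[OF \<psi>(1)] by (auto simp: Hm)
    then have gG: "?g \<in> carrier G" using HG by blast
    have "?g \<otimes>\<^bsub>G\<^esub> f = \<one>\<^bsub>G\<^esub>"
      by (rule ge[OF mc[OF gG fG] oc])
        (use Hom_closed[OF dH] Hom_closed[OF \<psi>(1)] N in \<open>simp add: Gm Go \<psi>(2)\<close>)
    then have "inv\<^bsub>G\<^esub> f = ?g" using G.inv_equality fG gG by blast
    then show "inv\<^bsub>G\<^esub> f \<in> H" using g by simp
  next
    fix f g assume "f \<in> H" "g \<in> H"
    then obtain \<psi> \<chi> where \<psi>: "\<psi> \<in> Hom R (P m) N" "f = compose (carrier (P ?n)) \<psi> (d ?n)"
      "\<chi> \<in> Hom R (P m) N" "g = compose (carrier (P ?n)) \<chi> (d ?n)" by (auto simp: Hm)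
    have "f \<otimes>\<^bsub>G\<^esub> g = compose (carrier (P ?n)) (\<lambda>x\<in>carrier (P m). \<psi> x \<oplus>\<^bsub>N\<^esub> \<chi> x) (d ?n)"
      using Hom_closed[OF dH] by (auto simp: Gm \<psi> compose_def fun_eq_iff)
    then show "f \<otimes>\<^bsub>G\<^esub> g \<in> H" using sumH[OF \<psi>(1,3)] by (auto simp: Hm)
  qed
  have "trivial_group (G Mod H) \<longleftrightarrow> carrier G \<subseteq> H"
  proof
    assume t: "trivial_group (G Mod H)"
    show "carrier G \<subseteq> H"
    proof
      fix f assume f: "f \<in> carrier G"
      have "H #>\<^bsub>G\<^esub> f \<in> carrier (G Mod H)" using f by (auto simp: FactGroup_def RCOSETS_def)
      then have "H #>\<^bsub>G\<^esub> f = H" using t by (simp add: trivial_group_def FactGroup_def)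
      then show "f \<in> H" using G.rcos_self[OF f sub] by simp
    qed
  next
    assume "carrier G \<subseteq> H"
    then have "H #>\<^bsub>G\<^esub> f = H" if "f \<in> carrier G" for f using that G.coset_join2[OF that sub] by blast
    then have "carrier (G Mod H) = {H}" using oc by (auto simp: FactGroup_def RCOSETS_def)
    then show "trivial_group (G Mod H)"
      using normal.factorgroup_is_group[OF G.subgroup_imp_normal[OF sub]]
      by (simp add: trivial_group_def FactGroup_def)
  qed
  also have "carrier G = cocycles R Pd ?n N" by (simp add: G_def)
  finally show ?thesis using ext_zero_iff_cocycles[OF X N res, of m] by (simp add: Ext H_def)
qed

section \<open>Dimensions\<close>

text \<open>A recursive form of the exact sequences in the dimensions, suited to induction on
  length: one term is peeled off next to \<open>M\<close>. Length 0 is 0 -> M -> D -> 0, hence an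
  isomorphism and not an equality.\<close>

primrec coresolved :: "('r, 'm) module set \<Rightarrow> nat \<Rightarrow> ('r, 'm) module \<Rightarrow> bool" where
  "coresolved \<C> 0 M \<longleftrightarrow> (\<exists>D\<in>\<C>. isomorphic_modules R M D)"
| "coresolved \<C> (Suc k) M \<longleftrightarrow> (\<exists>D\<in>\<C>. \<exists>L i p. ses M i D p L \<and> coresolved \<C> k L)"

primrec resolved :: "nat \<Rightarrow> ('r, 'm) module \<Rightarrow> bool" where
  "resolved 0 X \<longleftrightarrow> (\<exists>P\<in>Proj R U. isomorphic_modules R P X)"
| "resolved (Suc k) X \<longleftrightarrow> (\<exists>P\<in>Proj R U. \<exists>K i p. ses K i P p X \<and> resolved k K)"

text \<open>A long sequence is cut at the cokernel of its first map, which embeds in the term after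
  next; conversely a short sequence is spliced on at the left.\<close>

lemma coresolved_exact_sequence:
  assumes C: "\<C> \<subseteq> Mods" and "M \<in> Mods"
  shows "(\<exists>Y d. exact_sequence R k Y d \<and> Y 0 = M \<and> (\<forall>j\<le>k. Y (Suc j) \<in> \<C>)) \<longleftrightarrow> coresolved \<C> k M"
  using assms(2)
proof (induction k arbitrary: M)
  case 0
  show ?case
  proof
    assume "\<exists>Y d. exact_sequence R 0 Y d \<and> Y 0 = M \<and> (\<forall>j\<le>0. Y (Suc j) \<in> \<C>)"
    then show "coresolved \<C> 0 M"
      by (auto simp: exact_sequence_def isomorphic_modules_def bij_betw_def)
  next
    assume "coresolved \<C> 0 M"
    then obtain D f where "D \<in> \<C>" "f \<in> Hom R M D" "bij_betw f (carrier M) (carrier D)"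
      by (auto simp: isomorphic_modules_def)
    then show "\<exists>Y d. exact_sequence R 0 Y d \<and> Y 0 = M \<and> (\<forall>j\<le>0. Y (Suc j) \<in> \<C>)"
      by (intro exI[of _ "case_nat M (\<lambda>_. D)"] exI[of _ "\<lambda>_. f"])
        (auto simp: exact_sequence_def bij_betw_def)
  qed
next
  case (Suc k)
  show ?case
  proof
    assume "\<exists>Y d. exact_sequence R (Suc k) Y d \<and> Y 0 = M \<and> (\<forall>j\<le>Suc k. Y (Suc j) \<in> \<C>)"
    then obtain Y d where Y: "exact_sequence R (Suc k) Y d" "Y 0 = M" "\<And>j. j \<le> Suc k \<Longrightarrow> Y (Suc j) \<in> \<C>"
      by blast
    have d: "\<And>j. j \<le> Suc k \<Longrightarrow> d j \<in> Hom R (Y j) (Y (Suc j))" "inj_on (d 0) (carrier (Y 0))"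
      "\<And>j. j \<le> k \<Longrightarrow> exact_at (Y j) (d j) (Y (Suc j)) (d (Suc j)) (Y (Suc (Suc j)))"
      "d (Suc k) ` carrier (Y (Suc k)) = carrier (Y (Suc (Suc k)))"
      using Y(1) by (auto simp: exact_sequence_def less_Suc_eq_le)
    have Y1: "Y (Suc 0) \<in> Mods" "Y (Suc (Suc 0)) \<in> Mods" using Y(3)[of 0] Y(3)[of 1] C by auto
    have d0: "d 0 \<in> Hom R M (Y (Suc 0))" "d (Suc 0) \<in> Hom R (Y (Suc 0)) (Y (Suc (Suc 0)))"
      using d(1)[of 0] d(1)[of "Suc 0"] Y(2) by simp_all
    have e0: "d 0 ` carrier M = {y \<in> carrier (Y (Suc 0)). d (Suc 0) y = \<zero>\<^bsub>Y (Suc (Suc 0))\<^esub>}"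
      using d(3)[of 0] Y(2) by (simp add: exact_at_def kernel_of_def)
    obtain L p where L: "ses M (d 0) (Y (Suc 0)) p L"
      by (rule cokernel_ses[OF d0(1) Suc.prems Y1(1)]) (use d(2) Y(2) in auto)
    note Ld = sesD[OF L]
    \<comment> \<open>The second differential kills the image of the first, so it descends to the
      cokernel \<open>L\<close>; exactness makes the induced map injective.\<close>
    obtain e where e: "e \<in> Hom R L (Y (Suc (Suc 0)))" "\<And>x. x \<in> carrier (Y (Suc 0)) \<Longrightarrow> e (p x) = d (Suc 0) x"
    proof (rule ses_factor_right[OF L d0(2) Y1(2)])
      fix x assume "x \<in> carrier M"
      then show "d (Suc 0) (d 0 x) = \<zero>\<^bsub>Y (Suc (Suc 0))\<^esub>" using e0 by blast
    qed (rule that)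
    have ei: "inj_on e (carrier L)"
    proof (rule Hom_inj_onI[OF e(1) Ld(3) Y1(2)])
      fix x assume x: "x \<in> carrier L" "e x = \<zero>\<^bsub>Y (Suc (Suc 0))\<^esub>"
      obtain y where y: "y \<in> carrier (Y (Suc 0))" "p y = x" using ses_surj[OF L x(1)] by blast
      then have "y \<in> d 0 ` carrier M" using e0 x(2) e(2) by auto
      then show "x = \<zero>\<^bsub>L\<^esub>" using ses_zero[OF L] y(2) by auto
    qed
    have eim: "e ` carrier L = d (Suc 0) ` carrier (Y (Suc 0))"
    proof -
      have "e ` (p ` carrier (Y (Suc 0))) = d (Suc 0) ` carrier (Y (Suc 0))"
        using e(2) by (auto simp: image_image)
      then show ?thesis using Ld(7) by simp
    qed
    let ?Y = "case_nat L (\<lambda>j. Y (Suc (Suc j)))" and ?d = "case_nat e (\<lambda>j. d (Suc (Suc j)))"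
    have "exact_sequence R k ?Y ?d"
      unfolding exact_sequence_def
    proof (intro conjI allI impI)
      show "?d j \<in> Hom R (?Y j) (?Y (Suc j))" if "j \<le> k" for j
        using that e(1) d(1) by (cases j) auto
      show "inj_on (?d 0) (carrier (?Y 0))" using ei by simp
      show "exact_at (?Y j) (?d j) (?Y (Suc j)) (?d (Suc j)) (?Y (Suc (Suc j)))" if "j < k" for j
        using that d(3)[of "Suc j"] eim by (cases j) (auto simp: exact_at_def)
      show "?d k ` carrier (?Y k) = carrier (?Y (Suc k))"
        using d(4) eim by (cases k) auto
    qed
    then have "coresolved \<C> k L"
      using Suc.IH[OF Ld(3)] Y(3) by (metis (no_types, lifting) Suc_le_mono old.nat.simps(4,5))
    then show "coresolved \<C> (Suc k) M" using L Y(3)[of 0] by auto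
  next
    assume "coresolved \<C> (Suc k) M"
    then obtain D L i p where D: "D \<in> \<C>" "ses M i D p L" "coresolved \<C> k L" by auto
    note Dd = sesD[OF D(2)]
    obtain Y d where Y: "exact_sequence R k Y d" "Y 0 = L" "\<And>j. j \<le> k \<Longrightarrow> Y (Suc j) \<in> \<C>"
      using Suc.IH[OF Dd(3)] D(3) by blast
    have d: "\<And>j. j \<le> k \<Longrightarrow> d j \<in> Hom R (Y j) (Y (Suc j))" "inj_on (d 0) (carrier (Y 0))"
      "\<And>j. j < k \<Longrightarrow> exact_at (Y j) (d j) (Y (Suc j)) (d (Suc j)) (Y (Suc (Suc j)))"
      "d k ` carrier (Y k) = carrier (Y (Suc k))"
      using Y(1) by (auto simp: exact_sequence_def)
    have d0: "d 0 \<in> Hom R L (Y (Suc 0))" using d(1)[of 0] Y(2) by simp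
    have Y1: "Y (Suc 0) \<in> Mods" using Y(3)[of 0] C by auto
    \<comment> \<open>The spliced map has the kernel of \<open>p\<close>, since \<open>d 0\<close>
      is injective, and the image of \<open>d 0\<close>, since \<open>p\<close> is onto.\<close>
    let ?c = "compose (carrier D) (d 0) p"
    have c: "?c \<in> Hom R D (Y (Suc 0))" by (rule Hom_compose[OF Dd(5) d0 Dd(2)])
    have cim: "?c ` carrier D = d 0 ` carrier L"
    proof -
      have "?c ` carrier D = d 0 ` (p ` carrier D)" by (auto simp: image_image)
      then show ?thesis using Dd(7) by simp
    qed
    have cker: "?c x = \<zero>\<^bsub>Y (Suc 0)\<^esub> \<longleftrightarrow> p x = \<zero>\<^bsub>L\<^esub>" if x: "x \<in> carrier D" for x
      using inj_onD[OF d(2), of "p x" "\<zero>\<^bsub>L\<^esub>"] Hom_zero[OF d0 Dd(3) Y1] Hom_closed[OF Dd(5) x] Dd(3) x Y(2)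
      by auto
    let ?Y = "case_nat M (case_nat D (\<lambda>j. Y (Suc j)))" and ?d = "case_nat i (case_nat ?c (\<lambda>j. d (Suc j)))"
    have "exact_sequence R (Suc k) ?Y ?d"
      unfolding exact_sequence_def
    proof (intro conjI allI impI)
      show "?d j \<in> Hom R (?Y j) (?Y (Suc j))" if "j \<le> Suc k" for j
        using that Dd(4) c d(1) by (auto split: nat.split)
      show "inj_on (?d 0) (carrier (?Y 0))" using Dd(6) by simp
      show "exact_at (?Y j) (?d j) (?Y (Suc j)) (?d (Suc j)) (?Y (Suc (Suc j)))" if j: "j < Suc k" for j
      proof (cases j)
        case 0
        then show ?thesis using Dd(8) cker Hom_zero[OF d0 Dd(3) Y1] by (auto simp: exact_at_def kernel_of_def)
      next
        case (Suc l)
        then show ?thesis using j d(3)[of l] cim Y(2) by (cases l) (auto simp: exact_at_def)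
      qed
      show "?d (Suc k) ` carrier (?Y (Suc k)) = carrier (?Y (Suc (Suc k)))"
        using d(4) cim Y(2) by (cases k) auto
    qed
    moreover have "\<forall>j\<le>Suc k. ?Y (Suc j) \<in> \<C>" using D(1) Y(3) by (auto split: nat.split)
    ultimately show "\<exists>Y d. exact_sequence R (Suc k) Y d \<and> Y 0 = M \<and> (\<forall>j\<le>Suc k. Y (Suc j) \<in> \<C>)"
      by (intro exI[of _ ?Y] exI[of _ ?d]) simp
  qed
qed

text \<open>The mirror image at the other end of the sequence: the kernel of the last map replaces
  the last two terms, and splicing happens at the highest indices.\<close>

lemma resolved_exact_sequence:
  assumes "X \<in> Mods"
  shows "(\<exists>Y d. exact_sequence R k Y d \<and> (\<forall>j\<le>k. Y j \<in> Proj R U) \<and> Y (Suc k) = X) \<longleftrightarrow> resolved k X"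
  using assms
proof (induction k arbitrary: X)
  case 0
  show ?case
  proof
    assume "\<exists>Y d. exact_sequence R 0 Y d \<and> (\<forall>j\<le>0. Y j \<in> Proj R U) \<and> Y (Suc 0) = X"
    then show "resolved 0 X"
      by (auto simp: exact_sequence_def isomorphic_modules_def bij_betw_def)
  next
    assume "resolved 0 X"
    then obtain P f where "P \<in> Proj R U" "f \<in> Hom R P X" "bij_betw f (carrier P) (carrier X)"
      by (auto simp: isomorphic_modules_def)
    then show "\<exists>Y d. exact_sequence R 0 Y d \<and> (\<forall>j\<le>0. Y j \<in> Proj R U) \<and> Y (Suc 0) = X"
      by (intro exI[of _ "case_nat P (\<lambda>_. X)"] exI[of _ "\<lambda>_. f"])
        (auto simp: exact_sequence_def bij_betw_def)
  qed
next
  case (Suc k)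
  show ?case
  proof
    assume "\<exists>Y d. exact_sequence R (Suc k) Y d \<and> (\<forall>j\<le>Suc k. Y j \<in> Proj R U) \<and> Y (Suc (Suc k)) = X"
    then obtain Y d where Y: "exact_sequence R (Suc k) Y d" "\<And>j. j \<le> Suc k \<Longrightarrow> Y j \<in> Proj R U" "Y (Suc (Suc k)) = X"
      by blast
    have d: "\<And>j. j \<le> Suc k \<Longrightarrow> d j \<in> Hom R (Y j) (Y (Suc j))" "inj_on (d 0) (carrier (Y 0))"
      "\<And>j. j \<le> k \<Longrightarrow> exact_at (Y j) (d j) (Y (Suc j)) (d (Suc j)) (Y (Suc (Suc j)))"
      "d (Suc k) ` carrier (Y (Suc k)) = carrier X"
      using Y(1,3) by (auto simp: exact_sequence_def less_Suc_eq_le)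
    have YM: "Y j \<in> Mods" if "j \<le> Suc k" for j by (rule Proj_Mods[OF Y(2)[OF that]])
    have dk: "d (Suc k) \<in> Hom R (Y (Suc k)) X" "d k \<in> Hom R (Y k) (Y (Suc k))"
      using d(1)[of "Suc k"] d(1)[of k] Y(3) by simp_all
    let ?K = "kernel_module (Y (Suc k)) (d (Suc k)) X"
    have K: "ses ?K (\<lambda>x\<in>kernel_of (Y (Suc k)) (d (Suc k)) X. x) (Y (Suc k)) (d (Suc k)) X"
      by (rule ses_kernel[OF dk(1) YM Suc.prems d(4)]) simp
    have ex: "exact_at (Y k) (d k) (Y (Suc k)) (d (Suc k)) X" using d(3)[of k] Y(3) by simp
    have Kc: "carrier ?K = d k ` carrier (Y k)" using ex by (simp add: kernel_module_def exact_at_def)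
    have dK: "d k \<in> Hom R (Y k) ?K"
      by (rule sesD(5)[OF ses_kernel_exact[OF dk(2,1) YM YM Suc.prems ex]]) simp_all
    have "\<exists>Y' d. exact_sequence R k Y' d \<and> (\<forall>j\<le>k. Y' j \<in> Proj R U) \<and> Y' (Suc k) = ?K"
    proof (intro exI conjI)
      show "exact_sequence R k (Y(Suc k := ?K)) d"
        unfolding exact_sequence_def
      proof (intro conjI allI impI)
        show "d j \<in> Hom R ((Y(Suc k := ?K)) j) ((Y(Suc k := ?K)) (Suc j))" if "j \<le> k" for j
          using that d(1)[of j] dK by auto
        show "inj_on (d 0) (carrier ((Y(Suc k := ?K)) 0))" using d(2) by simp
        show "exact_at ((Y(Suc k := ?K)) j) (d j) ((Y(Suc k := ?K)) (Suc j)) (d (Suc j)) ((Y(Suc k := ?K)) (Suc (Suc j)))"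
          if "j < k" for j
          using that d(3)[of j] by (auto simp: exact_at_def kernel_of_def kernel_module_def)
        show "d k ` carrier ((Y(Suc k := ?K)) k) = carrier ((Y(Suc k := ?K)) (Suc k))" using Kc by simp
      qed
    qed (use Y(2) in auto)
    then have "resolved k ?K" using Suc.IH[OF sesD(1)[OF K]] by blast
    then show "resolved (Suc k) X" using K Y(2)[of "Suc k"] by auto
  next
    assume "resolved (Suc k) X"
    then obtain P K i p where P: "P \<in> Proj R U" "ses K i P p X" "resolved k K" by auto
    note Pd = sesD[OF P(2)]
    obtain Y d where Y: "exact_sequence R k Y d" "\<And>j. j \<le> k \<Longrightarrow> Y j \<in> Proj R U" "Y (Suc k) = K"
      using Suc.IH[OF Pd(1)] P(3) by blast
    have d: "\<And>j. j \<le> k \<Longrightarrow> d j \<in> Hom R (Y j) (Y (Suc j))" "inj_on (d 0) (carrier (Y 0))"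
      "\<And>j. j < k \<Longrightarrow> exact_at (Y j) (d j) (Y (Suc j)) (d (Suc j)) (Y (Suc (Suc j)))"
      "d k ` carrier (Y k) = carrier K"
      using Y(1,3) by (auto simp: exact_sequence_def)
    have dk: "d k \<in> Hom R (Y k) K" using d(1)[of k] Y(3) by simp
    have Yk: "Y k \<in> Mods" by (rule Proj_Mods[OF Y(2)]) simp
    let ?c = "compose (carrier (Y k)) i (d k)"
    have c: "?c \<in> Hom R (Y k) P" by (rule Hom_compose[OF dk Pd(4) Yk])
    have cim: "?c ` carrier (Y k) = i ` carrier K"
    proof -
      have "?c ` carrier (Y k) = i ` (d k ` carrier (Y k))" by (auto simp: image_image)
      then show ?thesis using d(4) by simp
    qed
    have cinj: "?c x = ?c y \<longleftrightarrow> d k x = d k y" if "x \<in> carrier (Y k)" "y \<in> carrier (Y k)" for x y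
      using that ses_inj[OF P(2)] Hom_closed[OF dk] by auto
    have cker: "?c x = \<zero>\<^bsub>P\<^esub> \<longleftrightarrow> d k x = \<zero>\<^bsub>K\<^esub>" if x: "x \<in> carrier (Y k)" for x
      using ses_inj_0[OF P(2) Hom_closed[OF dk x]] Hom_zero[OF Pd(4,1,2)] x by auto
    \<comment> \<open>Indices up to \<open>k\<close> are kept, since the sequence grows at its right
      end: \<open>P\<close> and \<open>X\<close> follow at \<open>Suc k\<close> and
      \<open>Suc (Suc k)\<close>, and only the map at \<open>k\<close> is composed with the
      inclusion of \<open>K\<close>.\<close>
    let ?Y = "\<lambda>j. if j \<le> k then Y j else if j = Suc k then P else X"
    let ?d = "\<lambda>j. if j < k then d j else if j = k then ?c else p"
    have "exact_sequence R (Suc k) ?Y ?d"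
      unfolding exact_sequence_def
    proof (intro conjI allI impI)
      show "?d j \<in> Hom R (?Y j) (?Y (Suc j))" if "j \<le> Suc k" for j
        using that Pd(5) c d(1)[of j] by (auto simp: le_Suc_eq)
      show "inj_on (?d 0) (carrier (?Y 0))"
        using d(2) cinj inj_onD[OF d(2)] by (cases k) (auto simp: inj_on_def)
      show "exact_at (?Y j) (?d j) (?Y (Suc j)) (?d (Suc j)) (?Y (Suc (Suc j)))" if j: "j < Suc k" for j
      proof -
        consider "Suc j < k" | "Suc j = k" | "j = k" using j by linarith
        then show ?thesis
        proof cases
          case 1
          then show ?thesis using d(3)[of j] by (simp add: exact_at_def)
        next
          case 2
          have "exact_at (Y j) (d j) (Y (Suc j)) (d (Suc j)) (Y (Suc (Suc j)))" using d(3)[of j] 2 by simp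
          then have "d j ` carrier (Y j) = {x \<in> carrier (Y k). d k x = \<zero>\<^bsub>K\<^esub>}"
            using 2 Y(3) by (auto simp: exact_at_def kernel_of_def)
          then show ?thesis using 2 cker Hom_zero[OF Pd(4,1,2)] by (auto simp: exact_at_def kernel_of_def)
        next
          case 3
          then show ?thesis using cim Pd(8) by (simp add: exact_at_def kernel_of_def)
        qed
      qed
      show "?d (Suc k) ` carrier (?Y (Suc k)) = carrier (?Y (Suc (Suc k)))" using Pd(7) by simp
    qed
    moreover have "\<forall>j\<le>Suc k. ?Y j \<in> Proj R U" using P(1) Y(2) by (auto simp: le_Suc_eq)
    ultimately show "\<exists>Y d. exact_sequence R (Suc k) Y d \<and> (\<forall>j\<le>Suc k. Y j \<in> Proj R U) \<and> Y (Suc (Suc k)) = X"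
      by (intro exI[of _ ?Y] exI[of _ ?d]) simp
  qed
qed

lemma isomorphic_refl: "A \<in> Mods \<Longrightarrow> isomorphic_modules R A A"
  unfolding isomorphic_modules_def using Hom_id
  by (intro bexI[of _ "\<lambda>x\<in>carrier A. x"]) (auto simp: bij_betw_def)

lemma isomorphic_trans:
  assumes "isomorphic_modules R A B" "isomorphic_modules R B C" "A \<in> Mods"
  shows "isomorphic_modules R A C"
proof -
  obtain f g where f: "f \<in> Hom R A B" "bij_betw f (carrier A) (carrier B)"
    and g: "g \<in> Hom R B C" "bij_betw g (carrier B) (carrier C)"
    using assms by (auto simp: isomorphic_modules_def)
  have "bij_betw (compose (carrier A) g f) (carrier A) (carrier C)"
    using bij_betw_trans[OF f(2) g(2)] by (rule iffD1[OF bij_betw_cong, rotated]) simp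
  then show ?thesis using Hom_compose[OF f(1) g(1) assms(3)] unfolding isomorphic_modules_def by blast
qed

lemma ext_zero_iso:
  assumes "isomorphic_modules R M N" "M \<in> Mods" "N \<in> Mods" "X \<in> Mods" "ext_zero n X N"
  shows "ext_zero n X M"
proof -
  obtain f where f: "f \<in> Hom R M N" "bij_betw f (carrier M) (carrier N)"
    using assms(1) by (auto simp: isomorphic_modules_def)
  obtain g where g: "g \<in> Hom R N M" "\<And>x. x \<in> carrier N \<Longrightarrow> f (g x) = x" "\<And>x. x \<in> carrier M \<Longrightarrow> g (f x) = x"
    by (rule Hom_inverse[OF f assms(2,3)]) (rule that)
  show ?thesis by (rule ext_zero_retract[OF assms(2,3) f(1) g(1,3) assms(4,5)])
qed

lemma Proj_iso:
  assumes "isomorphic_modules R P X" "P \<in> Proj R U" "X \<in> Mods"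
  shows "X \<in> Proj R U"
proof (rule ProjI[OF assms(3)])
  note PM = Proj_Mods[OF assms(2)]
  obtain \<phi> where \<phi>: "\<phi> \<in> Hom R P X" "bij_betw \<phi> (carrier P) (carrier X)"
    using assms(1) by (auto simp: isomorphic_modules_def)
  obtain \<psi> where \<psi>: "\<psi> \<in> Hom R X P" "\<And>x. x \<in> carrier X \<Longrightarrow> \<phi> (\<psi> x) = x" "\<And>x. x \<in> carrier P \<Longrightarrow> \<psi> (\<phi> x) = x"
    by (rule Hom_inverse[OF \<phi> PM assms(3)]) (rule that)
  fix A B p f assume *: "A \<in> Mods" "B \<in> Mods" "p \<in> Hom R A B" "f \<in> Hom R X B" "p ` carrier A = carrier B"
  obtain f' where f': "f' \<in> Hom R P B" "\<And>x. x \<in> carrier P \<Longrightarrow> f' x = f (\<phi> x)"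
    by (rule Hom_comp[OF \<phi>(1) *(4) PM]) (rule that)
  obtain h where h: "h \<in> Hom R P A" "\<And>x. x \<in> carrier P \<Longrightarrow> p (h x) = f' x"
    by (rule Proj_lift[OF assms(2) *(1,2,3) f'(1) *(5)]) (rule that)
  obtain g where "g \<in> Hom R X A" "\<And>x. x \<in> carrier X \<Longrightarrow> g x = h (\<psi> x)"
    by (rule Hom_comp[OF \<psi>(1) h(1) assms(3)]) (rule that)
  then show "\<exists>g\<in>Hom R X A. \<forall>x\<in>carrier X. p (g x) = f x"
    using h(2) f'(2) \<psi>(2) Hom_closed[OF \<psi>(1)] by (intro bexI[of _ g]) simp_all
qed

lemma resolved_ext_zero: "\<lbrakk>resolved k X; X \<in> Mods; N \<in> Mods\<rbrakk> \<Longrightarrow> ext_zero k X N"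
proof (induction k arbitrary: X)
  case 0
  then obtain P where "P \<in> Proj R U" "isomorphic_modules R P X" by auto
  then show ?case using ext_zero_Proj[OF Proj_iso] 0 by blast
next
  case (Suc k)
  then obtain P K i p where "P \<in> Proj R U" "ses K i P p X" "resolved k K" by auto
  then show ?case using Suc.IH[OF _ sesD(1) Suc.prems(3)] ext_zero_syzygy[OF Suc.prems(3)] by metis
qed

text \<open>Arbitrary syzygies work: after \<open>k\<close> of them the remaining module is
  orthogonal to everything on the right, hence projective.\<close>

lemma ext_zero_resolved: "\<lbrakk>X \<in> Mods; \<And>N. N \<in> Mods \<Longrightarrow> ext_zero k X N\<rbrakk> \<Longrightarrow> resolved k X"
proof (induction k arbitrary: X)
  case 0
  then have "X \<in> Proj R U" by (intro ProjI_orth) simp_all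
  then show ?case using isomorphic_refl[OF 0(1)] by auto
next
  case (Suc k)
  obtain K j P q where P: "P \<in> Proj R U" and K: "ses K j P q X" by (rule syzygy[OF Suc.prems(1)])
  have "resolved k K"
    by (rule Suc.IH[OF sesD(1)[OF K]]) (use Suc.prems(2) ext_zero_syzygy[OF _ K P] in blast)
  then show ?case using P K by auto
qed

lemma coresolved_Inj_ext_zero: "\<lbrakk>coresolved (Inj R U) k N; N \<in> Mods; X \<in> Mods\<rbrakk> \<Longrightarrow> ext_zero k X N"
proof (induction k arbitrary: N)
  case 0
  then obtain E where E: "E \<in> Inj R U" "isomorphic_modules R N E" by auto
  show ?case by (rule ext_zero_iso[OF E(2) 0(2) Inj_Mods[OF E(1)] 0(3) ext_zero_Inj[OF E(1) 0(3)]])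
next
  case (Suc k)
  then obtain E L i p where E: "E \<in> Inj R U" "ses N i E p L" "coresolved (Inj R U) k L" by auto
  then show ?case using Suc.IH[OF E(3) sesD(3)[OF E(2)] Suc.prems(3)] ext_zero_cosyzygy[OF Suc.prems(3) E(2,1)] by blast
qed

lemma ext_zero_coresolved_Inj:
  "\<lbrakk>N \<in> Mods; \<And>X. X \<in> Mods \<Longrightarrow> ext_zero k X N\<rbrakk> \<Longrightarrow> coresolved (Inj R U) k N"
proof (induction k arbitrary: N)
  case 0
  then have "N \<in> Inj R U" by (intro InjI_orth) simp_all
  then show ?case using isomorphic_refl[OF 0(1)] by auto
next
  case (Suc k)
  obtain i E p L where E: "E \<in> Inj R U" and L: "ses N i E p L" by (rule cosyzygy[OF Suc.prems(1)])
  have "coresolved (Inj R U) k L"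
    by (rule Suc.IH[OF sesD(3)[OF L]]) (use Suc.prems(2) ext_zero_cosyzygy[OF _ L E] in blast)
  then show ?case using E L by auto
qed

text \<open>The dimension allows any length up to \<open>n\<close>, while vanishing is stated in the
  single degree \<open>n + 1\<close>; monotonicity of vanishing in the degree bridges the
  two.\<close>

lemma proj_dim_le_iff:
  assumes "X \<in> Mods"
  shows "proj_dim R U X \<le> enat n \<longleftrightarrow> (\<forall>N\<in>Mods. ext_zero n X N)"
proof -
  have "proj_dim R U X \<le> enat n \<longleftrightarrow> (\<exists>k\<le>n. resolved k X)"
    unfolding proj_dim_def Inf_enat_le_iff resolved_exact_sequence[OF assms] ..
  then show ?thesis
    using resolved_ext_zero[OF _ assms] ext_zero_resolved[OF assms] ext_zero_mono_proj[OF assms] by blast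
qed

lemma coresolution_dim_le_iff:
  assumes "\<C> \<subseteq> Mods" "M \<in> Mods"
  shows "coresolution_dim R \<C> M \<le> enat n \<longleftrightarrow> (\<exists>k\<le>n. coresolved \<C> k M)"
  unfolding coresolution_dim_def Inf_enat_le_iff coresolved_exact_sequence[OF assms] ..

lemma fin_inj_dim_iff:
  "M \<in> fin_inj_dim R U \<longleftrightarrow> M \<in> Mods \<and> (\<exists>n. \<forall>X\<in>Mods. ext_zero n X M)"
proof (cases "M \<in> Mods")
  case M: True
  have I: "Inj R U \<subseteq> Mods" using Inj_Mods by blast
  have "inj_dim R U M < \<infinity> \<longleftrightarrow> (\<exists>n. inj_dim R U M \<le> enat n)"
    by (cases "inj_dim R U M") auto
  also have "\<dots> \<longleftrightarrow> (\<exists>n. \<forall>X\<in>Mods. ext_zero n X M)"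
    unfolding inj_dim_def coresolution_dim_le_iff[OF I M]
    using coresolved_Inj_ext_zero[OF _ M] ext_zero_coresolved_Inj[OF M] by blast
  finally show ?thesis using M by (simp add: fin_inj_dim_def)
qed (simp add: fin_inj_dim_def)

section \<open>Ding injective modules\<close>

definition ext_perp :: "('r, 'm) module set \<Rightarrow> ('r, 'm) module set" where
  "ext_perp \<E> = {M \<in> Mods. \<forall>E\<in>\<E>. \<forall>n. ext_zero n E M}"

lemma perp_eq: "\<E> \<subseteq> Mods \<Longrightarrow> perp R U \<E> = ext_perp \<E>"
proof -
  assume E: "\<E> \<subseteq> Mods"
  have "(\<forall>i\<ge>1. trivial_group (Ext R U i X M)) \<longleftrightarrow> (\<forall>n. ext_zero n X M)" if "X \<in> Mods" "M \<in> Mods" for X M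
    unfolding trivial_Ext_iff[OF that, symmetric]
    by (metis One_nat_def Suc_le_D Suc_le_mono le0)
  then show ?thesis using E unfolding perp_def ext_perp_def by blast
qed

lemma Abs_pure_Mods: "Abs_pure R U \<subseteq> Mods"
  by (auto simp: Abs_pure_def)

lemma Inj_subset_Mods: "Inj R U \<subseteq> Mods"
  using Inj_Mods by blast

lemma Ding_inj_Mods: "Ding_inj R U \<subseteq> Mods"
  by (auto simp: Ding_inj_def)

lemma Inj_subset_Abs_pure: "Inj R U \<subseteq> Abs_pure R U"
proof
  fix E assume E: "E \<in> Inj R U"
  have "trivial_group (Ext R U 1 F E)" if "F \<in> Mods" for F
    using trivial_Ext_iff[OF that Inj_Mods[OF E], of 0] ext_zero_Inj[OF E that] by simp
  then show "E \<in> Abs_pure R U" using Inj_Mods[OF E] by (auto simp: Abs_pure_def fin_pres_def)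
qed

lemma ses_iso_right:
  assumes S: "ses A i B p C" and f: "f \<in> Hom R C C'" "bij_betw f (carrier C) (carrier C')" and C': "C' \<in> Mods"
  shows "ses A i B (compose (carrier B) f p) C'"
proof (rule sesI)
  note D = sesD[OF S]
  show "A \<in> Mods" "B \<in> Mods" "C' \<in> Mods" "i \<in> Hom R A B" using D C' by simp_all
  show "compose (carrier B) f p \<in> Hom R B C'" by (rule Hom_compose[OF D(5) f(1) D(2)])
  show "x = \<zero>\<^bsub>A\<^esub>" if "x \<in> carrier A" "i x = \<zero>\<^bsub>B\<^esub>" for x using ses_inj_0[OF S] that by blast
  show "compose (carrier B) f p (i x) = \<zero>\<^bsub>C'\<^esub>" if "x \<in> carrier A" for x
    using that D(4) ses_zero[OF S that] Hom_zero[OF f(1) D(3) C'] by simp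
  show "\<exists>x\<in>carrier A. i x = y" if y: "y \<in> carrier B" "compose (carrier B) f p y = \<zero>\<^bsub>C'\<^esub>" for y
  proof (rule ses_mid[OF S y(1)])
    show "p y = \<zero>\<^bsub>C\<^esub>"
      by (rule inj_onD[OF bij_betw_imp_inj_on[OF f(2)]])
        (use y D(3,5) Hom_zero[OF f(1) D(3) C'] in simp_all)
  qed
  show "\<exists>y\<in>carrier B. compose (carrier B) f p y = z" if z: "z \<in> carrier C'" for z
  proof -
    obtain c where c: "c \<in> carrier C" "f c = z" using f(2) z by (metis bij_betw_imp_surj_on imageE)
    obtain b where "b \<in> carrier B" "p b = c" using ses_surj[OF S c(1)] by blast
    then show ?thesis using c by (intro bexI[of _ b]) simp_all
  qed
qed

text \<open>The cycles form short exact sequences from \<open>Z n\<close> through \<open>I n\<close>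
  to \<open>Z (n + 1)\<close>. Exactness of the Hom complex lifts maps from \<open>E\<close> to
  \<open>Z (n + 1)\<close> along \<open>I n\<close>, which kills the first Ext into every cycle;
  higher degrees follow because \<open>Z (n + 1)\<close> is a cosyzygy of \<open>Z n\<close>. The
  preceding cycle gives the second claim.\<close>

lemma Ding_injD:
  assumes "M \<in> Ding_inj R U"
  shows "\<And>E n. E \<in> Abs_pure R U \<Longrightarrow> ext_zero n E M"
    and "\<exists>I\<in>Inj R U. \<exists>M'\<in>Ding_inj R U. \<exists>i p. ses M' i I p M"
proof -
  obtain I d n where I': "\<forall>j. I j \<in> Inj R U" "exact_complex R I d" "\<forall>E\<in>Abs_pure R U. Hom_exact R E I d"
    and iso: "isomorphic_modules R M (kernel_module (I n) (d n) (I (n + 1)))" and M: "M \<in> Mods"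
    using assms unfolding Ding_inj_def by blast
  have I: "I j \<in> Inj R U" "exact_complex R I d" "E \<in> Abs_pure R U \<Longrightarrow> Hom_exact R E I d" for j E
    using I' by blast+
  have IM: "I j \<in> Mods" for j by (rule Inj_Mods[OF I(1)])
  have dH: "d n \<in> Hom R (I n) (I (n + 1))" for n using I(2) by (simp add: exact_complex_def)
  define Z where "Z n = kernel_module (I n) (d n) (I (n + 1))" for n
  define inc where "inc n = (\<lambda>x\<in>kernel_of (I n) (d n) (I (n + 1)). x)" for n
  have S: "ses (Z n) (inc n) (I n) (d n) (Z (n + 1))" for n
    using ses_kernel_exact[OF dH[of n] dH[of "n + 1"] IM IM IM] I(2)
    by (simp add: Z_def inc_def exact_complex_def add.assoc)
  note D = sesD[OF S]
  have Zc: "carrier (Z n) = kernel_of (I n) (d n) (I (n + 1))" for n by (simp add: Z_def kernel_module_def)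
  have ext: "ext_zero k E (Z n)" if E: "E \<in> Abs_pure R U" for k E n
  proof (induction k arbitrary: n)
    case 0
    have EM: "E \<in> Mods" using E Abs_pure_Mods by blast
    have "orth E (Z n)"
    proof (rule orthI_inj[OF S I(1) EM])
      fix f assume f: "f \<in> Hom R E (Z (n + 1))"
      obtain \<phi> where \<phi>: "\<phi> \<in> Hom R E (I (n + 1))" "\<And>x. x \<in> carrier E \<Longrightarrow> \<phi> x = inc (n + 1) (f x)"
        by (rule Hom_comp[OF f D(4) EM]) (rule that)
      have \<phi>f: "\<phi> x = f x" "d (n + 1) (f x) = \<zero>\<^bsub>I (n + 2)\<^esub>" if "x \<in> carrier E" for x
        using Hom_closed[OF f that] \<phi>(2)[OF that] by (simp_all add: Zc inc_def kernel_of_def add.assoc)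
      have "compose (carrier E) (d (n + 1)) \<phi> = (\<lambda>x\<in>carrier E. \<zero>\<^bsub>I (n + 2)\<^esub>)"
        by (auto simp: compose_def fun_eq_iff \<phi>f)
      then have "\<phi> \<in> (\<lambda>\<psi>. compose (carrier E) (d n) \<psi>) ` Hom R E (I n)"
        using I(3)[OF E] \<phi>(1) unfolding Hom_exact_def by blast
      then obtain \<psi> where \<psi>: "\<psi> \<in> Hom R E (I n)" "\<phi> = compose (carrier E) (d n) \<psi>" by blast
      have "d n (\<psi> x) = f x" if "x \<in> carrier E" for x
        using fun_cong[OF \<psi>(2), of x] that \<phi>f(1) by simp
      then show "\<exists>g\<in>Hom R E (I n). \<forall>x\<in>carrier E. d n (g x) = f x" using \<psi>(1) by blast
    qed
    then show ?case by simp
  next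
    case (Suc k)
    have EM: "E \<in> Mods" using E Abs_pure_Mods by blast
    show ?case using ext_zero_cosyzygy[OF EM S I(1)] Suc.IH by blast
  qed
  show "ext_zero m E M" if E: "E \<in> Abs_pure R U" for E m
    by (rule ext_zero_iso[OF iso[folded Z_def] M D(1) _ ext[OF E]]) (use E Abs_pure_Mods in blast)
  obtain f where f: "f \<in> Hom R M (Z n)" "bij_betw f (carrier M) (carrier (Z n))"
    using iso by (auto simp: isomorphic_modules_def Z_def)
  obtain g where g: "g \<in> Hom R (Z n) M" "\<And>x. x \<in> carrier (Z n) \<Longrightarrow> f (g x) = x" "\<And>x. x \<in> carrier M \<Longrightarrow> g (f x) = x"
    by (rule Hom_inverse[OF f M D(1)]) (rule that)
  have gb: "bij_betw g (carrier (Z n)) (carrier M)"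
    by (rule bij_betw_byWitness[of _ f]) (use g f(1) in \<open>auto simp: Hom_closed[OF g(1)] Hom_closed[OF f(1)]\<close>)
  have "Z (n - 1) \<in> Ding_inj R U"
    unfolding Ding_inj_def
  proof (intro CollectI conjI exI)
    show "isomorphic_modules R (Z (n - 1)) (kernel_module (I (n - 1)) (d (n - 1)) (I (n - 1 + 1)))"
      unfolding Z_def by (rule isomorphic_refl[OF D(1)[of "n - 1", unfolded Z_def]])
  qed (use I D(1) in auto)
  moreover have "ses (Z (n - 1)) (inc (n - 1)) (I (n - 1)) (compose (carrier (I (n - 1))) g (d (n - 1))) M"
    by (rule ses_iso_right[OF _ g(1) gb M]) (use S[of "n - 1"] in simp)
  ultimately show "\<exists>I\<in>Inj R U. \<exists>M'\<in>Ding_inj R U. \<exists>i p. ses M' i I p M" using I(1) by blast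
qed

text \<open>The Ding injective modules form the largest class with the two properties of \<open>Ding_injD\<close>.\<close>

lemma Ding_inj_coinduct:
  assumes "M \<in> \<C>"
    and ext: "\<And>M E n. \<lbrakk>M \<in> \<C>; E \<in> Abs_pure R U\<rbrakk> \<Longrightarrow> ext_zero n E M"
    and cover: "\<And>M. M \<in> \<C> \<Longrightarrow> \<exists>I\<in>Inj R U. \<exists>M'\<in>\<C>. \<exists>i p. ses M' i I p M"
  shows "M \<in> Ding_inj R U"
proof -
  have MM: "M \<in> Mods" if "M \<in> \<C>" for M using cover[OF that] sesD(3) by blast
  have stepL: "\<exists>y M'. (case y of (i, I, p) \<Rightarrow> I \<in> Inj R U \<and> ses M' i I p M) \<and> M' \<in> \<C>" if M: "M \<in> \<C>" for M
  proof -
    obtain I M' i p where "I \<in> Inj R U" "M' \<in> \<C>" "ses M' i I p M" using cover[OF M] by blast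
    then show ?thesis by (intro exI[of _ "(i, I, p)"] exI[of _ M']) simp
  qed
  obtain T y where T: "T 0 = M" "\<And>n. T n \<in> \<C>"
    "\<And>n. case y n of (i, I, p) \<Rightarrow> I \<in> Inj R U \<and> ses (T (Suc n)) i I p (T n)"
    by (rule nat_chain[where Q = "\<lambda>M. M \<in> \<C>"
          and S = "\<lambda>M y M'. case y of (i, I, p) \<Rightarrow> I \<in> Inj R U \<and> ses M' i I p M", OF assms(1) stepL])
      (assumption, rule that)
  let ?Q = "\<lambda>M. M \<in> Mods \<and> (\<forall>E\<in>Abs_pure R U. \<forall>n. ext_zero n E M)"
  \<comment> \<open>The right half consists of arbitrary cosyzygies. These keep the vanishing
    against absolutely pure modules by dimension shifting, although they may leave \<C>.\<close>
  have stepR: "\<exists>y M'. (case y of (i, I, p) \<Rightarrow> I \<in> Inj R U \<and> ses M i I p M') \<and> ?Q M'" if Q: "?Q M" for M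
  proof -
    have MM: "M \<in> Mods" using Q by blast
    obtain i I p L where I: "I \<in> Inj R U" "ses M i I p L" by (rule cosyzygy[OF MM])
    have "ext_zero n E L" if "E \<in> Abs_pure R U" for E n
      using ext_zero_cosyzygy[OF _ I(2,1), of E n] Q that Abs_pure_Mods by blast
    then show ?thesis using I sesD(3)[OF I(2)] by (intro exI[of _ "(i, I, p)"] exI[of _ L]) simp
  qed
  have QM: "?Q M" using MM ext assms(1) by blast
  obtain T' y' where T': "T' 0 = M" "\<And>n. ?Q (T' n)"
    "\<And>n. case y' n of (i, I, p) \<Rightarrow> I \<in> Inj R U \<and> ses (T' n) i I p (T' (Suc n))"
    by (rule nat_chain[where Q = ?Q
          and S = "\<lambda>M y M'. case y of (i, I, p) \<Rightarrow> I \<in> Inj R U \<and> ses M i I p M'", OF QM stepR])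
      (assumption, rule that)
  \<comment> \<open>Cycles: \<open>M\<close> at index 0, iterated cosyzygies to the right, iterated
    kernels in \<C> to the left.\<close>
  define Z where "Z m = (if m \<ge> 0 then T' (nat m) else T (nat (- m)))" for m :: int
  \<comment> \<open>The link from \<open>Z m\<close> to \<open>Z (m + 1)\<close>. Since
    \<open>y k\<close> leads from \<open>T (Suc k)\<close> to \<open>T k\<close>, its index is
    \<open>m = - 1 - k\<close>.\<close>
  define w where "w m = (if m \<ge> 0 then y' (nat m) else y (nat (- m - 1)))" for m :: int
  define \<alpha> I \<beta> where "\<alpha> m = fst (w m)" and "I m = fst (snd (w m))" and "\<beta> m = snd (snd (w m))" for m
  have I: "I m \<in> Inj R U \<and> ses (Z m) (\<alpha> m) (I m) (\<beta> m) (Z (m + 1))" for m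
  proof (cases "m \<ge> 0")
    case True
    then have "nat (m + 1) = Suc (nat m)" by simp
    then show ?thesis using True T'(3)[of "nat m"]
      by (auto simp: Z_def w_def \<alpha>_def I_def \<beta>_def split: prod.splits)
  next
    case False
    define k where "k = nat (- m - 1)"
    have m: "m = - 1 - int k" using False by (simp add: k_def)
    have "Z m = T (Suc k)" "Z (m + 1) = T k" "w m = y k"
      using T(1) T'(1) by (auto simp: Z_def w_def m nat_add_distrib)
    then show ?thesis using T(3)[of k] by (auto simp: \<alpha>_def I_def \<beta>_def split: prod.splits)
  qed
  have S: "ses (Z m) (\<alpha> m) (I m) (\<beta> m) (Z (m + 1))" for m using I by blast
  note D = sesD[OF S]
  define d where "d m = compose (carrier (I m)) (\<alpha> (m + 1)) (\<beta> m)" for m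
  have dH: "d m \<in> Hom R (I m) (I (m + 1))" for m
    unfolding d_def by (rule Hom_compose[OF D(5) D(4) D(2)])
  have dv: "d m x = \<alpha> (m + 1) (\<beta> m x)" if "x \<in> carrier (I m)" for m x using that by (simp add: d_def)
  have d0: "d m x = \<zero>\<^bsub>I (m + 1)\<^esub> \<longleftrightarrow> \<beta> m x = \<zero>\<^bsub>Z (m + 1)\<^esub>" if "x \<in> carrier (I m)" for m x
    using ses_inj_0[OF S Hom_closed[OF D(5) that]] Hom_zero[OF D(4) D(1) D(2)] by (auto simp: dv[OF that])
  have dker: "kernel_of (I m) (d m) (I (m + 1)) = \<alpha> m ` carrier (Z m)" for m
    using D(8)[of m] d0 by (auto simp: kernel_of_def)
  have "exact_complex R I d"
    unfolding exact_complex_def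
  proof (intro conjI allI dH)
    fix m
    have "d m ` carrier (I m) = \<alpha> (m + 1) ` (\<beta> m ` carrier (I m))"
      by (auto simp: dv image_image)
    also have "\<dots> = kernel_of (I (m + 1)) (d (m + 1)) (I (m + 1 + 1))" by (simp only: D(7) dker)
    finally show "exact_at (I m) (d m) (I (m + 1)) (d (m + 1)) (I (m + 2))"
      by (simp add: exact_at_def add.assoc)
  qed
  moreover have "Hom_exact R E I d" if E: "E \<in> Abs_pure R U" for E
    unfolding Hom_exact_def
  proof (intro allI subset_antisym subsetI)
    fix m \<phi>
    have EM: "E \<in> Mods" using E Abs_pure_Mods by blast
    {
      assume "\<phi> \<in> (\<lambda>\<psi>. compose (carrier E) (d m) \<psi>) ` Hom R E (I m)"
      then obtain \<psi> where \<psi>: "\<psi> \<in> Hom R E (I m)" "\<phi> = compose (carrier E) (d m) \<psi>" by blast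
      have "\<phi> \<in> Hom R E (I (m + 1))" unfolding \<psi>(2) by (rule Hom_compose[OF \<psi>(1) dH EM])
      moreover have "d (m + 1) (\<phi> x) = \<zero>\<^bsub>I (m + 2)\<^esub>" if x: "x \<in> carrier E" for x
      proof -
        have "d m (\<psi> x) \<in> kernel_of (I (m + 1)) (d (m + 1)) (I (m + 1 + 1))"
          unfolding dker using Hom_closed[OF \<psi>(1) x] by (simp add: dv Hom_closed[OF D(5)])
        then show ?thesis using x by (simp add: kernel_of_def \<psi>(2) add.assoc)
      qed
      ultimately show "\<phi> \<in> {\<phi> \<in> Hom R E (I (m + 1)). compose (carrier E) (d (m + 1)) \<phi> = (\<lambda>x\<in>carrier E. \<zero>\<^bsub>I (m + 2)\<^esub>)}"
        by (auto simp: compose_def fun_eq_iff)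
    next
      assume "\<phi> \<in> {\<phi> \<in> Hom R E (I (m + 1)). compose (carrier E) (d (m + 1)) \<phi> = (\<lambda>x\<in>carrier E. \<zero>\<^bsub>I (m + 2)\<^esub>)}"
      then have \<phi>: "\<phi> \<in> Hom R E (I (m + 1))"
        and c: "compose (carrier E) (d (m + 1)) \<phi> = (\<lambda>x\<in>carrier E. \<zero>\<^bsub>I (m + 2)\<^esub>)" by blast+
      have "d (m + 1) (\<phi> x) = \<zero>\<^bsub>I (m + 1 + 1)\<^esub>" if "x \<in> carrier E" for x
        using fun_cong[OF c, of x] that by (simp add: add.assoc)
      then have "\<beta> (m + 1) (\<phi> x) = \<zero>\<^bsub>Z (m + 1 + 1)\<^esub>" if "x \<in> carrier E" for x
        using d0[OF Hom_closed[OF \<phi> that]] that by blast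
      then obtain u where u: "u \<in> Hom R E (Z (m + 1))" "\<And>x. x \<in> carrier E \<Longrightarrow> \<alpha> (m + 1) (u x) = \<phi> x"
        by (rule ses_factor_left[OF S \<phi> EM]) (assumption, rule that)
      \<comment> \<open>A cocycle factors through \<open>Z (m + 1)\<close>; vanishing of the first
        Ext into \<open>Z m\<close> lifts it to \<open>I m\<close>, which is exactness of the Hom
        complex.\<close>
      have "ext_zero 0 E (Z m)"
        using T'(2)[of "nat m"] ext[OF T(2) E, of 0 "nat (- m)"] E unfolding Z_def by (cases "m \<ge> 0") metis+
      then have "orth E (Z m)" by simp
      then obtain \<psi> where \<psi>: "\<psi> \<in> Hom R E (I m)" "\<And>x. x \<in> carrier E \<Longrightarrow> \<beta> m (\<psi> x) = u x"
        by (rule orth_lift[OF _ EM S u(1)]) (rule that)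
      have "\<phi> = compose (carrier E) (d m) \<psi>"
        by (rule Hom_eqI[OF \<phi> Hom_compose[OF \<psi>(1) dH EM]])
          (use Hom_closed[OF \<psi>(1)] in \<open>simp add: dv \<psi>(2) u(2)\<close>)
      then show "\<phi> \<in> (\<lambda>\<psi>. compose (carrier E) (d m) \<psi>) ` Hom R E (I m)" using \<psi>(1) by blast
    }
  qed
  moreover have "isomorphic_modules R M (kernel_module (I 0) (d 0) (I (0 + 1)))"
  proof -
    define K where "K = kernel_module (I 0) (d 0) (I (0 + 1))"
    have Z0: "Z 0 = M" using T'(1) by (simp add: Z_def)
    have c: "carrier K = \<alpha> 0 ` carrier M" using dker[of 0] Z0 by (simp add: K_def kernel_module_def)
    have o: "add K = add (I 0)" "smult K = smult (I 0)" by (simp_all add: K_def kernel_module_def)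
    have a: "\<alpha> 0 \<in> Hom R M (I 0)" "inj_on (\<alpha> 0) (carrier M)" using D(4,6)[of 0] Z0 by simp_all
    have "\<alpha> 0 \<in> Hom R M K" using a(1) Hom_PiE[OF a(1)] unfolding Hom_def by (auto simp: c o)
    then have "isomorphic_modules R M K" using a(2) c by (auto simp: isomorphic_modules_def bij_betw_def)
    then show ?thesis unfolding K_def .
  qed
  ultimately show ?thesis
    unfolding Ding_inj_def using I QM by (intro CollectI conjI exI[of _ I] exI[of _ d] exI[of _ 0]) auto
qed

section \<open>Zero modules, the horseshoe construction and extensions of Ding injectives\<close>

definition zero_obj :: "('r, 'm) module \<Rightarrow> bool" where
  "zero_obj Z \<longleftrightarrow> Z \<in> Mods \<and> carrier Z = {\<zero>\<^bsub>Z\<^esub>}"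

lemma ses_zero_right:
  assumes "M \<in> Mods"
  obtains Z p where "zero_obj Z" "ses M (\<lambda>x\<in>carrier M. x) M p Z"
proof -
  obtain Z p where S: "ses M (\<lambda>x\<in>carrier M. x) M p Z"
    by (rule cokernel_ses[OF Hom_id[OF assms] assms assms]) (auto simp: inj_on_def)
  have "z = \<zero>\<^bsub>Z\<^esub>" if "z \<in> carrier Z" for z
  proof -
    obtain y where "y \<in> carrier M" "p y = z" using ses_surj[OF S \<open>z \<in> carrier Z\<close>] by blast
    then show ?thesis using ses_zero[OF S, of y] by simp
  qed
  then have "zero_obj Z" unfolding zero_obj_def using sesD(3)[OF S] mod_zero[OF sesD(3)[OF S]] by auto
  then show thesis by (rule that[OF _ S])
qed

lemma zero_obj_Inj: "zero_obj Z \<Longrightarrow> Z \<in> Inj R U"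
proof (rule InjI)
  assume Z: "zero_obj Z"
  fix A B i f assume *: "A \<in> Mods" "B \<in> Mods" "i \<in> Hom R A B" "f \<in> Hom R A Z"
  have "(\<lambda>x\<in>carrier B. \<zero>\<^bsub>Z\<^esub>) \<in> Hom R B Z" using Z *(2) by (intro Hom_0) (simp_all add: zero_obj_def)
  moreover have "(\<lambda>x\<in>carrier B. \<zero>\<^bsub>Z\<^esub>) (i x) = f x" if "x \<in> carrier A" for x
    using that *(3) Hom_closed[OF *(4) that] Z by (simp add: zero_obj_def)
  ultimately show "\<exists>g\<in>Hom R B Z. \<forall>x\<in>carrier A. g (i x) = f x" by blast
qed (simp add: zero_obj_def)

lemma ses_zero_left:
  assumes M: "M \<in> Mods"
  obtains Z i where "zero_obj Z" "ses Z i M (\<lambda>x\<in>carrier M. x) M"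
proof -
  have "ses (kernel_module M (\<lambda>x\<in>carrier M. x) M) (\<lambda>x\<in>kernel_of M (\<lambda>x\<in>carrier M. x) M. x) M (\<lambda>x\<in>carrier M. x) M"
    by (rule ses_kernel[OF Hom_id[OF M] M M]) auto
  moreover from this have "zero_obj (kernel_module M (\<lambda>x\<in>carrier M. x) M)"
    using sesD(1) M by (auto simp: zero_obj_def kernel_module_def kernel_of_def)
  ultimately show thesis using that by blast
qed

text \<open>The class of injectives satisfies both coinductive conditions by itself, each injective
  being covered by itself with kernel zero.\<close>

lemma Inj_subset_Ding_inj: "Inj R U \<subseteq> Ding_inj R U"
proof
  fix M assume "M \<in> Inj R U"
  then show "M \<in> Ding_inj R U"
  proof (rule Ding_inj_coinduct)
    fix M assume M: "M \<in> Inj R U"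
    show "ext_zero n E M" if "E \<in> Abs_pure R U" for E n
      using ext_zero_Inj[OF M] that Abs_pure_Mods by blast
    obtain Z i where "zero_obj Z" "ses Z i M (\<lambda>x\<in>carrier M. x) M" by (rule ses_zero_left[OF Inj_Mods[OF M]])
    then show "\<exists>I\<in>Inj R U. \<exists>M'\<in>Inj R U. \<exists>i p. ses M' i I p M" using M zero_obj_Inj by blast
  qed
qed

lemma Ding_inj_subset_perp: "Ding_inj R U \<subseteq> ext_perp (Abs_pure R U)" "Ding_inj R U \<subseteq> ext_perp (Inj R U)"
  using Ding_injD(1) Ding_inj_Mods Inj_subset_Abs_pure by (auto simp: ext_perp_def)

lemma Ding_inj_iso: "\<lbrakk>isomorphic_modules R M D; D \<in> Ding_inj R U; M \<in> Mods\<rbrakk> \<Longrightarrow> M \<in> Ding_inj R U"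
  unfolding Ding_inj_def using isomorphic_trans by blast

lemma biprod_Inj:
  assumes S: "biprod S p q A B" and A: "A \<in> Inj R U" and B: "B \<in> Inj R U"
  shows "S \<in> Inj R U"
proof (rule InjI)
  have Sd: "S \<in> Mods" "p \<in> Hom R S A" "q \<in> Hom R S B" using S by (simp_all add: biprod_def)
  show "S \<in> Mods" by (rule Sd(1))
  fix X Y i f assume *: "X \<in> Mods" "Y \<in> Mods" "i \<in> Hom R X Y" "f \<in> Hom R X S" "inj_on i (carrier X)"
  obtain pf where pf: "pf \<in> Hom R X A" "\<And>x. x \<in> carrier X \<Longrightarrow> pf x = p (f x)"
    by (rule Hom_comp[OF *(4) Sd(2) *(1)]) (rule that)
  obtain qf where qf: "qf \<in> Hom R X B" "\<And>x. x \<in> carrier X \<Longrightarrow> qf x = q (f x)"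
    by (rule Hom_comp[OF *(4) Sd(3) *(1)]) (rule that)
  obtain g where g: "g \<in> Hom R Y A" "\<And>x. x \<in> carrier X \<Longrightarrow> g (i x) = pf x"
    by (rule Inj_extend[OF A *(1,2,3) pf(1) *(5)]) (rule that)
  obtain h where h: "h \<in> Hom R Y B" "\<And>x. x \<in> carrier X \<Longrightarrow> h (i x) = qf x"
    by (rule Inj_extend[OF B *(1,2,3) qf(1) *(5)]) (rule that)
  obtain k where k: "k \<in> Hom R Y S" "\<And>x. x \<in> carrier Y \<Longrightarrow> p (k x) = g x" "\<And>x. x \<in> carrier Y \<Longrightarrow> q (k x) = h x"
    by (rule biprod_pair[OF S g(1) h(1) Inj_Mods[OF A] Inj_Mods[OF B] *(2)]) (rule that)
  have "k (i x) = f x" if x: "x \<in> carrier X" for x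
  proof -
    have ix: "i x \<in> carrier Y" using *(3) x by simp
    have "p (k (i x)) = p (f x)" "q (k (i x)) = q (f x)"
      using x by (simp_all add: k(2)[OF ix] k(3)[OF ix] g(2) h(2) pf(2) qf(2))
    then show ?thesis using S Hom_closed[OF k(1) ix] Hom_closed[OF *(4) x] by (simp add: biprod_def)
  qed
  then show "\<exists>g\<in>Hom R Y S. \<forall>x\<in>carrier X. g (i x) = f x" using k(1) by blast
qed

text \<open>The horseshoe lemma for left resolutions by injectives. \<open>J\<close> is not
  projective, so the lift of \<open>J -> C\<close> to \<open>B\<close> that the classical proof
  takes from projectivity comes from \<open>orth J A\<close>.\<close>

lemma horseshoe:
  assumes B: "ses A i B p C" and A: "ses A' j I u A" and C: "ses C' k J v C"
    and I: "I \<in> Inj R U" and J: "J \<in> Inj R U" and o: "orth J A"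
  obtains S B' l w s t where "S \<in> Inj R U" "ses B' l S w B" "ses A' s B' t C'"
proof -
  note Bd = sesD[OF B] and Ad = sesD[OF A] and Cd = sesD[OF C]
  obtain t0 where t0: "t0 \<in> Hom R J B" "\<And>x. x \<in> carrier J \<Longrightarrow> p (t0 x) = v x"
    by (rule orth_lift[OF o Inj_Mods[OF J] B Cd(5)]) (rule that)
  obtain S a b where S: "biprod S a b I J" by (rule biprod_exists[OF Ad(2) Cd(2)])
  have Sd: "S \<in> Mods" "a \<in> Hom R S I" "b \<in> Hom R S J" using S by (simp_all add: biprod_def)
  have Spair: "\<exists>s\<in>carrier S. a s = y \<and> b s = x" if "y \<in> carrier I" "x \<in> carrier J" for x y
    using S that by (simp add: biprod_def)
  have Seq: "s = s'" if "s \<in> carrier S" "s' \<in> carrier S" "a s = a s'" "b s = b s'" for s s'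
    using S that by (simp add: biprod_def)
  obtain ua where ua: "ua \<in> Hom R S A" "\<And>x. x \<in> carrier S \<Longrightarrow> ua x = u (a x)"
    by (rule Hom_comp[OF Sd(2) Ad(5) Sd(1)]) (rule that)
  obtain iu where iu: "iu \<in> Hom R S B" "\<And>x. x \<in> carrier S \<Longrightarrow> iu x = i (ua x)"
    by (rule Hom_comp[OF ua(1) Bd(4) Sd(1)]) (rule that)
  obtain tb where tb: "tb \<in> Hom R S B" "\<And>x. x \<in> carrier S \<Longrightarrow> tb x = t0 (b x)"
    by (rule Hom_comp[OF Sd(3) t0(1) Sd(1)]) (rule that)
  obtain w where w: "w \<in> Hom R S B" "\<And>x. x \<in> carrier S \<Longrightarrow> w x = iu x \<oplus>\<^bsub>B\<^esub> tb x"
    using Hom_sum[OF iu(1) tb(1) Sd(1) Bd(2)] by blast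
  have wv: "w x = i (u (a x)) \<oplus>\<^bsub>B\<^esub> t0 (b x)" if "x \<in> carrier S" for x
    using that by (simp add: w(2) iu(2) ua(2) tb(2))
  have pw: "p (w x) = v (b x)" if x: "x \<in> carrier S" for x
  proof -
    have c: "a x \<in> carrier I" "b x \<in> carrier J" using Sd x by simp_all
    have ux: "u (a x) \<in> carrier A" using Ad(5) c by simp
    have "p (w x) = p (i (u (a x))) \<oplus>\<^bsub>C\<^esub> p (t0 (b x))"
      unfolding wv[OF x] by (rule Hom_add[OF Bd(5) Hom_closed[OF Bd(4) ux] Hom_closed[OF t0(1) c(2)]])
    then show ?thesis using ses_zero[OF B ux] t0(2)[OF c(2)] Hom_closed[OF Cd(5) c(2)] Bd(3) by simp
  qed
  have "w ` carrier S = carrier B"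
  proof (intro subset_antisym subsetI)
    fix y assume y: "y \<in> carrier B"
    obtain x where x: "x \<in> carrier J" "v x = p y" using ses_surj[OF C Hom_closed[OF Bd(5) y]] by blast
    have tx: "t0 x \<in> carrier B" using t0(1) x(1) by simp
    have "p (y \<ominus>\<^bsub>B\<^esub> t0 x) = \<zero>\<^bsub>C\<^esub>" using Bd(2,3,5) y tx x t0(2) by simp
    then obtain z where z: "z \<in> carrier A" "i z = y \<ominus>\<^bsub>B\<^esub> t0 x" using ses_mid[OF B] mod_minus[OF Bd(2) y tx] by blast
    obtain z' where z': "z' \<in> carrier I" "u z' = z" using ses_surj[OF A z(1)] by blast
    obtain s where s: "s \<in> carrier S" "a s = z'" "b s = x" using Spair[OF z'(1) x(1)] by blast
    have "w s = y" using s z' z tx y Bd(2) by (simp add: wv)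
    then show "y \<in> w ` carrier S" using s(1) by blast
  qed (use Hom_closed[OF w(1)] in blast)
  note W = ses_kernel[OF w(1) Sd(1) Bd(2) this]
  let ?B' = "kernel_module S w B" and ?l = "\<lambda>x\<in>kernel_of S w B. x"
  note Wd = sesD[OF W]
  have B'c: "x \<in> carrier ?B' \<longleftrightarrow> x \<in> carrier S \<and> w x = \<zero>\<^bsub>B\<^esub>" for x
    by (simp add: kernel_module_def kernel_of_def)
  have l: "?l x = x" if "x \<in> carrier ?B'" for x using that by (simp add: kernel_module_def)
  \<comment> \<open>The inclusion of \<open>A'\<close> into the first summand; it lands in the
    kernel of \<open>w\<close> because \<open>u\<close> kills the image of \<open>j\<close>.\<close>
  obtain \<sigma> where \<sigma>: "\<sigma> \<in> Hom R A' S" "\<And>x. x \<in> carrier A' \<Longrightarrow> a (\<sigma> x) = j x"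
    "\<And>x. x \<in> carrier A' \<Longrightarrow> b (\<sigma> x) = (\<lambda>x\<in>carrier A'. \<zero>\<^bsub>J\<^esub>) x"
    by (rule biprod_pair[OF S Ad(4) Hom_0[OF Ad(1) Cd(2)] Ad(2) Cd(2) Ad(1)]) (rule that)
  have w\<sigma>: "w (\<sigma> x) = \<zero>\<^bsub>B\<^esub>" if x: "x \<in> carrier A'" for x
    using x Hom_closed[OF \<sigma>(1) x] ses_zero[OF A x] Hom_zero[OF Bd(4,1,2)] Hom_zero[OF t0(1) Cd(2) Bd(2)] Bd(2)
    by (simp add: wv \<sigma>(2,3))
  obtain s where s: "s \<in> Hom R A' ?B'" "\<And>x. x \<in> carrier A' \<Longrightarrow> ?l (s x) = \<sigma> x"
    by (rule ses_factor_left[OF W \<sigma>(1) Ad(1) w\<sigma>]) (assumption, rule that)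
  have s\<sigma>: "s x = \<sigma> x" if "x \<in> carrier A'" for x using s(2)[OF that] l[OF Hom_closed[OF s(1) that]] by simp
  obtain b' where b': "b' \<in> Hom R ?B' J" "\<And>x. x \<in> carrier ?B' \<Longrightarrow> b' x = b (?l x)"
    by (rule Hom_comp[OF Wd(4) Sd(3) Wd(1)]) (rule that)
  have b'b: "b' x = b x" if "x \<in> carrier ?B'" for x using b'(2)[OF that] l[OF that] by simp
  have vb: "v (b' x) = \<zero>\<^bsub>C\<^esub>" if x: "x \<in> carrier ?B'" for x
    using pw[of x] x B'c[of x] Hom_zero[OF Bd(5,2,3)] by (simp add: b'b)
  obtain t where t: "t \<in> Hom R ?B' C'" "\<And>x. x \<in> carrier ?B' \<Longrightarrow> k (t x) = b' x"
    by (rule ses_factor_left[OF C b'(1) Wd(1) vb]) (assumption, rule that)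
  have "ses A' s ?B' t C'"
  proof (rule sesI[OF Ad(1) Wd(1) Cd(1) s(1) t(1)])
    fix x assume x: "x \<in> carrier A'" "s x = \<zero>\<^bsub>?B'\<^esub>"
    have "\<zero>\<^bsub>?B'\<^esub> = \<zero>\<^bsub>S\<^esub>" by (simp add: kernel_module_def)
    then have "j x = \<zero>\<^bsub>I\<^esub>" using x s\<sigma> \<sigma>(2) Hom_zero[OF Sd(2,1) Ad(2)] by metis
    then show "x = \<zero>\<^bsub>A'\<^esub>" by (rule ses_inj_0[OF A x(1)])
  next
    fix x assume x: "x \<in> carrier A'"
    have "k (t (s x)) = \<zero>\<^bsub>J\<^esub>"
      using x by (simp add: t(2) b'b s\<sigma> \<sigma>(3) Hom_closed[OF s(1) x, unfolded s\<sigma>[OF x]])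
    then show "t (s x) = \<zero>\<^bsub>C'\<^esub>" by (rule ses_inj_0[OF C Hom_closed[OF t(1) Hom_closed[OF s(1) x]]])
  next
    fix y assume y: "y \<in> carrier ?B'" "t y = \<zero>\<^bsub>C'\<^esub>"
    have yS: "y \<in> carrier S" "w y = \<zero>\<^bsub>B\<^esub>" using y(1) B'c by blast+
    have ay: "a y \<in> carrier I" using Sd yS by simp
    have by0: "b y = \<zero>\<^bsub>J\<^esub>" using t(2)[OF y(1)] y(2) b'b[OF y(1)] Hom_zero[OF Cd(4,1,2)] by simp
    have "i (u (a y)) = \<zero>\<^bsub>B\<^esub>"
      using wv[OF yS(1)] yS(2) by0 Hom_zero[OF t0(1) Cd(2) Bd(2)] Hom_closed[OF Bd(4) Hom_closed[OF Ad(5) ay]] Bd(2)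
      by simp
    then have "u (a y) = \<zero>\<^bsub>A\<^esub>" by (rule ses_inj_0[OF B Hom_closed[OF Ad(5) ay]])
    then obtain x where x: "x \<in> carrier A'" "j x = a y" using ses_mid[OF A ay] by blast
    have "\<sigma> x = y"
      by (rule Seq[OF Hom_closed[OF \<sigma>(1) x(1)] yS(1)]) (use x by0 \<sigma>(2,3) in simp_all)
    then show "\<exists>x\<in>carrier A'. s x = y" using x(1) s\<sigma> by blast
  next
    fix z assume z: "z \<in> carrier C'"
    have kz: "k z \<in> carrier J" using Cd(4) z by simp
    have tk: "t0 (k z) \<in> carrier B" using t0(1) kz by simp
    have "p (t0 (k z)) = \<zero>\<^bsub>C\<^esub>" using t0(2)[OF kz] ses_zero[OF C z] by simp
    then have "p (\<zero>\<^bsub>B\<^esub> \<ominus>\<^bsub>B\<^esub> t0 (k z)) = \<zero>\<^bsub>C\<^esub>" using Bd(2,3,5) tk by simp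
    then obtain x where x: "x \<in> carrier A" "i x = \<zero>\<^bsub>B\<^esub> \<ominus>\<^bsub>B\<^esub> t0 (k z)"
      using ses_mid[OF B] mod_minus[OF Bd(2) mod_zero[OF Bd(2)] tk] by blast
    obtain x' where x': "x' \<in> carrier I" "u x' = x" using ses_surj[OF A x(1)] by blast
    \<comment> \<open>The first coordinate is chosen to cancel \<open>t0 (k z)\<close>, so that the
      pair lies in the kernel of \<open>w\<close>.\<close>
    obtain y where y: "y \<in> carrier S" "a y = x'" "b y = k z" using Spair[OF x'(1) kz] by blast
    have "w y = \<zero>\<^bsub>B\<^esub>" using y x' x tk Bd(2) by (simp add: wv)
    then have yB: "y \<in> carrier ?B'" using y(1) B'c by blast
    have "k (t y) = k z" using t(2)[OF yB] b'b[OF yB] y(3) by simp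
    then have "t y = z" by (rule ses_inj[OF C Hom_closed[OF t(1) yB] z])
    then show "\<exists>y\<in>carrier ?B'. t y = z" using yB by blast
  qed
  then show thesis by (rule that[OF biprod_Inj[OF S I J] W])
qed

text \<open>Coinduction on the class of all extensions of Ding injectives by Ding injectives: the
  horseshoe covers such an extension by an injective with kernel in the same class. Its
  orthogonality premise holds because injectives are absolutely pure.\<close>

lemma Ding_inj_extension:
  assumes "ses A i B p C" "A \<in> Ding_inj R U" "C \<in> Ding_inj R U"
  shows "B \<in> Ding_inj R U"
proof -
  define \<C> where "\<C> = {B. \<exists>A\<in>Ding_inj R U. \<exists>C\<in>Ding_inj R U. \<exists>i p. ses A i B p C}"
  have "B \<in> \<C>" using assms by (auto simp: \<C>_def)
  then show ?thesis
  proof (rule Ding_inj_coinduct)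
    fix B assume "B \<in> \<C>"
    then obtain A C i p where B: "A \<in> Ding_inj R U" "C \<in> Ding_inj R U" "ses A i B p C" by (auto simp: \<C>_def)
    show "ext_zero n E B" if E: "E \<in> Abs_pure R U" for E n
      by (rule ext_zero_middle[OF B(3) _ Ding_injD(1)[OF B(1) E] Ding_injD(1)[OF B(2) E]])
        (use E Abs_pure_Mods in blast)
    obtain I A' j u where I: "I \<in> Inj R U" "A' \<in> Ding_inj R U" "ses A' j I u A" using Ding_injD(2)[OF B(1)] by blast
    obtain J C' k v where J: "J \<in> Inj R U" "C' \<in> Ding_inj R U" "ses C' k J v C" using Ding_injD(2)[OF B(2)] by blast
    have "orth J A" using Ding_injD(1)[OF B(1), of J 0] J(1) Inj_subset_Abs_pure by auto
    then obtain S B' l w s t where "S \<in> Inj R U" "ses B' l S w B" "ses A' s B' t C'"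
      by (rule horseshoe[OF B(3) I(3) J(3) I(1) J(1)])
    then show "\<exists>I\<in>Inj R U. \<exists>M'\<in>\<C>. \<exists>i p. ses M' i I p B" using I(2) J(2) unfolding \<C>_def by blast
  qed
qed

section \<open>Pullbacks of short exact sequences\<close>

definition is_pullback where
  "is_pullback Q h g B p C q B' \<longleftrightarrow> Q \<in> Mods \<and> h \<in> Hom R Q B \<and> g \<in> Hom R Q B' \<and>
     (\<forall>x\<in>carrier Q. p (h x) = q (g x)) \<and>
     (\<forall>b\<in>carrier B. \<forall>b'\<in>carrier B'. p b = q b' \<longrightarrow> (\<exists>x\<in>carrier Q. h x = b \<and> g x = b')) \<and>
     (\<forall>x\<in>carrier Q. \<forall>y\<in>carrier Q. h x = h y \<longrightarrow> g x = g y \<longrightarrow> x = y)"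

lemma is_pullback_sym: "is_pullback Q h g B p C q B' \<Longrightarrow> is_pullback Q g h B' q C p B"
proof -
  assume Q: "is_pullback Q h g B p C q B'"
  have e: "\<exists>x\<in>carrier Q. h x = b \<and> g x = b'" if "b \<in> carrier B" "b' \<in> carrier B'" "p b = q b'" for b b'
    using Q that by (simp add: is_pullback_def)
  have u: "x = y" if "x \<in> carrier Q" "y \<in> carrier Q" "h x = h y" "g x = g y" for x y
    using Q that by (simp add: is_pullback_def)
  have m: "Q \<in> Mods" "h \<in> Hom R Q B" "g \<in> Hom R Q B'" "\<And>x. x \<in> carrier Q \<Longrightarrow> p (h x) = q (g x)"
    using Q by (simp_all add: is_pullback_def)
  show ?thesis
    unfolding is_pullback_def
  proof (intro conjI ballI impI)
    show "\<exists>x\<in>carrier Q. g x = b' \<and> h x = b" if "b' \<in> carrier B'" "b \<in> carrier B" "q b' = p b" for b b'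
      using e[OF that(2,1) that(3)[symmetric]] by blast
    show "x = y" if "x \<in> carrier Q" "y \<in> carrier Q" "g x = g y" "h x = h y" for x y
      by (rule u[OF that(1,2,4,3)])
  qed (simp_all add: m)
qed

lemma pullback_exists:
  assumes p: "p \<in> Hom R B C" and q: "q \<in> Hom R B' C" and M: "B \<in> Mods" "B' \<in> Mods" "C \<in> Mods"
  obtains Q h g where "is_pullback Q h g B p C q B'"
proof -
  obtain S a b where S: "biprod S a b B B'" by (rule biprod_exists[OF M(1,2)])
  have Sd: "S \<in> Mods" "a \<in> Hom R S B" "b \<in> Hom R S B'" using S by (simp_all add: biprod_def)
  obtain pa where pa: "pa \<in> Hom R S C" "\<And>x. x \<in> carrier S \<Longrightarrow> pa x = p (a x)"
    by (rule Hom_comp[OF Sd(2) p Sd(1)]) (rule that)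
  obtain qb where qb: "qb \<in> Hom R S C" "\<And>x. x \<in> carrier S \<Longrightarrow> qb x = q (b x)"
    by (rule Hom_comp[OF Sd(3) q Sd(1)]) (rule that)
  obtain d where d: "d \<in> Hom R S C" "\<And>x. x \<in> carrier S \<Longrightarrow> d x = pa x \<ominus>\<^bsub>C\<^esub> qb x"
    using Hom_diff[OF pa(1) qb(1) Sd(1) M(3)] by blast
  let ?Q = "kernel_module S d C"
  have QM: "?Q \<in> Mods" by (rule kernel_Mod[OF d(1) Sd(1) M(3)])
  have Qc: "x \<in> carrier ?Q \<longleftrightarrow> x \<in> carrier S \<and> p (a x) = q (b x)" for x
    using mod_minus_eq_0[OF M(3) Hom_closed[OF pa(1), of x] Hom_closed[OF qb(1), of x]] pa(2)[of x] qb(2)[of x] d(2)[of x]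
    by (auto simp: kernel_module_def kernel_of_def)
  have o: "add ?Q = add S" "smult ?Q = smult S" by (simp_all add: kernel_module_def)
  have "is_pullback ?Q (restrict a (carrier ?Q)) (restrict b (carrier ?Q)) B p C q B'"
    unfolding is_pullback_def
  proof (intro conjI ballI impI QM)
    show "restrict a (carrier ?Q) \<in> Hom R ?Q B" "restrict b (carrier ?Q) \<in> Hom R ?Q B'"
      by (rule Hom_restrict; use Sd QM in \<open>simp add: o Qc\<close>)+
    show "p (restrict a (carrier ?Q) x) = q (restrict b (carrier ?Q) x)" if "x \<in> carrier ?Q" for x
      using that Qc by simp
    fix y z assume yz: "y \<in> carrier B" "z \<in> carrier B'" "p y = q z"
    moreover from S yz have "\<exists>x\<in>carrier S. a x = y \<and> b x = z" by (simp add: biprod_def)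
    then obtain x where "x \<in> carrier S" "a x = y" "b x = z" by blast
    ultimately show "\<exists>x\<in>carrier ?Q. restrict a (carrier ?Q) x = y \<and> restrict b (carrier ?Q) x = z"
      using Qc by (intro bexI[of _ x]) simp_all
  next
    fix x y assume "x \<in> carrier ?Q" "y \<in> carrier ?Q" "restrict a (carrier ?Q) x = restrict a (carrier ?Q) y"
      "restrict b (carrier ?Q) x = restrict b (carrier ?Q) y"
    then show "x = y" using S Qc by (simp add: biprod_def)
  qed
  then show thesis by (rule that)
qed

text \<open>The pullback projection onto \<open>B'\<close> is onto with the same kernel
  \<open>A\<close>. Applied to a square of two epimorphisms in both directions, it yields two short
  exact sequences with the same middle term.\<close>

lemma pullback_ses:
  assumes Q: "is_pullback Q h g B p C q B'" and B: "ses A i B p C" and q: "q \<in> Hom R B' C" and B': "B' \<in> Mods"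
  obtains s where "ses A s Q g B'"
proof -
  note Bd = sesD[OF B]
  have Qd: "Q \<in> Mods" "h \<in> Hom R Q B" "g \<in> Hom R Q B'" "\<And>x. x \<in> carrier Q \<Longrightarrow> p (h x) = q (g x)"
    using Q by (simp_all add: is_pullback_def)
  have Qe: "\<exists>x\<in>carrier Q. h x = b \<and> g x = b'" if "b \<in> carrier B" "b' \<in> carrier B'" "p b = q b'" for b b'
    using Q that by (simp add: is_pullback_def)
  have Qu: "x = y" if "x \<in> carrier Q" "y \<in> carrier Q" "h x = h y" "g x = g y" for x y
    using Q that by (simp add: is_pullback_def)
  have "\<forall>x\<in>carrier A. \<exists>y\<in>carrier Q. h y = i x \<and> g y = \<zero>\<^bsub>B'\<^esub>"
    using Qe ses_zero[OF B] Hom_zero[OF q B' Bd(3)] Hom_closed[OF Bd(4)] B' by simp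
  then obtain s0 where s0: "\<And>x. x \<in> carrier A \<Longrightarrow> s0 x \<in> carrier Q \<and> h (s0 x) = i x \<and> g (s0 x) = \<zero>\<^bsub>B'\<^esub>"
    by metis
  then have s1: "s0 x \<in> carrier Q" "h (s0 x) = i x" "g (s0 x) = \<zero>\<^bsub>B'\<^esub>" if "x \<in> carrier A" for x
    using that by simp_all
  let ?s = "restrict s0 (carrier A)"
  have s: "?s \<in> Hom R A Q"
  proof (rule Hom_restrict)
    fix x y assume xy: "x \<in> carrier A" "y \<in> carrier A"
    show "s0 (x \<oplus>\<^bsub>A\<^esub> y) = s0 x \<oplus>\<^bsub>Q\<^esub> s0 y"
      by (rule Qu) (use xy Bd(1) Qd(1) B' in \<open>simp_all add: s1 Hom_add[OF Qd(2)] Hom_add[OF Qd(3)] Hom_add[OF Bd(4)]\<close>)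
  next
    fix a x assume x: "a \<in> carrier R" "x \<in> carrier A"
    show "s0 (a \<odot>\<^bsub>A\<^esub> x) = a \<odot>\<^bsub>Q\<^esub> s0 x"
      by (rule Qu) (use x Bd(1) Qd(1) B' in \<open>simp_all add: s1 Hom_smult[OF Qd(2)] Hom_smult[OF Qd(3)] Hom_smult[OF Bd(4)]\<close>)
  qed (use s1 Bd(1) in simp_all)
  have "ses A ?s Q g B'"
  proof (rule sesI[OF Bd(1) Qd(1) B' s Qd(3)])
    fix x assume x: "x \<in> carrier A" "?s x = \<zero>\<^bsub>Q\<^esub>"
    then have "i x = \<zero>\<^bsub>B\<^esub>" using s1(2)[OF x(1)] Hom_zero[OF Qd(2,1) Bd(2)] by simp
    then show "x = \<zero>\<^bsub>A\<^esub>" by (rule ses_inj_0[OF B x(1)])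
  next
    fix x assume "x \<in> carrier A"
    then show "g (?s x) = \<zero>\<^bsub>B'\<^esub>" using s1(3) by simp
  next
    fix y assume y: "y \<in> carrier Q" "g y = \<zero>\<^bsub>B'\<^esub>"
    have "p (h y) = \<zero>\<^bsub>C\<^esub>" using Qd(4)[OF y(1)] y(2) Hom_zero[OF q B' Bd(3)] by simp
    then obtain x where x: "x \<in> carrier A" "i x = h y" using ses_mid[OF B Hom_closed[OF Qd(2) y(1)]] by blast
    have "s0 x = y" by (rule Qu) (use x y s1 in simp_all)
    then show "\<exists>x\<in>carrier A. ?s x = y" using x(1) by (intro bexI[of _ x]) simp_all
  next
    fix z assume z: "z \<in> carrier B'"
    obtain b where "b \<in> carrier B" "p b = q z" using ses_surj[OF B Hom_closed[OF q z]] by blast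
    then show "\<exists>y\<in>carrier Q. g y = z" using Qe[OF _ z] by blast
  qed
  then show thesis by (rule that)
qed

text \<open>\<open>V\<close> is the preimage of \<open>M\<close> in \<open>I\<close>: it contains
  the kernel \<open>D\<close> with quotient \<open>M\<close>, and the quotient of \<open>I\<close>
  by it is \<open>W\<close>.\<close>

lemma ses_preimage:
  assumes Q: "ses M i Q g W" and I: "ses D j I h Q"
  obtains V s t u v where "ses D s V t M" "ses V u I v W"
proof -
  note Qd = sesD[OF Q] and Id = sesD[OF I]
  obtain V u t where V: "is_pullback V u t I h Q i M" by (rule pullback_exists[OF Id(5) Qd(4) Id(2) Qd(1,2)])
  obtain s where s: "ses D s V t M" by (rule pullback_ses[OF V I Qd(4,1)])
  have Vd: "V \<in> Mods" "u \<in> Hom R V I" "t \<in> Hom R V M" "\<And>x. x \<in> carrier V \<Longrightarrow> h (u x) = i (t x)"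
    using V by (simp_all add: is_pullback_def)
  have Ve: "\<exists>x\<in>carrier V. u x = b \<and> t x = b'" if "b \<in> carrier I" "b' \<in> carrier M" "h b = i b'" for b b'
    using V that by (simp add: is_pullback_def)
  have Vu: "x = y" if "x \<in> carrier V" "y \<in> carrier V" "u x = u y" "t x = t y" for x y
    using V that by (simp add: is_pullback_def)
  obtain v where v: "v \<in> Hom R I W" "\<And>x. x \<in> carrier I \<Longrightarrow> v x = g (h x)"
    by (rule Hom_comp[OF Id(5) Qd(5) Id(2)]) (rule that)
  have "ses V u I v W"
  proof (rule sesI[OF Vd(1) Id(2) Qd(3) Vd(2) v(1)])
    fix x assume x: "x \<in> carrier V" "u x = \<zero>\<^bsub>I\<^esub>"
    have "i (t x) = \<zero>\<^bsub>Q\<^esub>" using Vd(4)[OF x(1)] x(2) Hom_zero[OF Id(5,2,3)] by simp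
    then have "t x = \<zero>\<^bsub>M\<^esub>" by (rule ses_inj_0[OF Q Hom_closed[OF Vd(3) x(1)]])
    with x Vd(1) show "x = \<zero>\<^bsub>V\<^esub>"
      by - (rule Vu, simp_all add: Hom_zero[OF Vd(2,1) Id(2)] Hom_zero[OF Vd(3,1) Qd(1)])
  next
    fix x assume x: "x \<in> carrier V"
    show "v (u x) = \<zero>\<^bsub>W\<^esub>"
      using v(2)[OF Hom_closed[OF Vd(2) x]] Vd(4)[OF x] ses_zero[OF Q Hom_closed[OF Vd(3) x]] by simp
  next
    fix y assume y: "y \<in> carrier I" "v y = \<zero>\<^bsub>W\<^esub>"
    then have "g (h y) = \<zero>\<^bsub>W\<^esub>" using v(2) by simp
    then obtain m where "m \<in> carrier M" "i m = h y" using ses_mid[OF Q Hom_closed[OF Id(5) y(1)]] by blast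
    then show "\<exists>x\<in>carrier V. u x = y" using Ve[OF y(1)] by metis
  next
    fix z assume z: "z \<in> carrier W"
    obtain x where x: "x \<in> carrier Q" "g x = z" using ses_surj[OF Q z] by blast
    obtain y where "y \<in> carrier I" "h y = x" using ses_surj[OF I x(1)] by blast
    then show "\<exists>y\<in>carrier I. v y = z" using x(2) v(2) by blast
  qed
  then show thesis by (rule that[OF s])
qed

section \<open>Approximation by Ding injectives and by modules of finite injective dimension\<close>

lemma fin_inj_dim_Mods: "fin_inj_dim R U \<subseteq> Mods"
  by (auto simp: fin_inj_dim_def)

lemma Inj_subset_fin_inj_dim: "Inj R U \<subseteq> fin_inj_dim R U"
  using ext_zero_Inj Inj_Mods by (auto simp: fin_inj_dim_iff)

text \<open>For 0 -> M -> D -> L -> 0, pull \<open>D -> L\<close> back along an approximation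
  \<open>W -> L\<close> with Ding injective kernel \<open>D'\<close>. The pullback \<open>Q\<close>
  is an extension of \<open>D\<close> by \<open>D'\<close>, hence Ding injective, and 0 -> M -> Q ->
  W -> 0 is the second sequence. Covering \<open>Q\<close> by an injective and taking the preimage
  \<open>V\<close> of \<open>M\<close> gives the first; \<open>V\<close> embeds in that injective
  with quotient \<open>W\<close>, so its injective dimension grows by at most one.\<close>

lemma approximation:
  assumes "M \<in> Mods" "coresolved (Ding_inj R U) k M"
  shows "(\<exists>D\<in>Ding_inj R U. \<exists>W\<in>fin_inj_dim R U. \<exists>i p. ses D i W p M) \<and>
    (\<exists>D\<in>Ding_inj R U. \<exists>W\<in>fin_inj_dim R U. \<exists>i p. ses M i D p W)"
  using assms
proof (induction k arbitrary: M)
  case 0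
  then have M: "M \<in> Ding_inj R U" using Ding_inj_iso by auto
  obtain Z p where Z: "zero_obj Z" "ses M (\<lambda>x\<in>carrier M. x) M p Z" by (rule ses_zero_right[OF 0(1)])
  have "Z \<in> fin_inj_dim R U" using zero_obj_Inj[OF Z(1)] Inj_subset_fin_inj_dim by blast
  then show ?case using Z(2) M Ding_injD(2)[OF M] Inj_subset_fin_inj_dim by blast
next
  case (Suc k)
  then obtain D L i p where D: "D \<in> Ding_inj R U" "ses M i D p L" "coresolved (Ding_inj R U) k L" by auto
  note Dd = sesD[OF D(2)]
  obtain D' W j r where W: "D' \<in> Ding_inj R U" "W \<in> fin_inj_dim R U" "ses D' j W r L"
    using Suc.IH[OF Dd(3) D(3)] by blast
  note Wd = sesD[OF W(3)]
  obtain Q f g where Q: "is_pullback Q f g D p L r W" by (rule pullback_exists[OF Dd(5) Wd(5) Dd(2) Wd(2) Dd(3)])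
  obtain s where s: "ses M s Q g W" by (rule pullback_ses[OF Q D(2) Wd(5,2)])
  obtain t where t: "ses D' t Q f D" by (rule pullback_ses[OF is_pullback_sym[OF Q] W(3) Dd(5,2)])
  have QD: "Q \<in> Ding_inj R U" by (rule Ding_inj_extension[OF t W(1) D(1)])
  obtain I D'' l m where I: "I \<in> Inj R U" "D'' \<in> Ding_inj R U" "ses D'' l I m Q" using Ding_injD(2)[OF QD] by blast
  obtain V a b c e where V: "ses D'' a V b M" "ses V c I e W" by (rule ses_preimage[OF s I(3)])
  obtain n where n: "\<And>X. X \<in> Mods \<Longrightarrow> ext_zero n X W" using W(2) by (auto simp: fin_inj_dim_iff)
  have "ext_zero (Suc n) X V" if "X \<in> Mods" for X using ext_zero_cosyzygy[OF that V(2) I(1)] n[OF that] by blast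
  then have "V \<in> fin_inj_dim R U" using sesD(1)[OF V(2)] by (auto simp: fin_inj_dim_iff simp del: ext_zero.simps)
  then show ?case using V(1) I(2) s QD W(2) by blast
qed

text \<open>Induction on the injective dimension of \<open>W\<close> with the degree generalised:
  Ext of \<open>W\<close> sits between Ext of an injective in the same degree and Ext of the
  cosyzygy one degree higher.\<close>

lemma ext_zero_fin_inj_dim:
  assumes N: "N \<in> ext_perp (Inj R U)" and W: "W \<in> fin_inj_dim R U"
  shows "ext_zero k W N"
proof -
  have NM: "N \<in> Mods" using N by (simp add: ext_perp_def)
  have "ext_zero k W N" if "W \<in> Mods" "\<And>X. X \<in> Mods \<Longrightarrow> ext_zero n X W" for n W k
    using that
  proof (induction n arbitrary: W k)
    case 0
    then have "W \<in> Inj R U" by (intro InjI_orth) simp_all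
    then show ?case using N by (simp add: ext_perp_def)
  next
    case (Suc n)
    obtain i E p L where E: "E \<in> Inj R U" "ses W i E p L" by (rule cosyzygy[OF Suc.prems(1)])
    have "ext_zero (Suc k) L N"
      by (rule Suc.IH[OF sesD(3)[OF E(2)]]) (use Suc.prems(2) ext_zero_cosyzygy[OF _ E(2,1)] in blast)
    moreover have "ext_zero k E N" using N E(1) by (simp add: ext_perp_def)
    ultimately show ?case by (intro ext_zero_subobject[OF E(2) NM])
  qed
  then show ?thesis using W by (auto simp: fin_inj_dim_iff)
qed

lemma ses_retraction:
  assumes S: "ses N i M p L" "orth L N"
  shows "\<exists>r\<in>Hom R M N. \<forall>x\<in>carrier N. r (i x) = x"
proof -
  obtain r where "r \<in> Hom R M N" "\<And>x. x \<in> carrier N \<Longrightarrow> r (i x) = (\<lambda>x\<in>carrier N. x) x"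
    by (rule orth_extend[OF S(2,1) Hom_id[OF sesD(1)[OF S(1)]]]) (rule that)
  then show ?thesis by auto
qed

text \<open>The cokernel of an embedding of \<open>W\<close> into an injective again has finite
  injective dimension, so it is orthogonal to \<open>W\<close>; the embedding splits and
  \<open>W\<close> is a retract of an injective.\<close>

lemma fin_inj_dim_perp_Inj:
  assumes W: "W \<in> fin_inj_dim R U" "W \<in> ext_perp (Inj R U)"
  shows "W \<in> Inj R U"
proof -
  have WM: "W \<in> Mods" using W(2) by (simp add: ext_perp_def)
  obtain i E p L where E: "E \<in> Inj R U" "ses W i E p L" by (rule cosyzygy[OF WM])
  obtain n where n: "\<And>X. X \<in> Mods \<Longrightarrow> ext_zero n X W" using W(1) by (auto simp: fin_inj_dim_iff)
  have "ext_zero n X L" if "X \<in> Mods" for X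
    \<comment> \<open>The bound for \<open>W\<close> is first raised to \<open>Suc n\<close>;
      shifting to the cosyzygy lowers it to \<open>n\<close> again.\<close>
    using ext_zero_mono_inj[OF WM n, of "Suc n" X] ext_zero_cosyzygy[OF that E(2,1)] that by simp
  then have "L \<in> fin_inj_dim R U" using sesD(3)[OF E(2)] by (auto simp: fin_inj_dim_iff)
  then have "orth L W" using ext_zero_fin_inj_dim[OF W(2), of L 0] by simp
  then obtain r where r: "r \<in> Hom R E W" "\<forall>x\<in>carrier W. r (i x) = x" using ses_retraction[OF E(2)] by blast
  have "ext_zero 0 X W" if "X \<in> Mods" for X
    by (rule ext_zero_retract[OF WM sesD(2,4)[OF E(2)] r(1) _ that ext_zero_Inj[OF E(1) that]]) (use r(2) in blast)
  then show ?thesis by (intro InjI_orth[OF WM]) simp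
qed

text \<open>Coinduction on the orthogonal class itself. The kernel \<open>D\<close> stays in it, and
  \<open>D\<close> being Ding injective is what upgrades vanishing against injectives to vanishing
  against absolutely pure modules.\<close>

lemma perp_subset_Ding_inj:
  assumes fin: "\<And>M. M \<in> Mods \<Longrightarrow> \<exists>k. coresolved (Ding_inj R U) k M"
  shows "ext_perp (Inj R U) \<subseteq> Ding_inj R U"
proof
  fix M assume "M \<in> ext_perp (Inj R U)"
  then show "M \<in> Ding_inj R U"
  proof (rule Ding_inj_coinduct)
    fix M assume M: "M \<in> ext_perp (Inj R U)"
    have MM: "M \<in> Mods" using M by (simp add: ext_perp_def)
    obtain D W i p where D: "D \<in> Ding_inj R U" "W \<in> fin_inj_dim R U" "ses D i W p M"
      using approximation[OF MM] fin[OF MM] by blast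
    have DP: "D \<in> ext_perp (Inj R U)" using Ding_inj_subset_perp(2) D(1) by blast
    have "ext_zero n E W" if "E \<in> Inj R U" for E n
      using ext_zero_middle[OF D(3) Inj_Mods[OF that]] M DP that by (simp add: ext_perp_def)
    then have "W \<in> ext_perp (Inj R U)" using D(2) fin_inj_dim_Mods by (auto simp: ext_perp_def)
    then have WI: "W \<in> Inj R U" by (rule fin_inj_dim_perp_Inj[OF D(2)])
    then show "\<exists>I\<in>Inj R U. \<exists>M'\<in>ext_perp (Inj R U). \<exists>i p. ses M' i I p M" using D(3) DP by blast
    show "ext_zero n E M" if E: "E \<in> Abs_pure R U" for E n
    proof -
      have EM: "E \<in> Mods" using E Abs_pure_Mods by blast
      show ?thesis by (rule ext_zero_right[OF D(3) EM ext_zero_Inj[OF WI EM] Ding_injD(1)[OF D(1) E]])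
    qed
  qed
qed

text \<open>Each term of the coresolution costs one degree. All degrees from \<open>k\<close> on are
  covered since the length varies with \<open>M\<close> while one common degree is wanted.\<close>

lemma ext_zero_coresolved_Ding:
  assumes "X \<in> Abs_pure R U"
  shows "\<lbrakk>coresolved (Ding_inj R U) k M; M \<in> Mods; k \<le> m\<rbrakk> \<Longrightarrow> ext_zero m X M"
proof (induction k arbitrary: M m)
  case 0
  then have "M \<in> Ding_inj R U" using Ding_inj_iso by auto
  then show ?case by (rule Ding_injD(1)[OF _ assms])
next
  case (Suc k)
  then obtain D L i p where D: "D \<in> Ding_inj R U" "ses M i D p L" "coresolved (Ding_inj R U) k L" by auto
  obtain l where l: "m = Suc l" using Suc.prems(3) by (cases m) auto
  have XM: "X \<in> Mods" using assms Abs_pure_Mods by blast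
  have "ext_zero l X L" using Suc.IH[OF D(3) sesD(3)[OF D(2)]] Suc.prems(3) l by simp
  then show ?case unfolding l by (intro ext_zero_left[OF D(2) XM] Ding_injD(1)[OF D(1) assms])
qed

text \<open>Every cosyzygy lowers the threshold of vanishing by one, so the m-th one is orthogonal
  to injectives in all positive degrees; the injectives in between lie in the class too.\<close>

lemma coresolved_perp:
  "\<lbrakk>M \<in> Mods; \<And>E k. \<lbrakk>E \<in> Inj R U; m \<le> k\<rbrakk> \<Longrightarrow> ext_zero k E M\<rbrakk> \<Longrightarrow>
     coresolved (ext_perp (Inj R U)) m M"
proof (induction m arbitrary: M)
  case 0
  then have "M \<in> ext_perp (Inj R U)" by (simp add: ext_perp_def)
  then show ?case using isomorphic_refl[OF 0(1)] by auto
next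
  case (Suc m)
  obtain i E p L where E: "E \<in> Inj R U" "ses M i E p L" by (rule cosyzygy[OF Suc.prems(1)])
  have "coresolved (ext_perp (Inj R U)) m L"
    by (rule Suc.IH[OF sesD(3)[OF E(2)]])
      (use Suc.prems(2) ext_zero_cosyzygy[OF Inj_Mods E(2,1)] Suc_le_mono in blast)
  moreover have "E \<in> ext_perp (Inj R U)" using E(1) Inj_subset_Ding_inj Ding_inj_subset_perp(2) by blast
  ultimately show ?case using E(2) by auto
qed

section \<open>Comparison of the global dimensions\<close>

lemma pd_class_le_iff:
  assumes "\<C> \<subseteq> Mods"
  shows "pd_class R U \<C> \<le> enat n \<longleftrightarrow> (\<forall>X\<in>\<C>. \<forall>N\<in>Mods. ext_zero n X N)"
  unfolding pd_class_def SUP_le_iff using proj_dim_le_iff assms by blast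

lemma gl_DID_le_iff: "gl_DID R U \<le> enat n \<longleftrightarrow> (\<forall>M\<in>Mods. \<exists>k\<le>n. coresolved (Ding_inj R U) k M)"
  unfolding gl_DID_def SUP_le_iff Ding_inj_dim_def using coresolution_dim_le_iff[OF Ding_inj_Mods] by blast

lemma pd_class_le_gl_DID: "pd_class R U (Abs_pure R U) \<le> gl_DID R U"
proof (cases "gl_DID R U")
  case (enat n)
  then have "\<forall>M\<in>Mods. \<exists>k\<le>n. coresolved (Ding_inj R U) k M" using gl_DID_le_iff[of n] by simp
  then have "pd_class R U (Abs_pure R U) \<le> enat n"
    unfolding pd_class_le_iff[OF Abs_pure_Mods] using ext_zero_coresolved_Ding by blast
  then show ?thesis using enat by simp
qed simp

lemma pd_class_Inj_le: "pd_class R U (Inj R U) \<le> pd_class R U (Abs_pure R U)"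
  unfolding pd_class_def by (rule SUP_subset_mono[OF Inj_subset_Abs_pure]) simp

lemma gl_DID_le_pd_class:
  assumes "Ding_inj R U = ext_perp (Inj R U)"
  shows "gl_DID R U \<le> pd_class R U (Inj R U)"
proof (cases "pd_class R U (Inj R U)")
  case (enat n)
  then have *: "\<forall>X\<in>Inj R U. \<forall>N\<in>Mods. ext_zero n X N" using pd_class_le_iff[OF Inj_subset_Mods, of n] by simp
  have "coresolved (Ding_inj R U) n M" if M: "M \<in> Mods" for M
    unfolding assms
    \<comment> \<open>The bound on the projective dimension gives vanishing in one degree;
      monotonicity gives it in all later degrees.\<close>
    by (rule coresolved_perp[OF M]) (use * ext_zero_mono_proj[OF Inj_Mods _ _ M] in blast)
  then have "gl_DID R U \<le> enat n" unfolding gl_DID_le_iff by blast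
  then show ?thesis using enat by simp
qed simp

section \<open>The cotorsion pair and the equivalences\<close>

lemma short_exact_iff: "short_exact R A B C \<longleftrightarrow> (\<exists>i p. ses A i B p C)" if "A \<in> Mods" "B \<in> Mods" "C \<in> Mods"
  using that unfolding short_exact_def ses_def by blast

lemma finite_gl_DID:
  assumes "gl_DID R U < \<infinity>" "M \<in> Mods"
  shows "\<exists>k. coresolved (Ding_inj R U) k M"
proof -
  obtain n where "gl_DID R U = enat n" using assms(1) by auto
  then show ?thesis using gl_DID_le_iff[of n] assms(2) by auto
qed

lemma trivial_Ext_1: "\<lbrakk>X \<in> Mods; N \<in> Mods\<rbrakk> \<Longrightarrow> trivial_group (Ext R U 1 X N) \<longleftrightarrow> orth X N"
  using trivial_Ext_iff[of X N 0] by simp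

text \<open>A module orthogonal to one class makes its approximation sequence split, so it is a
  retract of a module in the other class; the retraction passes the relevant vanishing of Ext on to
  it.\<close>

lemma Ding_cotorsion_pair:
  assumes fin: "\<And>M. M \<in> Mods \<Longrightarrow> \<exists>k. coresolved (Ding_inj R U) k M"
  shows "cotorsion_pair R U (fin_inj_dim R U) (Ding_inj R U)"
proof -
  have DM: "D \<in> Mods" "D \<in> ext_perp (Inj R U)" if "D \<in> Ding_inj R U" for D
    using that Ding_inj_Mods Ding_inj_subset_perp(2) by blast+
  have WM: "W \<in> Mods" if "W \<in> fin_inj_dim R U" for W using that fin_inj_dim_Mods by blast
  have triv: "orth W D" if "W \<in> fin_inj_dim R U" "D \<in> Ding_inj R U" for W D
    using ext_zero_fin_inj_dim[OF DM(2)[OF that(2)] that(1), of 0] by simp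
  have left: "X \<in> fin_inj_dim R U" if X: "X \<in> Mods" "\<And>D. D \<in> Ding_inj R U \<Longrightarrow> orth X D" for X
  proof -
    obtain D W i p where D: "D \<in> Ding_inj R U" "W \<in> fin_inj_dim R U" "ses D i W p X"
      using approximation[OF X(1)] fin[OF X(1)] by blast
    obtain s where s: "s \<in> Hom R X W" "\<And>x. x \<in> carrier X \<Longrightarrow> p (s x) = (\<lambda>x\<in>carrier X. x) x"
      by (rule orth_lift[OF X(2)[OF D(1)] X(1) D(3) Hom_id[OF X(1)]]) (rule that)
    obtain n where n: "\<And>Y. Y \<in> Mods \<Longrightarrow> ext_zero n Y W" using D(2) by (auto simp: fin_inj_dim_iff)
    have "ext_zero n Y X" if "Y \<in> Mods" for Y
      by (rule ext_zero_retract[OF X(1) WM[OF D(2)] s(1) sesD(5)[OF D(3)] _ that n[OF that]]) (use s(2) in simp)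
    then show ?thesis using X(1) by (auto simp: fin_inj_dim_iff)
  qed
  have right: "Y \<in> Ding_inj R U" if Y: "Y \<in> Mods" "\<And>W. W \<in> fin_inj_dim R U \<Longrightarrow> orth W Y" for Y
  proof -
    obtain D W i p where D: "D \<in> Ding_inj R U" "W \<in> fin_inj_dim R U" "ses Y i D p W"
      using approximation[OF Y(1)] fin[OF Y(1)] by blast
    obtain r where r: "r \<in> Hom R D Y" "\<forall>x\<in>carrier Y. r (i x) = x"
      using ses_retraction[OF D(3) Y(2)[OF D(2)]] by blast
    have "ext_zero n E Y" if E: "E \<in> Inj R U" for E n
      by (rule ext_zero_retract[OF Y(1) DM(1)[OF D(1)] sesD(4)[OF D(3)] r(1) _ Inj_Mods[OF E]])
        (use r(2) DM(2)[OF D(1)] E in \<open>auto simp: ext_perp_def\<close>)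
    \<comment> \<open>The retract inherits vanishing of Ext against injectives; Ding injectivity is
      recovered from the inclusion of the orthogonal class in \<open>Ding_inj\<close>.\<close>
    then show ?thesis using perp_subset_Ding_inj[OF fin] Y(1) by (auto simp: ext_perp_def)
  qed
  show ?thesis
    unfolding cotorsion_pair_def
  proof
    show "fin_inj_dim R U = {X \<in> Mods. \<forall>D\<in>Ding_inj R U. trivial_group (Ext R U 1 X D)}"
      using left triv trivial_Ext_1 DM(1) WM by blast
    show "Ding_inj R U = {Y \<in> Mods. \<forall>W\<in>fin_inj_dim R U. trivial_group (Ext R U 1 W Y)}"
      using right triv trivial_Ext_1 DM(1) WM by blast
  qed
qed

lemma Ding_complete_cotorsion_pair:
  assumes fin: "\<And>M. M \<in> Mods \<Longrightarrow> \<exists>k. coresolved (Ding_inj R U) k M"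
  shows "complete_cotorsion_pair R U (fin_inj_dim R U) (Ding_inj R U)"
proof -
  have "(\<exists>B\<in>Ding_inj R U. \<exists>A\<in>fin_inj_dim R U. short_exact R B A C) \<and>
      (\<exists>B\<in>Ding_inj R U. \<exists>A\<in>fin_inj_dim R U. short_exact R C B A)" if C: "C \<in> Mods" for C
    using approximation[OF C] fin[OF C] C short_exact_iff Ding_inj_Mods fin_inj_dim_Mods by (meson subsetD)
  then show ?thesis
    unfolding complete_cotorsion_pair_def using Ding_cotorsion_pair[OF fin] by blast
qed

text \<open>Both closure properties are pieces of long exact sequences. A kernel may have injective
  dimension one above that of the quotient, whence \<open>Suc (max n m)\<close>.\<close>

lemma Ding_hereditary:
  assumes D: "Ding_inj R U = ext_perp (Inj R U)"
  shows "hereditary R U (fin_inj_dim R U) (Ding_inj R U)"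
  unfolding hereditary_def
proof (intro conjI ballI impI)
  fix K A A' assume *: "K \<in> Mods" "A \<in> fin_inj_dim R U" "A' \<in> fin_inj_dim R U" "short_exact R K A A'"
  then obtain i p where S: "ses K i A p A'" using short_exact_iff fin_inj_dim_Mods by blast
  obtain n m where n: "\<And>X. X \<in> Mods \<Longrightarrow> ext_zero n X A" "\<And>X. X \<in> Mods \<Longrightarrow> ext_zero m X A'"
    using *(2,3) by (auto simp: fin_inj_dim_iff)
  have "ext_zero (Suc (max n m)) X K" if X: "X \<in> Mods" for X
  proof (rule ext_zero_left[OF S X])
    show "ext_zero (max n m) X A'" by (rule ext_zero_mono_inj[OF sesD(3)[OF S] n(2) _ X]) simp_all
    show "ext_zero (Suc (max n m)) X A" by (rule ext_zero_mono_inj[OF sesD(2)[OF S] n(1) _ X]) simp_all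
  qed
  then show "K \<in> fin_inj_dim R U" using *(1) by (auto simp: fin_inj_dim_iff simp del: ext_zero.simps)
next
  fix B B' L assume *: "B \<in> Ding_inj R U" "B' \<in> Ding_inj R U" "L \<in> Mods" "short_exact R B B' L"
  then obtain i p where S: "ses B i B' p L" using short_exact_iff Ding_inj_Mods by blast
  have "ext_zero n E L" if "E \<in> Inj R U" for E n
    by (rule ext_zero_right[OF S Inj_Mods[OF that]]) (use *(1,2) that D in \<open>auto simp: ext_perp_def simp del: ext_zero.simps\<close>)
  then show "L \<in> Ding_inj R U" using *(3) D by (simp add: ext_perp_def)
qed

lemma cotorsion_pair_perp:
  assumes "cotorsion_pair R U (fin_inj_dim R U) (Ding_inj R U)"
  shows "Ding_inj R U = ext_perp (Inj R U)"
proof (intro subset_antisym Ding_inj_subset_perp(2) subsetI)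
  fix M assume M: "M \<in> ext_perp (Inj R U)"
  then have MM: "M \<in> Mods" by (simp add: ext_perp_def)
  have "trivial_group (Ext R U 1 W M)" if "W \<in> fin_inj_dim R U" for W
    using ext_zero_fin_inj_dim[OF M that, of 0] trivial_Ext_1[OF _ MM] that fin_inj_dim_Mods by auto
  then show "M \<in> Ding_inj R U" using assms MM unfolding cotorsion_pair_def by blast
qed

end

theorem lemma5p9:
  fixes R :: "('r, 'x) ring_scheme" and U :: "'m set set"
  assumes "ring R" and "module_universe R U"
  shows "let a = (complete_cotorsion_pair R U (fin_inj_dim R U) (Ding_inj R U) \<and>
                  hereditary R U (fin_inj_dim R U) (Ding_inj R U) \<and>
                  pd_class R U (Inj R U) < \<infinity>);
             b = (Ding_inj R U = perp R U (Inj R U) \<and> pd_class R U (Inj R U) < \<infinity>);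
             c = (gl_DID R U < \<infinity>)
         in (a \<longleftrightarrow> b) \<and> (b \<longleftrightarrow> c) \<and>
            (a \<or> b \<or> c \<longrightarrow>
               gl_DID R U = pd_class R U (Abs_pure R U) \<and>
               pd_class R U (Abs_pure R U) = pd_class R U (Inj R U))"
proof -
  interpret module_category R U by (rule module_category.intro[OF assms])
  let ?a = "complete_cotorsion_pair R U (fin_inj_dim R U) (Ding_inj R U) \<and>
    hereditary R U (fin_inj_dim R U) (Ding_inj R U) \<and> pd_class R U (Inj R U) < \<infinity>"
  let ?b = "Ding_inj R U = perp R U (Inj R U) \<and> pd_class R U (Inj R U) < \<infinity>"
  let ?c = "gl_DID R U < \<infinity>"
  note P = perp_eq[OF Inj_subset_Mods]
  have ab: ?b if ?a
    using that cotorsion_pair_perp P unfolding complete_cotorsion_pair_def by simp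
  have bc: ?c if ?b
    using that gl_DID_le_pd_class P by (metis order.strict_trans1)
  have cb: ?b if ?c
  proof
    show "Ding_inj R U = perp R U (Inj R U)"
      unfolding P using perp_subset_Ding_inj[OF finite_gl_DID[OF that]] Ding_inj_subset_perp(2) by blast
    show "pd_class R U (Inj R U) < \<infinity>"
      using that pd_class_Inj_le pd_class_le_gl_DID by (metis order.strict_trans1)
  qed
  have ca: ?a if ?c
    using cb[OF that] Ding_complete_cotorsion_pair[OF finite_gl_DID[OF that]] Ding_hereditary P by simp
  \<comment> \<open>The three inequalities gl.DID \<le> pd(Inj) \<le> pd(AP) \<le> gl.DID close into
    a cycle; only the one bounding gl.DID uses (b).\<close>
  have eq: "gl_DID R U = pd_class R U (Abs_pure R U) \<and> pd_class R U (Abs_pure R U) = pd_class R U (Inj R U)" if ?b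
    using that gl_DID_le_pd_class P pd_class_Inj_le pd_class_le_gl_DID by (metis order.antisym order.trans)
  show ?thesis unfolding Let_def using ab bc cb ca eq by blast
qed

end
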